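(* Let $\rho:\mathfrak g\to\mathrm{End}(V)$ be a finite-dimensional bottom-weight representation with adapted basis $v_-=v_1,\dots,v_N$ and weights $\omega_1,\dots,\omega_N$. Let $\alpha$ be a root of $\mathfrak g$ with root vector $e_\alpha\in\mathfrak g_\alpha$, and let $i,j$ be indices such that $\omega_j-\omega_i=\alpha$. Consider the vector field $$\mathscr T^\rho_\alpha=\frac{F^\rho_j}{F^\rho_i}\,\mathscr T^{e_\alpha}$$ on the open subset $\{k\in K: F^\rho_i(k)\neq0\}$ of $K$. Then $[\mathscr T^\Lambda,\mathscr T^\rho_\alpha]=0$ on this subset for every $\Lambda\in\mathfrak a$.
   Context: Setting. $\mathfrak g$ is a non-compact real form of a complex semisimple Lie algebra, $\theta$ a Cartan involution of $\mathfrak g$, and $\mathfrak g=\mathfrak k\oplus\mathfrak p$ the Cartan decomposition ($\theta=+1$ on $\mathfrak k$, $\theta=-1$ on $\mathfrak p$). $G$ is the 1-connected Lie group with Lie algebra $\mathfrak g$ and $K\subset G$ is the connected subgroup with Lie algebra $\mathfrak k$. $\mathfrak a\subset\mathfrak p$ is a maximal commutative subspace; for $\alpha\in\mathfrak a^*$ let $\mathfrak g_\alpha=\{X\in\mathfrak g: [H,X]=\alpha(H)X\ \forall H\in\mathfrak a\}$; nonzero $\alpha$ with $\mathfrak g_\alpha\ne0$ are the (restricted) roots. A set $\Delta_+$ of positive roots is fixed. Set $\mathfrak b_-=\mathfrak a\oplus\bigoplus_{\alpha\in\Delta_+}\mathfrak g_{-\alpha}$. Then $\mathfrak g=\mathfrak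 k\oplus\mathfrak b_-$, and $M:\mathfrak g\to\mathfrak k$ denotes the projection onto $\mathfrak k$ along $\mathfrak b_-$. Generalised Toda fields. For $X\in\mathfrak g$, $\mathscr T^X$ is the vector field on $K$ given by $\mathscr T^X(k)=dR_k(M(Ad_k(X)))$, where $R_k$ is right translation by $k$ and $Ad$ is the adjoint action of $K\subset G$ on $\mathfrak g$. For $X=\Lambda\in\mathfrak a$ it is called a Toda field. Representations. A finite-dimensional bottom-weight representation $\rho:\mathfrak g\to \mathrm{End}(V)$ is a real representation generated by a nonzero vector $v_-$ (lowest vector) such that $\rho(x)v_-=0$ for all $x\in\mathfrak g_{-\alpha}$, $\alpha\in\Delta_+$, and $\rho(h)v_-=\omega_1(h)v_-$ for all $h\in\mathfrak a$, for some $\omega_1\in\mathfrak a^*$. Let $\hat\rho$ be the induced representation of $K$. $V$ is equipped with a $K$-invariant Euclidean inner product $\langle\cdot,\cdot\rangle$ for which $\rho(L)$ is symmetric for $L\in\mathfrak p$ and $\rho(O)$ is skew-symmetric for $O\in\mathfrak k$. An adapted basis is an orthonormal basis $v_-=v_1,\dots,v_N$ of $V$ consisting of weight vectors: $\rho(h)v_i=\omega_i(h)v_i$ for all $h\in\mathfrak a$, with $\omega_i\in\mathfrak a^*$. Define smooth functions on $K$ by $F^\rho_i(k)=\langle\hat\rho(k)(v_i),v_-\rangle$. *)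

theory Defs
  imports "HOL-Analysis.Analysis" "HOL-Algebra.Group"
begin

section \<open>Smooth manifolds\<close>

primrec Ck_on :: "nat \<Rightarrow> ('e::euclidean_space \<Rightarrow> 'f::euclidean_space) \<Rightarrow> 'e set \<Rightarrow> bool" where
  "Ck_on 0 f S \<longleftrightarrow> continuous_on S f"
| "Ck_on (Suc n) f S \<longleftrightarrow>
     (\<forall>x\<in>S. f differentiable (at x)) \<and> (\<forall>v. Ck_on n (\<lambda>x. frechet_derivative f (at x) v) S)"

text \<open>Only used for open \<open>S\<close>.\<close>

definition smooth_on :: "'e::euclidean_space set \<Rightarrow> ('e \<Rightarrow> 'f::euclidean_space) \<Rightarrow> bool" where
  "smooth_on S f \<longleftrightarrow> (\<forall>n. Ck_on n f S)"

record ('m, 'e) manifold =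
  mtop :: "'m topology"
  atlas :: "('m set \<times> ('m \<Rightarrow> 'e)) set"

definition smooth_manifold :: "('m, 'e::euclidean_space) manifold \<Rightarrow> bool" where
  "smooth_manifold M \<longleftrightarrow>
     Hausdorff_space (mtop M) \<and> second_countable (mtop M) \<and>
     (\<Union>(U, \<phi>)\<in>atlas M. U) = topspace (mtop M) \<and>
     (\<forall>(U, \<phi>)\<in>atlas M. openin (mtop M) U \<and> open (\<phi> ` U) \<and>
        homeomorphic_map (subtopology (mtop M) U) (top_of_set (\<phi> ` U)) \<phi>) \<and>
     (\<forall>(U, \<phi>)\<in>atlas M. \<forall>(V, \<psi>)\<in>atlas M.
        smooth_on (\<phi> ` (U \<inter> V)) (\<lambda>x. \<psi> (inv_into U \<phi> x)))"

definition euclidean_manifold :: "'e::euclidean_space set \<Rightarrow> ('e, 'e) manifold" where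
  "euclidean_manifold W = \<lparr>mtop = top_of_set W, atlas = {(W, \<lambda>x. x)}\<rparr>"

definition open_submanifold :: "('m, 'e) manifold \<Rightarrow> 'm set \<Rightarrow> ('m, 'e) manifold" where
  "open_submanifold M W =
     \<lparr>mtop = subtopology (mtop M) W, atlas = (\<lambda>(U, \<phi>). (U \<inter> W, \<phi>)) ` atlas M\<rparr>"

definition prod_manifold ::
  "('m, 'e) manifold \<Rightarrow> ('n, 'f) manifold \<Rightarrow> ('m \<times> 'n, 'e \<times> 'f) manifold" where
  "prod_manifold M N =
     \<lparr>mtop = prod_topology (mtop M) (mtop N),
      atlas = {(U \<times> V, map_prod \<phi> \<psi>) |U V \<phi> \<psi>. (U, \<phi>) \<in> atlas M \<and> (V, \<psi>) \<in> atlas N}\<rparr>"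

definition smooth_map ::
  "('m, 'e::euclidean_space) manifold \<Rightarrow> ('n, 'f::euclidean_space) manifold \<Rightarrow> ('m \<Rightarrow> 'n) \<Rightarrow> bool" where
  "smooth_map M N F \<longleftrightarrow>
     continuous_map (mtop M) (mtop N) F \<and>
     (\<forall>(U, \<phi>)\<in>atlas M. \<forall>(V, \<psi>)\<in>atlas N.
        smooth_on (\<phi> ` (U \<inter> F -` V)) (\<lambda>x. \<psi> (F (inv_into U \<phi> x))))"

definition smooth_near :: "('m, 'e::euclidean_space) manifold \<Rightarrow> 'm \<Rightarrow> ('m \<Rightarrow> real) \<Rightarrow> bool" where
  "smooth_near M p f \<longleftrightarrow>
     (\<exists>W. openin (mtop M) W \<and> p \<in> W \<and>
        smooth_map (open_submanifold M W) (euclidean_manifold UNIV) f)"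


section \<open>Tangent vectors and vector fields\<close>

text \<open>
  A tangent vector at \<open>p\<close> is the directional derivative, along a smooth curve through \<open>p\<close>, of
  real functions that are smooth near \<open>p\<close>. Since functions are total in HOL, it is set to \<open>0\<close> on
  all other functions; this makes equality of tangent vectors equality of functionals. The value
  on \<open>f\<close> only depends on the germ of \<open>f\<close> at \<open>p\<close>.
\<close>

type_synonym 'm tangent = "('m \<Rightarrow> real) \<Rightarrow> real"

definition velocity :: "('m, 'e::euclidean_space) manifold \<Rightarrow> (real \<Rightarrow> 'm) \<Rightarrow> 'm tangent" where
  "velocity M \<gamma> = (\<lambda>f. if smooth_near M (\<gamma> 0) f then deriv (\<lambda>t. f (\<gamma> t)) 0 else 0)"

definition tangent_space :: "('m, 'e::euclidean_space) manifold \<Rightarrow> 'm \<Rightarrow> 'm tangent set" where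
  "tangent_space M p =
     {velocity M \<gamma> |\<gamma> \<epsilon>. \<epsilon> > 0 \<and> smooth_map (euclidean_manifold {- \<epsilon><..<\<epsilon>}) M \<gamma> \<and> \<gamma> 0 = p}"

definition differential ::
  "('m, 'e) manifold \<Rightarrow> ('n, 'f::euclidean_space) manifold \<Rightarrow> ('m \<Rightarrow> 'n) \<Rightarrow> 'm \<Rightarrow>
   'm tangent \<Rightarrow> 'n tangent" where
  "differential M N F p v = (\<lambda>f. if smooth_near N (F p) f then v (\<lambda>x. f (F x)) else 0)"

text \<open>
  A vector field assigns to each point a tangent vector. By locality, the bracket at \<open>p\<close> only
  depends on the two fields in a neighbourhood of \<open>p\<close>, so it can be used for vector fields on
  open subsets.
\<close>

definition vf_bracket ::
  "('m, 'e::euclidean_space) manifold \<Rightarrow> ('m \<Rightarrow> 'm tangent) \<Rightarrow> ('m \<Rightarrow> 'm tangent) \<Rightarrow>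
   'm \<Rightarrow> 'm tangent" where
  "vf_bracket M X Y p =
     (\<lambda>f. if smooth_near M p f then X p (\<lambda>q. Y q f) - Y p (\<lambda>q. X q f) else 0)"


section \<open>Lie groups\<close>

definition lie_group :: "('g, 'r) monoid_scheme \<Rightarrow> ('g, 'e::euclidean_space) manifold \<Rightarrow> bool" where
  "lie_group G S \<longleftrightarrow>
     group G \<and> smooth_manifold S \<and> topspace (mtop S) = carrier G \<and>
     smooth_map (prod_manifold S S) S (\<lambda>(g, h). g \<otimes>\<^bsub>G\<^esub> h) \<and>
     smooth_map S S (\<lambda>g. inv\<^bsub>G\<^esub> g)"

definition simply_connected_space :: "'m topology \<Rightarrow> bool" where
  "simply_connected_space X \<longleftrightarrow>
     path_connected_space X \<and>
     (\<forall>p q. pathin X p \<and> p 0 = p 1 \<and> pathin X q \<and> q 0 = q 1 \<longrightarrow>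
        homotopic_with (\<lambda>r. r 0 = r 1) (top_of_set {0..1}) X p q)"

definition left_invariant_field ::
  "('g, 'r) monoid_scheme \<Rightarrow> ('g, 'e::euclidean_space) manifold \<Rightarrow> 'g tangent \<Rightarrow> 'g \<Rightarrow> 'g tangent" where
  "left_invariant_field G S v g = differential S S (\<lambda>h. g \<otimes>\<^bsub>G\<^esub> h) \<one>\<^bsub>G\<^esub> v"

text \<open>
  \<open>\<iota>\<close> identifies the Lie algebra with bracket \<open>br\<close> with the tangent space of \<open>G\<close> at the identity,
  which carries the bracket of left-invariant vector fields.
\<close>

definition lie_algebra_iso ::
  "('a::real_vector \<Rightarrow> 'a \<Rightarrow> 'a) \<Rightarrow> ('g, 'r) monoid_scheme \<Rightarrow> ('g, 'e::euclidean_space) manifold \<Rightarrow>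
   ('a \<Rightarrow> 'g tangent) \<Rightarrow> bool" where
  "lie_algebra_iso br G S \<iota> \<longleftrightarrow>
     (\<forall>X Y f. \<iota> (X + Y) f = \<iota> X f + \<iota> Y f) \<and>
     (\<forall>c X f. \<iota> (c *\<^sub>R X) f = c * \<iota> X f) \<and>
     bij_betw \<iota> UNIV (tangent_space S \<one>\<^bsub>G\<^esub>) \<and>
     (\<forall>X Y. \<iota> (br X Y) =
        vf_bracket S (left_invariant_field G S (\<iota> X)) (left_invariant_field G S (\<iota> Y)) \<one>\<^bsub>G\<^esub>)"

text \<open>
  Lie subgroups are immersed: \<open>K\<close> carries its own manifold structure \<open>SK\<close>, whose topology may be
  finer than the subspace topology.
\<close>

definition lie_subgroup ::
  "('g, 'r) monoid_scheme \<Rightarrow> ('g, 'e::euclidean_space) manifold \<Rightarrow>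
   'g set \<Rightarrow> ('g, 'f::euclidean_space) manifold \<Rightarrow> bool" where
  "lie_subgroup G S K SK \<longleftrightarrow>
     subgroup K G \<and> lie_group (G\<lparr>carrier := K\<rparr>) SK \<and> smooth_map SK S (\<lambda>x. x) \<and>
     (\<forall>p\<in>K. inj_on (differential SK S (\<lambda>x. x) p) (tangent_space SK p))"

definition subgroup_lie_algebra ::
  "('g, 'r) monoid_scheme \<Rightarrow> ('g, 'e::euclidean_space) manifold \<Rightarrow> ('a \<Rightarrow> 'g tangent) \<Rightarrow>
   ('g, 'f::euclidean_space) manifold \<Rightarrow> 'a set" where
  "subgroup_lie_algebra G S \<iota> SK =
     {X. \<iota> X \<in> differential SK S (\<lambda>x. x) \<one>\<^bsub>G\<^esub> ` tangent_space SK \<one>\<^bsub>G\<^esub>}"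

definition subgroup_tangent ::
  "('g, 'r) monoid_scheme \<Rightarrow> ('g, 'e::euclidean_space) manifold \<Rightarrow> ('a \<Rightarrow> 'g tangent) \<Rightarrow>
   ('g, 'f::euclidean_space) manifold \<Rightarrow> 'a \<Rightarrow> 'g tangent" where
  "subgroup_tangent G S \<iota> SK X =
     the_inv_into (tangent_space SK \<one>\<^bsub>G\<^esub>) (differential SK S (\<lambda>x. x) \<one>\<^bsub>G\<^esub>) (\<iota> X)"

definition Ad ::
  "('g, 'r) monoid_scheme \<Rightarrow> ('g, 'e::euclidean_space) manifold \<Rightarrow> ('a \<Rightarrow> 'g tangent) \<Rightarrow>
   'g \<Rightarrow> 'a \<Rightarrow> 'a" where
  "Ad G S \<iota> g X =
     the_inv_into UNIV \<iota> (differential S S (\<lambda>h. g \<otimes>\<^bsub>G\<^esub> h \<otimes>\<^bsub>G\<^esub> inv\<^bsub>G\<^esub> g) \<one>\<^bsub>G\<^esub> (\<iota> X))"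


section \<open>Lie algebras\<close>

locale lie_algebra = vector_space scale
  for scale :: "'f::field \<Rightarrow> 'v::ab_group_add \<Rightarrow> 'v" +
  fixes br :: "'v \<Rightarrow> 'v \<Rightarrow> 'v"
  assumes br_add_left: "br (x + y) z = br x z + br y z"
    and br_add_right: "br x (y + z) = br x y + br x z"
    and br_scale_left: "br (scale c x) y = scale c (br x y)"
    and br_scale_right: "br x (scale c y) = scale c (br x y)"
    and br_self: "br x x = 0"
    and jacobi: "br x (br y z) + br y (br z x) + br z (br x y) = 0"
begin

definition lie_ideal :: "'v set \<Rightarrow> bool" where
  "lie_ideal I \<longleftrightarrow> subspace I \<and> (\<forall>x. \<forall>y\<in>I. br x y \<in> I)"

definition derived :: "'v set \<Rightarrow> 'v set" where
  "derived I = span {br x y |x y. x \<in> I \<and> y \<in> I}"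

definition solvable :: "'v set \<Rightarrow> bool" where
  "solvable I \<longleftrightarrow> (\<exists>n. (derived ^^ n) I = {0})"

definition semisimple :: bool where
  "semisimple \<longleftrightarrow> (\<forall>I. lie_ideal I \<and> solvable I \<longrightarrow> I = {0})"

end

text \<open>\<open>j\<close> embeds the real Lie algebra \<open>br\<close> into the complex one such that \<open>\<gg>\<^sub>\<complex> = j \<gg> \<oplus> \<i> j \<gg>\<close>.\<close>

definition real_form ::
  "(complex \<Rightarrow> 'c::ab_group_add \<Rightarrow> 'c) \<Rightarrow> ('c \<Rightarrow> 'c \<Rightarrow> 'c) \<Rightarrow> ('a::real_vector \<Rightarrow> 'a \<Rightarrow> 'a) \<Rightarrow>
   ('a \<Rightarrow> 'c) \<Rightarrow> bool" where
  "real_form sC brC br j \<longleftrightarrow>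
     lie_algebra sC brC \<and> lie_algebra (*\<^sub>R) br \<and>
     (\<forall>X Y. j (X + Y) = j X + j Y) \<and>
     (\<forall>c X. j (c *\<^sub>R X) = sC (complex_of_real c) (j X)) \<and>
     (\<forall>X Y. j (br X Y) = brC (j X) (j Y)) \<and>
     (\<forall>Z. \<exists>!XY. Z = j (fst XY) + sC \<i> (j (snd XY)))"

text \<open>The trace of \<open>ad X \<circ> ad Y\<close>; it does not depend on the choice of the inner product.\<close>

definition killing :: "('a::euclidean_space \<Rightarrow> 'a \<Rightarrow> 'a) \<Rightarrow> 'a \<Rightarrow> 'a \<Rightarrow> real" where
  "killing br X Y = (\<Sum>b\<in>Basis. br X (br Y b) \<bullet> b)"

text \<open>A real form is compact iff its Killing form is negative definite.\<close>

definition noncompact_real_form ::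
  "(complex \<Rightarrow> 'c::ab_group_add \<Rightarrow> 'c) \<Rightarrow> ('c \<Rightarrow> 'c \<Rightarrow> 'c) \<Rightarrow> ('a::euclidean_space \<Rightarrow> 'a \<Rightarrow> 'a) \<Rightarrow>
   ('a \<Rightarrow> 'c) \<Rightarrow> bool" where
  "noncompact_real_form sC brC br j \<longleftrightarrow>
     real_form sC brC br j \<and> \<not> (\<forall>X. X \<noteq> 0 \<longrightarrow> killing br X X < 0)"

definition cartan_involution ::
  "('a::euclidean_space \<Rightarrow> 'a \<Rightarrow> 'a) \<Rightarrow> ('a \<Rightarrow> 'a) \<Rightarrow> bool" where
  "cartan_involution br \<theta> \<longleftrightarrow>
     linear \<theta> \<and> (\<forall>X Y. \<theta> (br X Y) = br (\<theta> X) (\<theta> Y)) \<and> (\<forall>X. \<theta> (\<theta> X) = X) \<and>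
     (\<forall>X. X \<noteq> 0 \<longrightarrow> - killing br X (\<theta> X) > 0)"

definition cartan_k :: "('a \<Rightarrow> 'a) \<Rightarrow> 'a set" where
  "cartan_k \<theta> = {X. \<theta> X = X}"

definition cartan_p :: "('a::real_vector \<Rightarrow> 'a) \<Rightarrow> 'a set" where
  "cartan_p \<theta> = {X. \<theta> X = - X}"

definition commutative_subspace_of ::
  "('a::real_vector \<Rightarrow> 'a \<Rightarrow> 'a) \<Rightarrow> 'a set \<Rightarrow> 'a set \<Rightarrow> bool" where
  "commutative_subspace_of br p A \<longleftrightarrow> subspace A \<and> A \<subseteq> p \<and> (\<forall>X\<in>A. \<forall>Y\<in>A. br X Y = 0)"

definition maximal_commutative_subspace ::
  "('a::real_vector \<Rightarrow> 'a \<Rightarrow> 'a) \<Rightarrow> 'a set \<Rightarrow> 'a set \<Rightarrow> bool" where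
  "maximal_commutative_subspace br p A \<longleftrightarrow>
     commutative_subspace_of br p A \<and>
     (\<forall>A'. commutative_subspace_of br p A' \<and> A \<subseteq> A' \<longrightarrow> A' = A)"

text \<open>
  Linear forms on the subspace \<open>A\<close> are represented by their extension by \<open>0\<close> (not a linear
  extension) to the ambient space, so that equality, sums and negation are pointwise.
\<close>

definition dual_space :: "'a::real_vector set \<Rightarrow> ('a \<Rightarrow> real) set" where
  "dual_space A =
     {\<alpha>. (\<forall>H\<in>A. \<forall>H'\<in>A. \<alpha> (H + H') = \<alpha> H + \<alpha> H') \<and>
         (\<forall>c. \<forall>H\<in>A. \<alpha> (c *\<^sub>R H) = c * \<alpha> H) \<and> (\<forall>H. H \<notin> A \<longrightarrow> \<alpha> H = 0)}"

definition root_space ::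
  "('a::real_vector \<Rightarrow> 'a \<Rightarrow> 'a) \<Rightarrow> 'a set \<Rightarrow> ('a \<Rightarrow> real) \<Rightarrow> 'a set" where
  "root_space br A \<alpha> = {X. \<forall>H\<in>A. br H X = \<alpha> H *\<^sub>R X}"

definition roots :: "('a::real_vector \<Rightarrow> 'a \<Rightarrow> 'a) \<Rightarrow> 'a set \<Rightarrow> ('a \<Rightarrow> real) set" where
  "roots br A = {\<alpha> \<in> dual_space A. \<alpha> \<noteq> (\<lambda>H. 0) \<and> root_space br A \<alpha> \<noteq> {0}}"

definition positive_roots ::
  "('a::real_vector \<Rightarrow> 'a \<Rightarrow> 'a) \<Rightarrow> 'a set \<Rightarrow> ('a \<Rightarrow> real) set \<Rightarrow> bool" where
  "positive_roots br A P \<longleftrightarrow>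
     P \<subseteq> roots br A \<and>
     (\<forall>\<alpha>\<in>roots br A. \<alpha> \<in> P \<longleftrightarrow> (\<lambda>H. - \<alpha> H) \<notin> P) \<and>
     (\<forall>\<alpha>\<in>P. \<forall>\<beta>\<in>P. (\<lambda>H. \<alpha> H + \<beta> H) \<in> roots br A \<longrightarrow> (\<lambda>H. \<alpha> H + \<beta> H) \<in> P)"

definition b_minus ::
  "('a::real_vector \<Rightarrow> 'a \<Rightarrow> 'a) \<Rightarrow> 'a set \<Rightarrow> ('a \<Rightarrow> real) set \<Rightarrow> 'a set" where
  "b_minus br A P = span (A \<union> (\<Union>\<alpha>\<in>P. root_space br A (\<lambda>H. - \<alpha> H)))"

definition projection_along :: "'a::real_vector set \<Rightarrow> 'a set \<Rightarrow> 'a \<Rightarrow> 'a" where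
  "projection_along k b X = (THE Y. Y \<in> k \<and> X - Y \<in> b)"


section \<open>Representations\<close>

definition lie_representation ::
  "('a::real_vector \<Rightarrow> 'a \<Rightarrow> 'a) \<Rightarrow> ('a \<Rightarrow> 'v::real_vector \<Rightarrow> 'v) \<Rightarrow> bool" where
  "lie_representation br \<rho> \<longleftrightarrow>
     (\<forall>X. linear (\<rho> X)) \<and> (\<forall>x. linear (\<lambda>X. \<rho> X x)) \<and>
     (\<forall>X Y x. \<rho> (br X Y) x = \<rho> X (\<rho> Y x) - \<rho> Y (\<rho> X x))"

definition bottom_weight_representation ::
  "('a::real_vector \<Rightarrow> 'a \<Rightarrow> 'a) \<Rightarrow> 'a set \<Rightarrow> ('a \<Rightarrow> real) set \<Rightarrow>
   ('a \<Rightarrow> 'v::real_vector \<Rightarrow> 'v) \<Rightarrow> 'v \<Rightarrow> bool" where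
  "bottom_weight_representation br A P \<rho> v \<longleftrightarrow>
     lie_representation br \<rho> \<and> v \<noteq> 0 \<and>
     (\<forall>W. subspace W \<and> v \<in> W \<and> (\<forall>X. \<forall>w\<in>W. \<rho> X w \<in> W) \<longrightarrow> W = UNIV) \<and>
     (\<forall>\<alpha>\<in>P. \<forall>X\<in>root_space br A (\<lambda>H. - \<alpha> H). \<rho> X v = 0) \<and>
     (\<exists>\<omega>\<in>dual_space A. \<forall>H\<in>A. \<rho> H v = \<omega> H *\<^sub>R v)"

text \<open>
  \<open>R\<close> is a representation of \<open>G\<close> with differential \<open>\<rho>\<close> at the identity. On a 1-connected group it
  exists and is unique; its restriction to \<open>K\<close> is the induced representation of \<open>K\<close>.
\<close>

definition integrates_to ::
  "('g, 'r) monoid_scheme \<Rightarrow> ('g, 'e::euclidean_space) manifold \<Rightarrow> ('a \<Rightarrow> 'g tangent) \<Rightarrow>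
   ('a \<Rightarrow> 'v::euclidean_space \<Rightarrow> 'v) \<Rightarrow> ('g \<Rightarrow> 'v \<Rightarrow> 'v) \<Rightarrow> bool" where
  "integrates_to G S \<iota> \<rho> R \<longleftrightarrow>
     (\<forall>g\<in>carrier G. linear (R g)) \<and> (\<forall>x. R \<one>\<^bsub>G\<^esub> x = x) \<and>
     (\<forall>g\<in>carrier G. \<forall>h\<in>carrier G. \<forall>x. R (g \<otimes>\<^bsub>G\<^esub> h) x = R g (R h x)) \<and>
     (\<forall>x. smooth_map S (euclidean_manifold UNIV) (\<lambda>g. R g x)) \<and>
     (\<forall>X x y. \<iota> X (\<lambda>g. R g x \<bullet> y) = \<rho> X x \<bullet> y)"

definition adapted_inner ::
  "('a::real_vector \<Rightarrow> 'a) \<Rightarrow> 'g set \<Rightarrow> ('a \<Rightarrow> 'v::real_inner \<Rightarrow> 'v) \<Rightarrow> ('g \<Rightarrow> 'v \<Rightarrow> 'v) \<Rightarrow> bool" where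
  "adapted_inner \<theta> K \<rho> R \<longleftrightarrow>
     (\<forall>k\<in>K. \<forall>x y. R k x \<bullet> R k y = x \<bullet> y) \<and>
     (\<forall>L\<in>cartan_p \<theta>. \<forall>x y. \<rho> L x \<bullet> y = x \<bullet> \<rho> L y) \<and>
     (\<forall>X\<in>cartan_k \<theta>. \<forall>x y. \<rho> X x \<bullet> y = - (x \<bullet> \<rho> X y))"

definition adapted_basis ::
  "'a::real_vector set \<Rightarrow> ('a \<Rightarrow> 'v::euclidean_space \<Rightarrow> 'v) \<Rightarrow> (nat \<Rightarrow> 'v) \<Rightarrow> (nat \<Rightarrow> 'a \<Rightarrow> real) \<Rightarrow>
   bool" where
  "adapted_basis A \<rho> v \<omega> \<longleftrightarrow>
     (\<forall>i\<in>{1..DIM('v)}. \<forall>j\<in>{1..DIM('v)}. v i \<bullet> v j = (if i = j then 1 else 0)) \<and>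
     (\<forall>i\<in>{1..DIM('v)}. \<omega> i \<in> dual_space A \<and> (\<forall>H\<in>A. \<rho> H (v i) = \<omega> i H *\<^sub>R v i))"

definition matrix_coeff :: "('g \<Rightarrow> 'v::real_inner \<Rightarrow> 'v) \<Rightarrow> (nat \<Rightarrow> 'v) \<Rightarrow> nat \<Rightarrow> 'g \<Rightarrow> real" where
  "matrix_coeff R v i k = R k (v i) \<bullet> v 1"


section \<open>Generalised Toda fields\<close>

definition toda_field ::
  "('a::real_vector \<Rightarrow> 'a \<Rightarrow> 'a) \<Rightarrow> ('a \<Rightarrow> 'a) \<Rightarrow> 'a set \<Rightarrow> ('a \<Rightarrow> real) set \<Rightarrow>
   ('g, 'r) monoid_scheme \<Rightarrow> ('g, 'e::euclidean_space) manifold \<Rightarrow> ('a \<Rightarrow> 'g tangent) \<Rightarrow>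
   ('g, 'f::euclidean_space) manifold \<Rightarrow> 'a \<Rightarrow> 'g \<Rightarrow> 'g tangent" where
  "toda_field br \<theta> A P G S \<iota> SK X k =
     differential SK SK (\<lambda>h. h \<otimes>\<^bsub>G\<^esub> k) \<one>\<^bsub>G\<^esub>
       (subgroup_tangent G S \<iota> SK
         (projection_along (cartan_k \<theta>) (b_minus br A P) (Ad G S \<iota> k X)))"

end

(*
  The field T^X is obtained by projecting the left-invariant field of X on G to K along B_-, hence
  [T^X, T^Z] = T^[X,Z]; infinitesimally this uses only that k is a subalgebra complementing the
  subalgebra b_-. For a weight vector w of weight \<omega> the function F(k) = <R k w, v_-> satisfies
  T^\<Lambda> F = (c - \<omega>(\<Lambda>)) F, where c comes from the character of b_- on v_-: the k-component of
  Ad_k \<Lambda> acts by a skew operator, while Ad_k \<Lambda> itself acts by a symmetric one. So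
  T^\<Lambda> (F_j / F_i) = - \<alpha>(\<Lambda>) F_j / F_i, which cancels [T^\<Lambda>, T^e] = T^[\<Lambda>,e] = \<alpha>(\<Lambda>) T^e.
*)
theory Submission
  imports Defs
begin

section \<open>Smooth functions on open sets\<close>

text \<open>Differentiating T^Z f along T^X is not a computation with invariant fields: the vector
  Ad_q Z whose k-component is used varies with q. It is therefore expanded in a fixed basis of the
  Lie algebra, which turns T^Z f near a point into a sum of smooth coefficients times
  right-invariant derivatives of f. The coefficients contribute the derivative of Ad, which is the
  bracket; the right-invariant derivatives contribute a commutator with the reversed sign. Both
  facts rest on the symmetry of mixed second derivatives, since the bracket is defined through
  left-invariant fields while the fields on K use right translations. As tangent vectors are
  functionals with value 0 off the functions smooth near the point, such identities carry smoothness
  statements along with them. The projection is a definite description, so that g is the direct sum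
  of k and b_- has to be proved: the operators ad H, for H in the maximal commutative subspace,
  commute and are symmetric for the inner product built from the Killing form and \<theta>.\<close>

lemma frechet_derivative_apply_eq:
  "(f has_derivative f') (at x) \<Longrightarrow> frechet_derivative f (at x) v = f' v"
  by (drule frechet_derivative_at) simp

lemma Ck_on_SucD:
  "Ck_on (Suc n) f S \<Longrightarrow> x \<in> S \<Longrightarrow> (f has_derivative frechet_derivative f (at x)) (at x)"
  using frechet_derivative_works by auto

lemma Ck_on_cong_imp:
  assumes "open S" "\<And>x. x \<in> S \<Longrightarrow> f x = g x" "Ck_on n f S"
  shows "Ck_on n g S"
  using assms(2,3)
proof (induction n arbitrary: f g)
  case 0
  then show ?case by (simp cong: continuous_on_cong)
next
  case (Suc n)
  have D: "(g has_derivative frechet_derivative f (at x)) (at x)" if "x \<in> S" for x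
    by (rule has_derivative_transform_within_open[OF Ck_on_SucD[OF Suc.prems(2) that] assms(1) that])
      (rule Suc.prems(1))
  have "Ck_on n (\<lambda>x. frechet_derivative g (at x) v) S" for v
    by (rule Suc.IH[of "\<lambda>x. frechet_derivative f (at x) v"])
      (use frechet_derivative_apply_eq[OF D] Suc.prems(2) in auto)
  then show ?case using D by (auto simp: differentiable_def)
qed

lemma Ck_on_cong:
  assumes "open S" "\<And>x. x \<in> S \<Longrightarrow> f x = g x"
  shows "Ck_on n f S \<longleftrightarrow> Ck_on n g S"
  using Ck_on_cong_imp[OF assms(1), of f g n] Ck_on_cong_imp[OF assms(1), of g f n] assms(2) by auto

text \<open>\<open>Ck_on\<close> is phrased with \<open>frechet_derivative\<close>; this rule
  accepts any family of derivatives instead, in whatever form makes its C^n property easy to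
  see.\<close>

lemma Ck_on_SucI:
  assumes "open S" "\<And>x. x \<in> S \<Longrightarrow> (f has_derivative f' x) (at x)"
    and "\<And>v. Ck_on n (\<lambda>x. f' x v) S"
  shows "Ck_on (Suc n) f S"
proof -
  have "Ck_on n (\<lambda>x. frechet_derivative f (at x) v) S" for v
    by (rule Ck_on_cong_imp[OF assms(1) _ assms(3)]) (simp add: frechet_derivative_apply_eq[OF assms(2)])
  then show ?thesis using assms(2) by (auto simp: differentiable_def)
qed

lemma Ck_on_subset: "Ck_on n f S \<Longrightarrow> T \<subseteq> S \<Longrightarrow> Ck_on n f T"
  by (induction n arbitrary: f) (auto intro: continuous_on_subset)

lemma Ck_on_Suc_imp: "Ck_on (Suc n) f S \<Longrightarrow> Ck_on n f S"
proof (induction n arbitrary: f)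
  case 0
  then show ?case
    by (auto intro!: continuous_at_imp_continuous_on differentiable_imp_continuous_within)
next
  case (Suc n)
  then show ?case by (metis Ck_on.simps(2))
qed

lemma Ck_on_const: "Ck_on n (\<lambda>x. c) S"
  by (induction n arbitrary: c) auto

lemma Ck_on_bounded_linear_compose:
  assumes "bounded_linear L" "open S" "Ck_on n f S"
  shows "Ck_on n (\<lambda>x. L (f x)) S"
  using assms(3)
proof (induction n arbitrary: f)
  case 0
  then show ?case using bounded_linear.continuous_on[OF assms(1)] by auto
next
  case (Suc n)
  show ?case
    using Suc
    by (intro Ck_on_SucI[OF assms(2) bounded_linear.has_derivative[OF assms(1) Ck_on_SucD]]) auto
qed

lemma Ck_on_add:
  assumes "open S" "Ck_on n f S" "Ck_on n g S"
  shows "Ck_on n (\<lambda>x. f x + g x) S"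
  using assms(2,3)
proof (induction n arbitrary: f g)
  case 0
  then show ?case by (auto intro: continuous_on_add)
next
  case (Suc n)
  show ?case
    using Suc by (intro Ck_on_SucI[OF assms(1) has_derivative_add[OF Ck_on_SucD Ck_on_SucD]]) auto
qed

text \<open>The product rule gives B(f, g') + B(f', g), again bilinear expressions in functions of
  class C^n, so the induction runs over all pairs f, g at once.\<close>

lemma Ck_on_bilinear:
  assumes "bounded_bilinear B" "open S" "Ck_on n f S" "Ck_on n g S"
  shows "Ck_on n (\<lambda>x. B (f x) (g x)) S"
  using assms(3,4)
proof (induction n arbitrary: f g)
  case 0
  then show ?case using bounded_bilinear.continuous_on[OF assms(1)] by auto
next
  case (Suc n)
  show ?case
    using Suc.prems Ck_on_Suc_imp[OF Suc.prems(1)] Ck_on_Suc_imp[OF Suc.prems(2)]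
    by (intro Ck_on_SucI[OF assms(2) bounded_bilinear.FDERIV[OF assms(1) Ck_on_SucD Ck_on_SucD]]
        Ck_on_add Suc.IH assms(2)) auto
qed

lemma Ck_on_sum:
  assumes "open S" "finite I" "\<And>i. i \<in> I \<Longrightarrow> Ck_on n (f i) S"
  shows "Ck_on n (\<lambda>x. \<Sum>i\<in>I. f i x) S"
  using assms(2,3) by (induction I) (auto intro!: Ck_on_const Ck_on_add assms(1))

lemma linear_Basis_expand:
  fixes x :: "'a::euclidean_space"
  assumes "linear L"
  shows "L x = (\<Sum>b\<in>Basis. (x \<bullet> b) *\<^sub>R L b)"
proof -
  have "L x = L (\<Sum>b\<in>Basis. (x \<bullet> b) *\<^sub>R b)" by (simp add: euclidean_representation)
  then show ?thesis using assms by (simp add: linear_sum linear_scale)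
qed

text \<open>In g'(f x)(f'(x) v) the direction varies with x, whereas \<open>Ck_on\<close> speaks of
  derivatives in fixed directions. Expanding f'(x) v in the basis leaves products of real C^n
  functions with (D_b g)(f x), and the induction hypothesis for D_b g applies.\<close>

lemma Ck_on_compose:
  assumes "open S" "open T" "f ` S \<subseteq> T" "Ck_on n f S" "Ck_on n g T"
  shows "Ck_on n (\<lambda>x. g (f x)) S"
  using assms(4,5)
proof (induction n arbitrary: g)
  case 0
  then show ?case using continuous_on_compose2 assms(3) by auto
next
  case (Suc n)
  show ?case
  proof (rule Ck_on_SucI[OF assms(1)])
    fix x assume x: "x \<in> S"
    then have g: "(g has_derivative frechet_derivative g (at (f x))) (at (f x))"
      using Suc.prems(2) assms(3) by (intro Ck_on_SucD) auto
    have "((\<lambda>x. g (f x)) has_derivative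
        (\<lambda>v. frechet_derivative g (at (f x)) (frechet_derivative f (at x) v))) (at x)"
      by (rule has_derivative_compose[OF Ck_on_SucD[OF Suc.prems(1) x] g])
    then show "((\<lambda>x. g (f x)) has_derivative
        (\<lambda>v. \<Sum>b\<in>Basis. (frechet_derivative f (at x) v \<bullet> b) *\<^sub>R frechet_derivative g (at (f x)) b)) (at x)"
      by (simp add: linear_Basis_expand[OF has_derivative_linear[OF g], symmetric])
  next
    fix v
    show "Ck_on n (\<lambda>x. \<Sum>b\<in>Basis. (frechet_derivative f (at x) v \<bullet> b) *\<^sub>R frechet_derivative g (at (f x)) b) S"
      using Suc.prems Ck_on_Suc_imp[OF Suc.prems(1)]
      by (intro Ck_on_sum Ck_on_bilinear[OF bounded_bilinear_scaleR] Suc.IH assms(1)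
          Ck_on_bounded_linear_compose[OF bounded_linear_inner_left]) auto
  qed
qed

lemma Ck_on_local:
  assumes "\<And>x. x \<in> S \<Longrightarrow> \<exists>T. open T \<and> x \<in> T \<and> Ck_on n f T"
  shows "Ck_on n f S"
  using assms
proof (induction n arbitrary: f)
  case 0
  then show ?case
    by (simp, intro continuous_at_imp_continuous_on ballI) (meson continuous_on_eq_continuous_at)
next
  case (Suc n)
  have "Ck_on n (\<lambda>x. frechet_derivative f (at x) v) S" for v
    by (rule Suc.IH) (use Suc.prems in force)
  then show ?case using Suc.prems by auto
qed

section \<open>Calculus of smooth functions\<close>

lemma smooth_on_cong:
  "open S \<Longrightarrow> (\<And>x. x \<in> S \<Longrightarrow> f x = g x) \<Longrightarrow> smooth_on S f \<longleftrightarrow> smooth_on S g"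
  unfolding smooth_on_def using Ck_on_cong by blast

lemma smooth_on_transform:
  "smooth_on S f \<Longrightarrow> open S \<Longrightarrow> (\<And>x. x \<in> S \<Longrightarrow> f x = g x) \<Longrightarrow> smooth_on S g"
  using smooth_on_cong by blast

lemma smooth_on_subset: "smooth_on S f \<Longrightarrow> T \<subseteq> S \<Longrightarrow> smooth_on T f"
  unfolding smooth_on_def using Ck_on_subset by blast

lemma smooth_on_const: "smooth_on S (\<lambda>x. c)"
  unfolding smooth_on_def by (simp add: Ck_on_const)

lemma smooth_on_bounded_linear_compose:
  "bounded_linear L \<Longrightarrow> open S \<Longrightarrow> smooth_on S f \<Longrightarrow> smooth_on S (\<lambda>x. L (f x))"
  unfolding smooth_on_def by (simp add: Ck_on_bounded_linear_compose)

lemma smooth_on_add: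
  "open S \<Longrightarrow> smooth_on S f \<Longrightarrow> smooth_on S g \<Longrightarrow> smooth_on S (\<lambda>x. f x + g x)"
  unfolding smooth_on_def by (simp add: Ck_on_add)

lemma smooth_on_mult:
  fixes f g :: "'a::euclidean_space \<Rightarrow> real"
  shows "open S \<Longrightarrow> smooth_on S f \<Longrightarrow> smooth_on S g \<Longrightarrow> smooth_on S (\<lambda>x. f x * g x)"
  unfolding smooth_on_def by (simp add: Ck_on_bilinear[OF bounded_bilinear_mult])

lemma smooth_on_compose:
  "open S \<Longrightarrow> open T \<Longrightarrow> f ` S \<subseteq> T \<Longrightarrow> smooth_on S f \<Longrightarrow> smooth_on T g \<Longrightarrow> smooth_on S (\<lambda>x. g (f x))"
  unfolding smooth_on_def by (simp add: Ck_on_compose)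

lemma smooth_on_local:
  "(\<And>x. x \<in> S \<Longrightarrow> \<exists>T. open T \<and> x \<in> T \<and> smooth_on T f) \<Longrightarrow> smooth_on S f"
  unfolding smooth_on_def by (meson Ck_on_local)

lemma smooth_on_ident: "smooth_on S (\<lambda>x. x)"
proof -
  have "Ck_on n (\<lambda>x. x) UNIV" for n
    by (cases n) (auto simp: Ck_on_const)
  then show ?thesis unfolding smooth_on_def using Ck_on_subset by blast
qed

lemma smooth_on_bounded_linear:
  "bounded_linear L \<Longrightarrow> smooth_on S L"
  using smooth_on_bounded_linear_compose[OF _ open_UNIV smooth_on_ident] smooth_on_subset by blast

lemma smooth_on_Pair:
  fixes f :: "'a::euclidean_space \<Rightarrow> 'b::euclidean_space" and g :: "'a \<Rightarrow> 'c::euclidean_space"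
  assumes "open S" "smooth_on S f" "smooth_on S g"
  shows "smooth_on S (\<lambda>x. (f x, g x))"
proof -
  have 1: "bounded_linear (\<lambda>y::'b. (y, 0::'c))"
    by (intro bounded_linear_Pair bounded_linear_ident bounded_linear_zero)
  have 2: "bounded_linear (\<lambda>y::'c. (0::'b, y))"
    by (intro bounded_linear_Pair bounded_linear_ident bounded_linear_zero)
  show ?thesis
    using smooth_on_add[OF assms(1) smooth_on_bounded_linear_compose[OF 1 assms(1,2)]
       smooth_on_bounded_linear_compose[OF 2 assms(1,3)]] by simp
qed

lemma smooth_on_inverse: "smooth_on {x::real. x \<noteq> 0} inverse"
proof -
  have op: "open {x::real. x \<noteq> 0}" by (simp add: open_Collect_neq)
  have "Ck_on n inverse {x::real. x \<noteq> 0}" for n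
  proof (induction n)
    case 0
    then show ?case by (auto intro!: continuous_intros)
  next
    case (Suc n)
    show ?case
    proof (rule Ck_on_SucI[OF op])
      fix x :: real assume "x \<in> {x. x \<noteq> 0}"
      then have "(inverse has_derivative (\<lambda>v. - (inverse x * v * inverse x))) (at x)"
        using has_derivative_inverse'[of x UNIV] by simp
      \<comment> \<open>The derivative is arranged as products of constants and
        \<open>inverse\<close>, so that the induction hypothesis gives its class.\<close>
      then show "(inverse has_derivative (\<lambda>v. - v * (inverse x * inverse x))) (at x)"
        by (simp add: mult_ac)
    qed (intro Ck_on_bilinear[OF bounded_bilinear_mult] op Suc Ck_on_const)
  qed
  then show ?thesis unfolding smooth_on_def by blast
qed

lemma smooth_on_frechet_derivative:
  "smooth_on S f \<Longrightarrow> smooth_on S (\<lambda>x. frechet_derivative f (at x) v)"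
  unfolding smooth_on_def by (metis Ck_on.simps(2))

lemma smooth_on_differentiable: "smooth_on S f \<Longrightarrow> x \<in> S \<Longrightarrow> f differentiable (at x)"
  unfolding smooth_on_def by (metis Ck_on.simps(2))

lemma smooth_on_has_derivative:
  "smooth_on S f \<Longrightarrow> x \<in> S \<Longrightarrow> (f has_derivative frechet_derivative f (at x)) (at x)"
  using smooth_on_differentiable frechet_derivative_works by blast

lemma smooth_on_continuous: "smooth_on S f \<Longrightarrow> continuous_on S f"
  unfolding smooth_on_def by (metis Ck_on.simps(1))

section \<open>Symmetry of second derivatives\<close>

text \<open>Both iterated derivatives are limits of the second difference quotient
  \<open>(f (x + h a + h b) - f (x + h a) - f (x + h b) + f x) / h\<^sup>2\<close>.\<close>

lemma second_difference_mean_value: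
  fixes f :: "'a::euclidean_space \<Rightarrow> real"
  assumes S: "smooth_on S f" and h: "h > 0"
    and box: "\<And>s t. 0 \<le> s \<Longrightarrow> s \<le> h \<Longrightarrow> 0 \<le> t \<Longrightarrow> t \<le> h \<Longrightarrow> x + s *\<^sub>R a + t *\<^sub>R b \<in> S"
  obtains s t where "0 < s" "s < h" "0 < t" "t < h"
    "f (x + h *\<^sub>R a + h *\<^sub>R b) - f (x + h *\<^sub>R a) - f (x + h *\<^sub>R b) + f x
      = h * h * frechet_derivative (\<lambda>y. frechet_derivative f (at y) a) (at (x + s *\<^sub>R a + t *\<^sub>R b)) b"
proof -
  \<comment> \<open>The second difference is \<open>u h - u 0\<close>, the increment along a of an
    increment along b; two applications of the mean value theorem, along a and then along b, produce
    the intermediate point.\<close>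
  define u where "u s = f (x + s *\<^sub>R a + h *\<^sub>R b) - f (x + s *\<^sub>R a)" for s
  let ?D = "\<lambda>y. frechet_derivative f (at y) a"
  have lin: "frechet_derivative g (at y) (c *\<^sub>R w) = c * frechet_derivative g (at y) w"
    if "smooth_on S g" "y \<in> S" for g :: "'a \<Rightarrow> real" and y w c
    using linear_scale[OF linear_frechet_derivative[OF smooth_on_differentiable[OF that]]] by simp
  have der: "((\<lambda>s. g (y + s *\<^sub>R w)) has_real_derivative frechet_derivative g (at (y + s *\<^sub>R w)) w) (at s)"
    if "smooth_on S g" "y + s *\<^sub>R w \<in> S" for g :: "'a \<Rightarrow> real" and y w s
  proof -
    have "((\<lambda>s. g (y + s *\<^sub>R w)) has_derivative (\<lambda>r. frechet_derivative g (at (y + s *\<^sub>R w)) (r *\<^sub>R w))) (at s)"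
      by (rule has_derivative_compose[where g=g and f="\<lambda>s. y + s *\<^sub>R w", OF _ smooth_on_has_derivative[OF that]])
        (auto intro!: derivative_eq_intros)
    then show ?thesis
      unfolding has_field_derivative_def using lin[OF that] by (simp add: mult.commute mult_commute_abs)
  qed
  have "\<exists>s>0. s < h \<and> u h - u 0 = (h - 0) * (?D (x + h *\<^sub>R b + s *\<^sub>R a) - ?D (x + s *\<^sub>R a))"
  proof (rule MVT2[OF h])
    fix s assume s: "0 \<le> s" "s \<le> h"
    have 1: "x + h *\<^sub>R b + s *\<^sub>R a \<in> S" using box[of s h] s h by (simp add: algebra_simps)
    have 2: "x + s *\<^sub>R a \<in> S" using box[of s 0] s h by simp
    have "u = (\<lambda>s. f (x + h *\<^sub>R b + s *\<^sub>R a) - f (x + s *\<^sub>R a))"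
      by (simp add: u_def fun_eq_iff algebra_simps)
    then show "(u has_real_derivative ?D (x + h *\<^sub>R b + s *\<^sub>R a) - ?D (x + s *\<^sub>R a)) (at s)"
      using der[OF S 1] der[OF S 2] by (auto intro!: derivative_intros)
  qed
  then obtain s where s: "0 < s" "s < h" 
    "u h - u 0 = h * (?D (x + h *\<^sub>R b + s *\<^sub>R a) - ?D (x + s *\<^sub>R a))" by auto
  have "\<exists>t>0. t < h \<and> ?D (x + s *\<^sub>R a + h *\<^sub>R b) - ?D (x + s *\<^sub>R a + 0 *\<^sub>R b)
     = (h - 0) * frechet_derivative ?D (at (x + s *\<^sub>R a + t *\<^sub>R b)) b"
  proof (rule MVT2[OF h])
    fix t assume "0 \<le> t" "t \<le> h"
    then show "((\<lambda>t. ?D (x + s *\<^sub>R a + t *\<^sub>R b)) has_real_derivative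
        frechet_derivative ?D (at (x + s *\<^sub>R a + t *\<^sub>R b)) b) (at t)"
      using box[of s t] s by (intro der smooth_on_frechet_derivative S) auto
  qed
  then obtain t where t: "0 < t" "t < h"
    "?D (x + s *\<^sub>R a + h *\<^sub>R b) - ?D (x + s *\<^sub>R a) = h * frechet_derivative ?D (at (x + s *\<^sub>R a + t *\<^sub>R b)) b"
    by auto
  have "x + h *\<^sub>R b + s *\<^sub>R a = x + s *\<^sub>R a + h *\<^sub>R b" by (simp add: algebra_simps)
  with s(3) t(3) have "u h - u 0 = h * h * frechet_derivative ?D (at (x + s *\<^sub>R a + t *\<^sub>R b)) b"
    by (metis mult.assoc)
  then show ?thesis using s t by (intro that[of s t]) (auto simp: u_def)
qed

text \<open>The second difference is symmetric in a and b, so it equals h^2 times a value of either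
  derivative near x. If the two differed at x, continuity would keep their values apart on a small
  ball.\<close>

lemma second_derivative_symmetric:
  fixes f :: "'a::euclidean_space \<Rightarrow> real"
  assumes "open S" "smooth_on S f" "x \<in> S"
  shows "frechet_derivative (\<lambda>y. frechet_derivative f (at y) a) (at x) b
       = frechet_derivative (\<lambda>y. frechet_derivative f (at y) b) (at x) a"
proof (rule ccontr)
  define P where "P y = frechet_derivative (\<lambda>y. frechet_derivative f (at y) a) (at y) b" for y
  define Q where "Q y = frechet_derivative (\<lambda>y. frechet_derivative f (at y) b) (at y) a" for y
  assume "\<not> ?thesis"
  then have neq: "P x \<noteq> Q x" by (simp add: P_def Q_def)
  \<comment> \<open>Half the distance, so that no number can be within e of both values.\<close>
  define e where "e = dist (P x) (Q x) / 2"
  have e: "e > 0" using neq by (simp add: e_def)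
  have "continuous_on S P" "continuous_on S Q"
    unfolding P_def Q_def
    by (intro smooth_on_continuous smooth_on_frechet_derivative assms(2))+
  then have cont: "isCont P x" "isCont Q x"
    using assms(1,3) by (simp_all add: continuous_on_eq_continuous_at)
  have "\<forall>\<^sub>F y in nhds x. y \<in> S \<and> dist (P y) (P x) < e \<and> dist (Q y) (Q x) < e"
    using assms(1,3) e cont
    by (intro eventually_conj eventually_nhds_in_open tendstoD) (auto simp: tendsto_nhds_iff isCont_def)
  then obtain r where r: "r > 0" "\<And>y. dist y x < r \<Longrightarrow> y \<in> S \<and> dist (P y) (P x) < e \<and> dist (Q y) (Q x) < e"
    unfolding eventually_nhds_metric by blast
  \<comment> \<open>Small enough for the parallelogram spanned by h a and h b to lie in the ball of
    radius r; the summand 1 covers a = b = 0.\<close>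
  define h where "h = r / (2 * (norm a + norm b + 1))"
  have h: "h > 0" unfolding h_def using r(1) by (simp add: add_nonneg_pos)
  have hh: "h * (norm a + norm b) < r"
  proof -
    have "h * (norm a + norm b) \<le> h * (norm a + norm b + 1)" using h by simp
    also have "\<dots> = r / 2"
    proof -
      have "norm a + norm b + 1 \<noteq> 0" by (metis add_nonneg_pos norm_ge_zero add_nonneg_nonneg less_irrefl zero_less_one)
      then show ?thesis by (simp add: h_def field_simps)
    qed
    finally show ?thesis using r(1) by simp
  qed
  have near: "dist (x + s *\<^sub>R a + t *\<^sub>R b) x < r" if "0 \<le> s" "s \<le> h" "0 \<le> t" "t \<le> h" for s t
  proof -
    have "dist (x + s *\<^sub>R a + t *\<^sub>R b) x \<le> norm (s *\<^sub>R a) + norm (t *\<^sub>R b)"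
      by (simp add: dist_norm add.assoc del: norm_scaleR) (rule norm_triangle_ineq)
    also have "\<dots> \<le> h * norm a + h * norm b"
      using that by (intro add_mono) (auto intro: mult_right_mono)
    finally show ?thesis using hh by (simp add: algebra_simps)
  qed
  have near': "dist (x + s *\<^sub>R b + t *\<^sub>R a) x < r" if "0 \<le> s" "s \<le> h" "0 \<le> t" "t \<le> h" for s t
    using near[of t s] that by (simp add: algebra_simps)
  obtain s t where st: "0 < s" "s < h" "0 < t" "t < h" and P:
    "f (x + h *\<^sub>R a + h *\<^sub>R b) - f (x + h *\<^sub>R a) - f (x + h *\<^sub>R b) + f x
      = h * h * P (x + s *\<^sub>R a + t *\<^sub>R b)"
    unfolding P_def using second_difference_mean_value[OF assms(2) h, of x a b] near r(2) by metis
  obtain s' t' where st': "0 < s'" "s' < h" "0 < t'" "t' < h" and Q: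
    "f (x + h *\<^sub>R b + h *\<^sub>R a) - f (x + h *\<^sub>R b) - f (x + h *\<^sub>R a) + f x
      = h * h * Q (x + s' *\<^sub>R b + t' *\<^sub>R a)"
    unfolding Q_def using second_difference_mean_value[OF assms(2) h, of x b a] near' r(2) by metis
  have "h * h * P (x + s *\<^sub>R a + t *\<^sub>R b) = h * h * Q (x + s' *\<^sub>R b + t' *\<^sub>R a)"
    using P Q by (simp add: algebra_simps)
  then have "P (x + s *\<^sub>R a + t *\<^sub>R b) = Q (x + s' *\<^sub>R b + t' *\<^sub>R a)" using h by simp
  moreover have "dist (P (x + s *\<^sub>R a + t *\<^sub>R b)) (P x) < e" using r(2) near st by simp
  moreover have "dist (Q (x + s' *\<^sub>R b + t' *\<^sub>R a)) (Q x) < e" using r(2) near' st' by simp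
  ultimately have "dist (P x) (Q x) < dist (P x) (Q x)"
    unfolding e_def by (metis dist_triangle_half_r)
  then show False by simp
qed

section \<open>Smoothness at a point\<close>

abbreviation \<E> :: "('e::euclidean_space, 'e) manifold" where
  "\<E> \<equiv> euclidean_manifold UNIV"

text \<open>The part of \<open>smooth_manifold\<close> without transition maps. Products of
  manifolds are used with this property only, so smoothness of their transition maps never has to be
  established.\<close>

definition charted :: "('m, 'e::euclidean_space) manifold \<Rightarrow> bool" where
  "charted M \<longleftrightarrow>
     (\<Union>(U, \<phi>)\<in>atlas M. U) = topspace (mtop M) \<and>
     (\<forall>(U, \<phi>)\<in>atlas M. openin (mtop M) U \<and> open (\<phi> ` U) \<and>
        homeomorphic_map (subtopology (mtop M) U) (top_of_set (\<phi> ` U)) \<phi>)"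

text \<open>Quantifying over all charts makes composition independent of the smoothness of transition
  maps, so that it applies to product manifolds as well.\<close>

definition smooth_map_at ::
  "('m, 'e::euclidean_space) manifold \<Rightarrow> ('n, 'f::euclidean_space) manifold \<Rightarrow> 'm \<Rightarrow> ('m \<Rightarrow> 'n) \<Rightarrow> bool" where
  "smooth_map_at M N p F \<longleftrightarrow>
     (\<forall>U \<phi> V \<psi>. (U, \<phi>) \<in> atlas M \<longrightarrow> (V, \<psi>) \<in> atlas N \<longrightarrow> p \<in> U \<longrightarrow> F p \<in> V \<longrightarrow>
        (\<exists>T. open T \<and> \<phi> p \<in> T \<and> T \<subseteq> \<phi> ` U \<and> (\<forall>x\<in>T. F (inv_into U \<phi> x) \<in> V) \<and>
             smooth_on T (\<lambda>x. \<psi> (F (inv_into U \<phi> x)))))"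

lemma smooth_map_atD:
  assumes "smooth_map_at M N p F" "(U, \<phi>) \<in> atlas M" "(V, \<psi>) \<in> atlas N" "p \<in> U" "F p \<in> V"
  obtains T where "open T" "\<phi> p \<in> T" "T \<subseteq> \<phi> ` U" "\<And>x. x \<in> T \<Longrightarrow> F (inv_into U \<phi> x) \<in> V"
    "smooth_on T (\<lambda>x. \<psi> (F (inv_into U \<phi> x)))"
  using assms unfolding smooth_map_at_def by metis

lemma smooth_manifold_charted: "smooth_manifold M \<Longrightarrow> charted M"
  unfolding smooth_manifold_def charted_def by auto

lemma charted_topspace: "charted M \<Longrightarrow> p \<in> topspace (mtop M) \<longleftrightarrow> (\<exists>U \<phi>. (U, \<phi>) \<in> atlas M \<and> p \<in> U)"
proof -
  assume "charted M"
  then have "topspace (mtop M) = (\<Union>(U, \<phi>)\<in>atlas M. U)" unfolding charted_def by simp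
  then show ?thesis by auto
qed

lemma charted_obtain:
  assumes "charted M" "p \<in> topspace (mtop M)"
  obtains U \<phi> where "(U, \<phi>) \<in> atlas M" "p \<in> U"
  using assms charted_topspace by metis

section \<open>Properties of a single chart\<close>

context
  fixes M :: "('m, 'e::euclidean_space) manifold" and U \<phi>
  assumes M: "charted M" and ch: "(U, \<phi>) \<in> atlas M"
begin

lemma chart_openin: "openin (mtop M) U"
  using M ch unfolding charted_def by auto

lemma chart_subset: "U \<subseteq> topspace (mtop M)"
  using chart_openin openin_subset by auto

lemma chart_open_image: "open (\<phi> ` U)"
  using M ch unfolding charted_def by auto

lemma chart_homeomorphic: "homeomorphic_map (subtopology (mtop M) U) (top_of_set (\<phi> ` U)) \<phi>"
  using M ch unfolding charted_def by auto

lemma chart_topspace: "topspace (subtopology (mtop M) U) = U"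
  using chart_subset by auto

lemma chart_inj: "inj_on \<phi> U"
  using homeomorphic_imp_injective_map[OF chart_homeomorphic] chart_topspace by simp

lemma chart_inv: "x \<in> U \<Longrightarrow> inv_into U \<phi> (\<phi> x) = x"
  using chart_inj by simp

lemma chart_open_image_Int:
  assumes "openin (mtop M) W"
  shows "open (\<phi> ` (U \<inter> W))"
proof -
  have "openin (subtopology (mtop M) U) (U \<inter> W)"
    using assms by (simp add: openin_subtopology_Int2)
  then have "openin (top_of_set (\<phi> ` U)) (\<phi> ` (U \<inter> W))"
    using homeomorphic_imp_open_map[OF chart_homeomorphic] unfolding open_map_def by blast
  then show ?thesis using chart_open_image openin_open_trans by blast
qed

lemma chart_openin_vimage:
  assumes "open T"
  shows "openin (mtop M) {x \<in> U. \<phi> x \<in> T}"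
proof -
  have "openin (subtopology (mtop M) U) {x \<in> topspace (subtopology (mtop M) U). \<phi> x \<in> \<phi> ` U \<inter> T}"
    using homeomorphic_imp_continuous_map[OF chart_homeomorphic] assms
    by (intro openin_continuous_map_preimage) (auto intro: openin_open_Int)
  moreover have "{x \<in> topspace (subtopology (mtop M) U). \<phi> x \<in> \<phi> ` U \<inter> T} = {x \<in> U. \<phi> x \<in> T}"
    using chart_topspace by auto
  ultimately show ?thesis using openin_trans_full chart_openin by metis
qed

end

section \<open>Euclidean spaces and products\<close>

lemma charted_euclidean:
  assumes "open W"
  shows "charted (euclidean_manifold W)"
  unfolding charted_def euclidean_manifold_def using assms
  by (simp add: subtopology_subtopology homeomorphic_map_id[unfolded id_def])

lemma inv_into_ident [simp]: "x \<in> W \<Longrightarrow> inv_into W (\<lambda>x. x) x = x"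
  using inv_into_f_f[of "\<lambda>x. x" W x] by simp

lemma atlas_euclidean [simp]: "atlas (euclidean_manifold W) = {(W, \<lambda>x. x)}"
  and mtop_euclidean [simp]: "mtop (euclidean_manifold W) = top_of_set W"
  by (simp_all add: euclidean_manifold_def)

lemma inv_into_map_prod:
  assumes "inj_on \<phi> U" "inj_on \<psi> V" "x \<in> \<phi> ` U" "y \<in> \<psi> ` V"
  shows "inv_into (U \<times> V) (map_prod \<phi> \<psi>) (x, y) = (inv_into U \<phi> x, inv_into V \<psi> y)"
proof (rule inv_into_f_eq)
  show "inj_on (map_prod \<phi> \<psi>) (U \<times> V)" by (rule map_prod_inj_on[OF assms(1,2)])
  show "(inv_into U \<phi> x, inv_into V \<psi> y) \<in> U \<times> V" using assms by (simp add: inv_into_into)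
  show "map_prod \<phi> \<psi> (inv_into U \<phi> x, inv_into V \<psi> y) = (x, y)" using assms by (simp add: f_inv_into_f)
qed

lemma charted_prod:
  fixes M :: "('m, 'e::euclidean_space) manifold" and N :: "('n, 'f::euclidean_space) manifold"
  assumes "charted M" "charted N"
  shows "charted (prod_manifold M N)"
proof -
  have "openin (prod_topology (mtop M) (mtop N)) (U \<times> V)"
    "open (map_prod \<phi> \<psi> ` (U \<times> V))"
    "homeomorphic_map (subtopology (prod_topology (mtop M) (mtop N)) (U \<times> V))
          (top_of_set (map_prod \<phi> \<psi> ` (U \<times> V))) (map_prod \<phi> \<psi>)"
    if c: "(U, \<phi>) \<in> atlas M" "(V, \<psi>) \<in> atlas N" for U \<phi> V \<psi>
  proof -
    show "openin (prod_topology (mtop M) (mtop N)) (U \<times> V)"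
      using chart_openin[OF assms(1) c(1)] chart_openin[OF assms(2) c(2)]
      by (simp add: openin_prod_Times_iff)
    have im: "map_prod \<phi> \<psi> ` (U \<times> V) = \<phi> ` U \<times> \<psi> ` V" by force
    show "open (map_prod \<phi> \<psi> ` (U \<times> V))"
      unfolding im by (intro open_Times chart_open_image[OF assms(1) c(1)] chart_open_image[OF assms(2) c(2)])
    have top: "top_of_set (\<phi> ` U \<times> \<psi> ` V) = prod_topology (top_of_set (\<phi> ` U)) (top_of_set (\<psi> ` V))"
      by simp
    have "map_prod \<phi> \<psi> = (\<lambda>(x, y). (\<phi> x, \<psi> y))" by auto
    then show "homeomorphic_map (subtopology (prod_topology (mtop M) (mtop N)) (U \<times> V))
          (top_of_set (map_prod \<phi> \<psi> ` (U \<times> V))) (map_prod \<phi> \<psi>)"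
      unfolding im subtopology_Times top
      using chart_homeomorphic[OF assms(1) c(1)] chart_homeomorphic[OF assms(2) c(2)]
      by (metis homeomorphic_map_maps homeomorphic_maps_prod)
  qed
  moreover have "(\<Union>(U, \<phi>)\<in>atlas (prod_manifold M N). U) = topspace (mtop (prod_manifold M N))"
  proof -
    have "(\<Union>(U, \<phi>)\<in>atlas (prod_manifold M N). U) = (\<Union>(U, \<phi>)\<in>atlas M. U) \<times> (\<Union>(U, \<phi>)\<in>atlas N. U)"
    proof (rule equalityI; rule subsetI)
      fix z assume "z \<in> (\<Union>(U, \<phi>)\<in>atlas (prod_manifold M N). U)"
      then obtain W \<eta> where W: "(W, \<eta>) \<in> atlas (prod_manifold M N)" "z \<in> W" by auto
      obtain U \<phi> V \<psi> where "W = U \<times> V" "(U, \<phi>) \<in> atlas M" "(V, \<psi>) \<in> atlas N"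
        using W(1) by (auto simp: prod_manifold_def)
      then show "z \<in> (\<Union>(U, \<phi>)\<in>atlas M. U) \<times> (\<Union>(U, \<phi>)\<in>atlas N. U)"
        using W(2) by fastforce
    next
      fix z assume "z \<in> (\<Union>(U, \<phi>)\<in>atlas M. U) \<times> (\<Union>(U, \<phi>)\<in>atlas N. U)"
      then obtain U \<phi> V \<psi> where c: "(U, \<phi>) \<in> atlas M" "(V, \<psi>) \<in> atlas N" "z \<in> U \<times> V" by auto
      have "(U \<times> V, map_prod \<phi> \<psi>) \<in> atlas (prod_manifold M N)"
        using c by (auto simp: prod_manifold_def)
      then show "z \<in> (\<Union>(U, \<phi>)\<in>atlas (prod_manifold M N). U)" using c(3) by fast
    qed
    then show ?thesis using assms unfolding charted_def by (simp add: prod_manifold_def)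
  qed
  ultimately show ?thesis
    unfolding charted_def by (auto simp: prod_manifold_def)
qed

lemma smooth_map_imp_at:
  assumes M: "charted M" and N: "charted N" and F: "smooth_map M N F"
  shows "smooth_map_at M N p F"
  unfolding smooth_map_at_def
proof (intro allI impI)
  fix U \<phi> V \<psi>
  assume c: "(U, \<phi>) \<in> atlas M" "(V, \<psi>) \<in> atlas N" "p \<in> U" "F p \<in> V"
  \<comment> \<open>Continuity of F enters here: it makes the domain of the local expression open,
    and \<open>smooth_on\<close> is meaningful on open sets only.\<close>
  let ?W = "{x \<in> topspace (mtop M). F x \<in> V}"
  have W: "openin (mtop M) ?W"
    using F chart_openin[OF N c(2)] unfolding smooth_map_def
    by (intro openin_continuous_map_preimage[of _ "mtop N"]) auto
  have eq: "U \<inter> ?W = U \<inter> F -` V" using chart_subset[OF M c(1)] by auto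
  show "\<exists>T. open T \<and> \<phi> p \<in> T \<and> T \<subseteq> \<phi> ` U \<and> (\<forall>x\<in>T. F (inv_into U \<phi> x) \<in> V) \<and>
      smooth_on T (\<lambda>x. \<psi> (F (inv_into U \<phi> x)))"
  proof (intro exI[of _ "\<phi> ` (U \<inter> F -` V)"] conjI)
    show "open (\<phi> ` (U \<inter> F -` V))" using chart_open_image_Int[OF M c(1) W] eq by simp
    show "smooth_on (\<phi> ` (U \<inter> F -` V)) (\<lambda>x. \<psi> (F (inv_into U \<phi> x)))"
      using F c(1,2) unfolding smooth_map_def by auto
  qed (use c chart_inv[OF M c(1)] in auto)
qed

lemma smooth_map_at_compose:
  assumes M: "charted M" and N: "charted N" and y: "F p \<in> topspace (mtop N)"
    and F: "smooth_map_at M N p F" and G: "smooth_map_at N L (F p) G"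
  shows "smooth_map_at M L p (\<lambda>x. G (F x))"
  unfolding smooth_map_at_def
proof (intro allI impI)
  fix U \<phi> W \<eta>
  assume c: "(U, \<phi>) \<in> atlas M" "(W, \<eta>) \<in> atlas L" "p \<in> U" "G (F p) \<in> W"
  obtain V \<psi> where V: "(V, \<psi>) \<in> atlas N" "F p \<in> V" using charted_obtain[OF N y] .
  obtain T1 where T1: "open T1" "\<phi> p \<in> T1" "T1 \<subseteq> \<phi> ` U" "\<And>x. x \<in> T1 \<Longrightarrow> F (inv_into U \<phi> x) \<in> V"
    "smooth_on T1 (\<lambda>x. \<psi> (F (inv_into U \<phi> x)))"
    using smooth_map_atD[OF F c(1) V(1) c(3) V(2)] by blast
  obtain T2 where T2: "open T2" "\<psi> (F p) \<in> T2" "T2 \<subseteq> \<psi> ` V" "\<And>x. x \<in> T2 \<Longrightarrow> G (inv_into V \<psi> x) \<in> W"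
    "smooth_on T2 (\<lambda>x. \<eta> (G (inv_into V \<psi> x)))"
    using smooth_map_atD[OF G V(1) c(2) V(2) c(4)] by blast
  define h where "h x = \<psi> (F (inv_into U \<phi> x))" for x
  have h: "inv_into V \<psi> (h x) = F (inv_into U \<phi> x)" if "x \<in> T1" for x
    unfolding h_def using chart_inv[OF N V(1)] T1(4)[OF that] by simp
  define T where "T = T1 \<inter> h -` T2"
  have opT: "open T"
    unfolding T_def using smooth_on_continuous[OF T1(5)] T1(1) T2(1)
    by (simp add: h_def[abs_def] continuous_open_preimage)
  show "\<exists>T. open T \<and> \<phi> p \<in> T \<and> T \<subseteq> \<phi> ` U \<and> (\<forall>x\<in>T. G (F (inv_into U \<phi> x)) \<in> W) \<and>
      smooth_on T (\<lambda>x. \<eta> (G (F (inv_into U \<phi> x))))"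
  proof (intro exI[of _ T] conjI ballI)
    have hs: "smooth_on T h"
      unfolding h_def[abs_def] by (rule smooth_on_subset[OF T1(5)]) (auto simp: T_def)
    have "smooth_on T (\<lambda>x. \<eta> (G (inv_into V \<psi> (h x))))"
      by (rule smooth_on_compose[OF opT T2(1) _ hs T2(5)]) (auto simp: T_def)
    then show "smooth_on T (\<lambda>x. \<eta> (G (F (inv_into U \<phi> x))))"
      by (rule smooth_on_transform[OF _ opT]) (use h in \<open>auto simp: T_def\<close>)
    show "\<phi> p \<in> T" using T1(2) T2(2) chart_inv[OF M c(1,3)] by (simp add: T_def h_def)
    show "G (F (inv_into U \<phi> x)) \<in> W" if "x \<in> T" for x
      using T2(4)[of "h x"] h[of x] that by (auto simp: T_def)
  qed (use opT T1(3) in \<open>auto simp: T_def\<close>)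
qed

lemma smooth_map_at_cong:
  assumes M: "charted M" and W: "openin (mtop M) W" "p \<in> W" "\<And>x. x \<in> W \<Longrightarrow> F x = G x"
    and F: "smooth_map_at M N p F"
  shows "smooth_map_at M N p G"
  unfolding smooth_map_at_def
proof (intro allI impI)
  fix U \<phi> V \<psi>
  assume c: "(U, \<phi>) \<in> atlas M" "(V, \<psi>) \<in> atlas N" "p \<in> U" "G p \<in> V"
  obtain T where T: "open T" "\<phi> p \<in> T" "T \<subseteq> \<phi> ` U" "\<And>x. x \<in> T \<Longrightarrow> F (inv_into U \<phi> x) \<in> V"
    "smooth_on T (\<lambda>x. \<psi> (F (inv_into U \<phi> x)))"
    using smooth_map_atD[OF F c(1,2,3)] c(4) W by metis
  let ?T = "T \<inter> \<phi> ` (U \<inter> W)"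
  have opT: "open ?T" using T(1) chart_open_image_Int[OF M c(1) W(1)] by blast
  have eq: "F (inv_into U \<phi> x) = G (inv_into U \<phi> x)" if "x \<in> ?T" for x
    using that W(3) chart_inv[OF M c(1)] by auto
  have "smooth_on ?T (\<lambda>x. \<psi> (G (inv_into U \<phi> x)))"
    by (rule smooth_on_transform[OF smooth_on_subset[OF T(5)] opT]) (use eq in auto)
  then show "\<exists>T. open T \<and> \<phi> p \<in> T \<and> T \<subseteq> \<phi> ` U \<and> (\<forall>x\<in>T. G (inv_into U \<phi> x) \<in> V) \<and>
      smooth_on T (\<lambda>x. \<psi> (G (inv_into U \<phi> x)))"
    using T opT eq c(3) W(2) by (intro exI[of _ ?T]) (auto, metis IntI imageI)
qed

section \<open>Vector-valued functions smooth at a point\<close>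

lemma smooth_at_iff:
  "smooth_map_at M \<E> p f \<longleftrightarrow>
     (\<forall>U \<phi>. (U, \<phi>) \<in> atlas M \<longrightarrow> p \<in> U \<longrightarrow>
        (\<exists>T. open T \<and> \<phi> p \<in> T \<and> T \<subseteq> \<phi> ` U \<and> smooth_on T (\<lambda>x. f (inv_into U \<phi> x))))"
  unfolding smooth_map_at_def by simp

lemma smooth_atD:
  assumes "smooth_map_at M \<E> p f" "(U, \<phi>) \<in> atlas M" "p \<in> U"
  obtains T where "open T" "\<phi> p \<in> T" "T \<subseteq> \<phi> ` U" "smooth_on T (\<lambda>x. f (inv_into U \<phi> x))"
  using assms unfolding smooth_at_iff by metis

lemma smooth_at_euclidean_iff:
  "smooth_map_at \<E> \<E> x f \<longleftrightarrow> (\<exists>T. open T \<and> x \<in> T \<and> smooth_on T f)"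
  unfolding smooth_at_iff by simp

lemma smooth_at_combine:
  fixes M :: "('m, 'e::euclidean_space) manifold" and h :: "'a::euclidean_space \<Rightarrow> 'b::euclidean_space \<Rightarrow> 'c::euclidean_space"
  assumes M: "charted M" and f: "smooth_map_at M \<E> p f" and g: "smooth_map_at M \<E> p g"
    and h: "\<And>(S::'e set) f g. open S \<Longrightarrow> smooth_on S f \<Longrightarrow> smooth_on S g \<Longrightarrow> smooth_on S (\<lambda>x. h (f x) (g x))"
  shows "smooth_map_at M \<E> p (\<lambda>x. h (f x) (g x))"
  unfolding smooth_at_iff
proof (intro allI impI)
  fix U \<phi> assume c: "(U, \<phi>) \<in> atlas M" "p \<in> U"
  obtain T1 where T1: "open T1" "\<phi> p \<in> T1" "T1 \<subseteq> \<phi> ` U" "smooth_on T1 (\<lambda>x. f (inv_into U \<phi> x))"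
    using f c unfolding smooth_at_iff by metis
  obtain T2 where T2: "open T2" "\<phi> p \<in> T2" "smooth_on T2 (\<lambda>x. g (inv_into U \<phi> x))"
    using g c unfolding smooth_at_iff by metis
  show "\<exists>T. open T \<and> \<phi> p \<in> T \<and> T \<subseteq> \<phi> ` U \<and> smooth_on T (\<lambda>x. h (f (inv_into U \<phi> x)) (g (inv_into U \<phi> x)))"
    using T1 T2 smooth_on_subset[OF T1(4), of "T1 \<inter> T2"] smooth_on_subset[OF T2(3), of "T1 \<inter> T2"]
    by (intro exI[of _ "T1 \<inter> T2"] conjI h) auto
qed

lemma smooth_at_add:
  "charted M \<Longrightarrow> smooth_map_at M \<E> p f \<Longrightarrow> smooth_map_at M \<E> p g \<Longrightarrow> smooth_map_at M \<E> p (\<lambda>x. f x + g x)"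
  by (rule smooth_at_combine[where h = "(+)"]) (auto intro: smooth_on_add)

lemma smooth_at_mult:
  fixes f g :: "'m \<Rightarrow> real"
  shows "charted M \<Longrightarrow> smooth_map_at M \<E> p f \<Longrightarrow> smooth_map_at M \<E> p g \<Longrightarrow> smooth_map_at M \<E> p (\<lambda>x. f x * g x)"
  by (rule smooth_at_combine[where h = "(*)"]) (auto intro: smooth_on_mult)

lemma smooth_at_const: "charted M \<Longrightarrow> smooth_map_at M \<E> p (\<lambda>x. c)"
  unfolding smooth_at_iff
proof (intro allI impI)
  fix U \<phi> assume "charted M" "(U, \<phi>) \<in> atlas M" "p \<in> U"
  then show "\<exists>T. open T \<and> \<phi> p \<in> T \<and> T \<subseteq> \<phi> ` U \<and> smooth_on T (\<lambda>x. c)"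
    by (intro exI[of _ "\<phi> ` U"]) (simp add: chart_open_image smooth_on_const)
qed

lemma smooth_at_sum:
  assumes M: "charted M" and "\<And>i. i \<in> I \<Longrightarrow> smooth_map_at M \<E> p (f i)"
  shows "smooth_map_at M \<E> p (\<lambda>x. \<Sum>i\<in>I. f i x)"
  using assms(2)
proof (induction I rule: infinite_finite_induct)
  case (insert i I)
  then show ?case by (auto intro!: smooth_at_add[OF M])
qed (simp_all add: smooth_at_const[OF M])

lemma smooth_at_compose_euclidean:
  assumes M: "charted M" and f: "smooth_map_at M \<E> p f" and T: "open T" "f p \<in> T" "smooth_on T g"
  shows "smooth_map_at M \<E> p (\<lambda>x. g (f x))"
  using T by (intro smooth_map_at_compose[OF M charted_euclidean[OF open_UNIV] _ f])
     (auto simp: smooth_at_euclidean_iff)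

lemma smooth_at_bounded_linear:
  assumes "charted M" "smooth_map_at M \<E> p f" "bounded_linear L"
  shows "smooth_map_at M \<E> p (\<lambda>x. L (f x))"
  using smooth_at_compose_euclidean[OF assms(1,2) open_UNIV UNIV_I smooth_on_bounded_linear[OF assms(3)]] .

lemma smooth_at_inverse:
  assumes "charted M" "smooth_map_at M \<E> p f" "f p \<noteq> (0::real)"
  shows "smooth_map_at M \<E> p (\<lambda>x. inverse (f x))"
  using assms by (intro smooth_at_compose_euclidean[OF assms(1,2) _ _ smooth_on_inverse])
    (auto simp: open_Collect_neq)

lemma smooth_map_at_ident:
  assumes M: "smooth_manifold M"
  shows "smooth_map_at M M p (\<lambda>x. x)"
  unfolding smooth_map_at_def
proof (intro allI impI)
  fix U \<phi> V \<psi>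
  assume c: "(U, \<phi>) \<in> atlas M" "(V, \<psi>) \<in> atlas M" "p \<in> U" "p \<in> V"
  note M' = smooth_manifold_charted[OF M]
  show "\<exists>T. open T \<and> \<phi> p \<in> T \<and> T \<subseteq> \<phi> ` U \<and> (\<forall>x\<in>T. inv_into U \<phi> x \<in> V) \<and>
      smooth_on T (\<lambda>x. \<psi> (inv_into U \<phi> x))"
  proof (intro exI[of _ "\<phi> ` (U \<inter> V)"] conjI)
    show "smooth_on (\<phi> ` (U \<inter> V)) (\<lambda>x. \<psi> (inv_into U \<phi> x))"
      using M c(1,2) unfolding smooth_manifold_def by blast
    show "open (\<phi> ` (U \<inter> V))" using chart_open_image_Int[OF M' c(1) chart_openin[OF M' c(2)]] .
  qed (use c chart_inv[OF M' c(1)] in auto)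
qed

lemma smooth_at_chart:
  assumes M: "smooth_manifold M" and c: "(U, \<phi>) \<in> atlas M" "p \<in> U"
  shows "smooth_map_at M \<E> p \<phi>"
  unfolding smooth_at_iff
proof (intro allI impI)
  fix V \<psi> assume V: "(V, \<psi>) \<in> atlas M" "p \<in> V"
  obtain T where "open T" "\<psi> p \<in> T" "T \<subseteq> \<psi> ` V" "smooth_on T (\<lambda>x. \<phi> (inv_into V \<psi> x))"
    using smooth_map_atD[OF smooth_map_at_ident[OF M] V(1) c(1) V(2) c(2)] .
  then show "\<exists>T. open T \<and> \<psi> p \<in> T \<and> T \<subseteq> \<psi> ` V \<and> smooth_on T (\<lambda>x. \<phi> (inv_into V \<psi> x))"
    by blast
qed

lemma smooth_map_at_inv_chart:
  assumes M: "smooth_manifold M" and c: "(U, \<phi>) \<in> atlas M" "x \<in> \<phi> ` U"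
  shows "smooth_map_at \<E> M x (inv_into U \<phi>)"
  unfolding smooth_map_at_def
proof (intro allI impI)
  fix U0 \<phi>0 V \<psi>
  assume a: "(U0, \<phi>0) \<in> atlas \<E>" "(V, \<psi>) \<in> atlas M" "x \<in> U0" "inv_into U \<phi> x \<in> V"
  have p: "inv_into U \<phi> x \<in> U" "\<phi> (inv_into U \<phi> x) = x"
    using c(2) by (simp_all add: inv_into_into f_inv_into_f)
  obtain T where T: "open T" "\<phi> (inv_into U \<phi> x) \<in> T" "T \<subseteq> \<phi> ` U" "\<And>y. y \<in> T \<Longrightarrow> inv_into U \<phi> y \<in> V"
    "smooth_on T (\<lambda>y. \<psi> (inv_into U \<phi> y))"
    using smooth_map_atD[OF smooth_map_at_ident[OF M] c(1) a(2) p(1) a(4)] by blast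
  have "U0 = UNIV" "\<phi>0 = (\<lambda>x. x)" using a(1) by simp_all
  then show "\<exists>T. open T \<and> \<phi>0 x \<in> T \<and> T \<subseteq> \<phi>0 ` U0 \<and> (\<forall>x\<in>T. inv_into U \<phi> (inv_into U0 \<phi>0 x) \<in> V) \<and>
      smooth_on T (\<lambda>x. \<psi> (inv_into U \<phi> (inv_into U0 \<phi>0 x)))"
    using T p(2) by (intro exI[of _ T]) simp
qed

text \<open>Outside all charts \<open>smooth_map_at\<close> holds vacuously, hence the membership in
  \<open>topspace\<close>. From right to left, smoothness in one chart spreads to a coordinate
  neighbourhood W and to every other chart, because f near a point of W is its local expression
  composed with the chart map, itself smooth in all charts.\<close>

lemma smooth_near_iff:
  assumes M: "smooth_manifold M"
  shows "smooth_near M p f \<longleftrightarrow> p \<in> topspace (mtop M) \<and> smooth_map_at M \<E> p f"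
proof
  note M' = smooth_manifold_charted[OF M]
  assume "smooth_near M p f"
  then obtain W where W: "openin (mtop M) W" "p \<in> W"
    "smooth_map (open_submanifold M W) \<E> f" unfolding smooth_near_def by blast
  have "smooth_map_at M \<E> p f"
    unfolding smooth_at_iff
  proof (intro allI impI)
    fix U \<phi> assume c: "(U, \<phi>) \<in> atlas M" "p \<in> U"
    let ?T = "\<phi> ` (U \<inter> W)"
    have op: "open ?T" by (rule chart_open_image_Int[OF M' c(1) W(1)])
    have "(U \<inter> W, \<phi>) \<in> atlas (open_submanifold M W)"
      using c(1) by (force simp: open_submanifold_def)
    then have sm: "smooth_on ?T (\<lambda>x. f (inv_into (U \<inter> W) \<phi> x))"
      using W(3) unfolding smooth_map_def by force
    \<comment> \<open>Inverting the chart on the smaller domain is a separate choice function;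
      injectivity of \<open>\<phi>\<close> makes both inverses agree on the image.\<close>
    have eq: "inv_into (U \<inter> W) \<phi> x = inv_into U \<phi> x" if "x \<in> ?T" for x
    proof -
      have "inj_on \<phi> (U \<inter> W)" using chart_inj[OF M' c(1)] by (rule inj_on_subset) auto
      then show ?thesis using that chart_inv[OF M' c(1)] by auto
    qed
    have "smooth_on ?T (\<lambda>x. f (inv_into U \<phi> x))"
      by (rule smooth_on_transform[OF sm op]) (simp add: eq)
    then show "\<exists>T. open T \<and> \<phi> p \<in> T \<and> T \<subseteq> \<phi> ` U \<and> smooth_on T (\<lambda>x. f (inv_into U \<phi> x))"
      using op c(2) W(2) by (intro exI[of _ ?T]) auto
  qed
  then show "p \<in> topspace (mtop M) \<and> smooth_map_at M \<E> p f"
    using W openin_subset by blast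
next
  note M' = smooth_manifold_charted[OF M]
  assume a: "p \<in> topspace (mtop M) \<and> smooth_map_at M \<E> p f"
  obtain U \<phi> where c: "(U, \<phi>) \<in> atlas M" "p \<in> U" using charted_obtain[OF M'] a by blast
  obtain T where T: "open T" "\<phi> p \<in> T" "T \<subseteq> \<phi> ` U" "smooth_on T (\<lambda>x. f (inv_into U \<phi> x))"
    using a c unfolding smooth_at_iff by metis
  define W where "W = {x \<in> U. \<phi> x \<in> T}"
  have W: "openin (mtop M) W" "p \<in> W"
    unfolding W_def using chart_openin_vimage[OF M' c(1) T(1)] T(2) c(2) by auto
  have at: "smooth_map_at M \<E> q f" if "q \<in> W" for q
  proof (rule smooth_map_at_cong[OF M' W(1) that])
    show "smooth_map_at M \<E> q (\<lambda>x. f (inv_into U \<phi> (\<phi> x)))"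
      by (rule smooth_at_compose_euclidean[OF M' smooth_at_chart[OF M c(1)] T(1) _ T(4)])
        (use that in \<open>auto simp: W_def\<close>)
  qed (use chart_inv[OF M' c(1)] in \<open>auto simp: W_def\<close>)
  have "smooth_map (open_submanifold M W) \<E> f"
    unfolding smooth_map_def
  proof
    have cm: "continuous_map (subtopology (mtop M) W) (top_of_set T) \<phi>"
    proof -
      have "continuous_map (subtopology (mtop M) U) euclidean \<phi>"
        using homeomorphic_imp_continuous_map[OF chart_homeomorphic[OF M' c(1)]]
        by (simp add: continuous_map_in_subtopology)
      then have "continuous_map (subtopology (mtop M) W) euclidean \<phi>"
        by (rule continuous_map_from_subtopology_mono) (auto simp: W_def)
      then show ?thesis by (auto simp: continuous_map_in_subtopology W_def)
    qed
    have "continuous_map (top_of_set T) euclidean (\<lambda>x. f (inv_into U \<phi> x))"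
      using smooth_on_continuous[OF T(4)] by simp
    from continuous_map_compose[OF cm this]
    have "continuous_map (subtopology (mtop M) W) euclidean f"
      by (rule continuous_map_eq) (use chart_inv[OF M' c(1)] in \<open>auto simp: W_def\<close>)
    then show "continuous_map (mtop (open_submanifold M W)) (mtop \<E>) f"
      by (simp add: open_submanifold_def)
    have "smooth_on (\<psi> ` (V \<inter> W)) (\<lambda>x. f (inv_into (V \<inter> W) \<psi> x))" if V: "(V, \<psi>) \<in> atlas M" for V \<psi>
    proof (rule smooth_on_local)
      fix x assume "x \<in> \<psi> ` (V \<inter> W)"
      then obtain q where q: "q \<in> V" "q \<in> W" "x = \<psi> q" by auto
      obtain T' where T': "open T'" "x \<in> T'" "T' \<subseteq> \<psi> ` V" "smooth_on T' (\<lambda>x. f (inv_into V \<psi> x))"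
        using smooth_atD[OF at[OF q(2)] V q(1)] unfolding q(3) .
      let ?T = "T' \<inter> \<psi> ` (V \<inter> W)"
      have op: "open ?T" using T'(1) chart_open_image_Int[OF M' V W(1)] by blast
      have eq: "inv_into (V \<inter> W) \<psi> y = inv_into V \<psi> y" if "y \<in> ?T" for y
      proof -
        have "inj_on \<psi> (V \<inter> W)" using chart_inj[OF M' V] by (rule inj_on_subset) auto
        then show ?thesis using that chart_inv[OF M' V] by auto
      qed
      have "smooth_on ?T (\<lambda>x. f (inv_into (V \<inter> W) \<psi> x))"
        by (rule smooth_on_transform[OF smooth_on_subset[OF T'(4)] op]) (simp_all add: eq)
      then show "\<exists>T. open T \<and> x \<in> T \<and> smooth_on T (\<lambda>x. f (inv_into (V \<inter> W) \<psi> x))"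
        using op T'(2) q by (intro exI[of _ ?T]) auto
    qed
    then show "\<forall>(U, \<phi>)\<in>atlas (open_submanifold M W). \<forall>(V, \<psi>)\<in>atlas \<E>.
        smooth_on (\<phi> ` (U \<inter> f -` V)) (\<lambda>x. \<psi> (f (inv_into U \<phi> x)))"
      by (auto simp: open_submanifold_def)
  qed
  then show "smooth_near M p f" unfolding smooth_near_def using W by blast
qed

lemma smooth_near_eventually:
  assumes "smooth_manifold M" "smooth_near M p f"
  obtains W where "openin (mtop M) W" "p \<in> W" "\<And>q. q \<in> W \<Longrightarrow> smooth_near M q f"
  using assms(2) unfolding smooth_near_def by blast

lemma smooth_map_at_Pair:
  assumes L: "charted L" and M: "charted M" and N: "charted N" 
    and F: "smooth_map_at L M p F" and G: "smooth_map_at L N p G"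
  shows "smooth_map_at L (prod_manifold M N) p (\<lambda>x. (F x, G x))"
  unfolding smooth_map_at_def
proof (intro allI impI)
  fix U \<phi> VW \<psi>\<eta>
  assume c: "(U, \<phi>) \<in> atlas L" "(VW, \<psi>\<eta>) \<in> atlas (prod_manifold M N)" "p \<in> U" "(F p, G p) \<in> VW"
  obtain V \<psi> W \<eta> where VW: "VW = V \<times> W" "\<psi>\<eta> = map_prod \<psi> \<eta>" "(V, \<psi>) \<in> atlas M" "(W, \<eta>) \<in> atlas N"
    using c(2) by (auto simp: prod_manifold_def)
  have "F p \<in> V" "G p \<in> W" using c(4) VW(1) by auto
  obtain T1 where T1: "open T1" "\<phi> p \<in> T1" "T1 \<subseteq> \<phi> ` U" "\<And>x. x \<in> T1 \<Longrightarrow> F (inv_into U \<phi> x) \<in> V"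
    "smooth_on T1 (\<lambda>x. \<psi> (F (inv_into U \<phi> x)))"
    using smooth_map_atD[OF F c(1) VW(3) c(3) \<open>F p \<in> V\<close>] by blast
  obtain T2 where T2: "open T2" "\<phi> p \<in> T2" "T2 \<subseteq> \<phi> ` U" "\<And>x. x \<in> T2 \<Longrightarrow> G (inv_into U \<phi> x) \<in> W"
    "smooth_on T2 (\<lambda>x. \<eta> (G (inv_into U \<phi> x)))"
    using smooth_map_atD[OF G c(1) VW(4) c(3) \<open>G p \<in> W\<close>] by blast
  show "\<exists>T. open T \<and> \<phi> p \<in> T \<and> T \<subseteq> \<phi> ` U \<and> (\<forall>x\<in>T. (F (inv_into U \<phi> x), G (inv_into U \<phi> x)) \<in> VW) \<and>
      smooth_on T (\<lambda>x. \<psi>\<eta> (F (inv_into U \<phi> x), G (inv_into U \<phi> x)))"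
    unfolding VW(1,2) map_prod_simp
    using T1 T2 smooth_on_subset[OF T1(5), of "T1 \<inter> T2"] smooth_on_subset[OF T2(5), of "T1 \<inter> T2"]
    by (intro exI[of _ "T1 \<inter> T2"] conjI smooth_on_Pair) auto
qed

text \<open>The local expression is a linear projection followed by a transition map of M, hence the
  assumption that M is a smooth manifold.\<close>

lemma smooth_map_at_fst:
  assumes M: "smooth_manifold M" and N: "charted N"
  shows "smooth_map_at (prod_manifold M N) M p fst"
  unfolding smooth_map_at_def
proof (intro allI impI)
  fix UV \<phi>\<psi> U' \<phi>'
  assume c: "(UV, \<phi>\<psi>) \<in> atlas (prod_manifold M N)" "(U', \<phi>') \<in> atlas M" "p \<in> UV" "fst p \<in> U'"
  obtain U \<phi> V \<psi> where UV: "UV = U \<times> V" "\<phi>\<psi> = map_prod \<phi> \<psi>" "(U, \<phi>) \<in> atlas M" "(V, \<psi>) \<in> atlas N"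
    using c(1) by (auto simp: prod_manifold_def)
  obtain x y where p: "p = (x, y)" by force
  have xy: "x \<in> U" "y \<in> V" "x \<in> U'" using c(3,4) p UV by auto
  note M' = smooth_manifold_charted[OF M]
  obtain T where T: "open T" "\<phi> x \<in> T" "T \<subseteq> \<phi> ` U" "\<And>x. x \<in> T \<Longrightarrow> inv_into U \<phi> x \<in> U'"
    "smooth_on T (\<lambda>x. \<phi>' (inv_into U \<phi> x))"
    using smooth_map_atD[OF smooth_map_at_ident[OF M] UV(3) c(2) xy(1,3)] by blast
  let ?T = "T \<times> \<psi> ` V"
  have op: "open ?T" by (intro open_Times T(1) chart_open_image[OF N UV(4)])
  have inv: "inv_into UV \<phi>\<psi> z = (inv_into U \<phi> (fst z), inv_into V \<psi> (snd z))" if "z \<in> ?T" for z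
    unfolding UV(1,2)
    using inv_into_map_prod[OF chart_inj[OF M' UV(3)] chart_inj[OF N UV(4)], of "fst z" "snd z"] that T(3) by auto
  have "smooth_on ?T (\<lambda>z. \<phi>' (inv_into U \<phi> (fst z)))"
    by (rule smooth_on_compose[OF op T(1) _ smooth_on_bounded_linear[OF bounded_linear_fst] T(5)]) auto
  then have "smooth_on ?T (\<lambda>z. \<phi>' (fst (inv_into UV \<phi>\<psi> z)))"
    by (rule smooth_on_transform[OF _ op]) (simp add: inv)
  then show "\<exists>T. open T \<and> \<phi>\<psi> p \<in> T \<and> T \<subseteq> \<phi>\<psi> ` UV \<and> (\<forall>x\<in>T. fst (inv_into UV \<phi>\<psi> x) \<in> U') \<and>
      smooth_on T (\<lambda>x. \<phi>' (fst (inv_into UV \<phi>\<psi> x)))"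
    using op T xy by (intro exI[of _ ?T]) (auto simp: inv, auto simp: UV p)
qed

lemma smooth_map_at_snd:
  assumes M: "charted M" and N: "smooth_manifold N"
  shows "smooth_map_at (prod_manifold M N) N p snd"
  unfolding smooth_map_at_def
proof (intro allI impI)
  fix UV \<phi>\<psi> U' \<phi>'
  assume c: "(UV, \<phi>\<psi>) \<in> atlas (prod_manifold M N)" "(U', \<phi>') \<in> atlas N" "p \<in> UV" "snd p \<in> U'"
  obtain U \<phi> V \<psi> where UV: "UV = U \<times> V" "\<phi>\<psi> = map_prod \<phi> \<psi>" "(U, \<phi>) \<in> atlas M" "(V, \<psi>) \<in> atlas N"
    using c(1) by (auto simp: prod_manifold_def)
  obtain x y where p: "p = (x, y)" by force
  have xy: "x \<in> U" "y \<in> V" "y \<in> U'" using c(3,4) p UV by auto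
  note N' = smooth_manifold_charted[OF N]
  obtain T where T: "open T" "\<psi> y \<in> T" "T \<subseteq> \<psi> ` V" "\<And>x. x \<in> T \<Longrightarrow> inv_into V \<psi> x \<in> U'"
    "smooth_on T (\<lambda>x. \<phi>' (inv_into V \<psi> x))"
    using smooth_map_atD[OF smooth_map_at_ident[OF N] UV(4) c(2) xy(2,3)] by blast
  let ?T = "\<phi> ` U \<times> T"
  have op: "open ?T" by (intro open_Times T(1) chart_open_image[OF M UV(3)])
  have inv: "inv_into UV \<phi>\<psi> z = (inv_into U \<phi> (fst z), inv_into V \<psi> (snd z))" if "z \<in> ?T" for z
    unfolding UV(1,2)
    using inv_into_map_prod[OF chart_inj[OF M UV(3)] chart_inj[OF N' UV(4)], of "fst z" "snd z"] that T(3) by auto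
  have "smooth_on ?T (\<lambda>z. \<phi>' (inv_into V \<psi> (snd z)))"
    by (rule smooth_on_compose[OF op T(1) _ smooth_on_bounded_linear[OF bounded_linear_snd] T(5)]) auto
  then have "smooth_on ?T (\<lambda>z. \<phi>' (snd (inv_into UV \<phi>\<psi> z)))"
    by (rule smooth_on_transform[OF _ op]) (simp add: inv)
  then show "\<exists>T. open T \<and> \<phi>\<psi> p \<in> T \<and> T \<subseteq> \<phi>\<psi> ` UV \<and> (\<forall>x\<in>T. snd (inv_into UV \<phi>\<psi> x) \<in> U') \<and>
      smooth_on T (\<lambda>x. \<phi>' (snd (inv_into UV \<phi>\<psi> x)))"
    using op T xy by (intro exI[of _ ?T]) (auto simp: inv, auto simp: UV p)
qed

section \<open>Tangent vectors\<close>

lemma smooth_map_at_from_euclidean: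
  assumes at: "smooth_map_at (euclidean_manifold W) M t F" "(V, \<psi>) \<in> atlas M" "t \<in> W" "F t \<in> V"
  shows "\<exists>T. open T \<and> t \<in> T \<and> T \<subseteq> W \<and> (\<forall>x\<in>T. F x \<in> V) \<and> smooth_on T (\<lambda>t. \<psi> (F t))"
proof -
  have "(W, \<lambda>x. x) \<in> atlas (euclidean_manifold W)" by simp
  then have "\<exists>T. open T \<and> (\<lambda>x. x) t \<in> T \<and> T \<subseteq> (\<lambda>x. x) ` W \<and> (\<forall>x\<in>T. F (inv_into W (\<lambda>x. x) x) \<in> V) \<and>
      smooth_on T (\<lambda>x. \<psi> (F (inv_into W (\<lambda>x. x) x)))"
    using at(1)[unfolded smooth_map_at_def, THEN spec, THEN spec, THEN spec, THEN spec, THEN mp, THEN mp,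
      THEN mp, THEN mp, of W "\<lambda>x. x" V \<psi>] at(2-4) by argo
  then obtain T where T: "open T" "t \<in> T" "T \<subseteq> W" "\<forall>x\<in>T. F (inv_into W (\<lambda>x. x) x) \<in> V"
    "smooth_on T (\<lambda>x. \<psi> (F (inv_into W (\<lambda>x. x) x)))"
    unfolding image_ident by (elim exE conjE)
  have inv: "inv_into W (\<lambda>x. x) x = x" if "x \<in> T" for x using T(3) that by auto
  have "smooth_on T (\<lambda>t. \<psi> (F t))"
    by (rule smooth_on_transform[OF T(5,1)]) (simp add: inv)
  then show ?thesis using T inv by (intro exI[of _ T]) simp
qed

text \<open>The derivation with coordinate vector \<open>a\<close>. It shares the default value 0
  with \<open>velocity\<close>, so a tangent vector can equal it as a functional.\<close>

definition chart_tangent ::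
  "('m, 'e::euclidean_space) manifold \<Rightarrow> 'm set \<Rightarrow> ('m \<Rightarrow> 'e) \<Rightarrow> 'm \<Rightarrow> 'e \<Rightarrow> 'm tangent" where
  "chart_tangent M U \<phi> p a =
     (\<lambda>f. if smooth_near M p f then frechet_derivative (\<lambda>x. f (inv_into U \<phi> x)) (at (\<phi> p)) a else 0)"

context
  fixes M :: "('m, 'e::euclidean_space) manifold"
  assumes M: "smooth_manifold M"
begin

lemma smooth_near_chart_derivative:
  assumes c: "(U, \<phi>) \<in> atlas M" "p \<in> U" and f: "smooth_near M p f"
  shows "((\<lambda>x. f (inv_into U \<phi> x)) has_derivative
     frechet_derivative (\<lambda>x. f (inv_into U \<phi> x)) (at (\<phi> p))) (at (\<phi> p))"
proof -
  have "smooth_map_at M \<E> p f" using f by (simp add: smooth_near_iff[OF M])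
  then obtain T where "open T" "\<phi> p \<in> T" "T \<subseteq> \<phi> ` U" "smooth_on T (\<lambda>x. f (inv_into U \<phi> x))"
    using smooth_atD[OF _ c] by blast
  then show ?thesis using smooth_on_has_derivative by blast
qed

text \<open>By the chain rule the coordinate vector is the derivative at 0 of the curve read in the
  chart.\<close>

lemma velocity_eq_chart_tangent:
  assumes \<epsilon>: "\<epsilon> > 0" and \<gamma>: "smooth_map (euclidean_manifold {-\<epsilon><..<\<epsilon>}) M \<gamma>"
    and c: "(U, \<phi>) \<in> atlas M" "\<gamma> 0 \<in> U"
  shows "\<exists>a. velocity M \<gamma> = chart_tangent M U \<phi> (\<gamma> 0) a"
proof -
  let ?I = "{-\<epsilon><..<\<epsilon>}"
  note M' = smooth_manifold_charted[OF M]
  have at: "smooth_map_at (euclidean_manifold ?I) M 0 \<gamma>"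
    by (rule smooth_map_imp_at[OF charted_euclidean M' \<gamma>]) simp
  have "0 \<in> ?I" using \<epsilon> by simp
  then obtain T where T: "open T" "0 \<in> T" "\<forall>x\<in>T. \<gamma> x \<in> U" "smooth_on T (\<lambda>x. \<phi> (\<gamma> x))"
    using smooth_map_at_from_euclidean[OF at c(1) _ c(2)] by blast
  then have d: "((\<lambda>x. \<phi> (\<gamma> x)) has_derivative frechet_derivative (\<lambda>x. \<phi> (\<gamma> x)) (at 0)) (at 0)"
    using smooth_on_has_derivative T(2) by blast
  let ?D = "frechet_derivative (\<lambda>x. \<phi> (\<gamma> x)) (at 0)"
  have "deriv (\<lambda>t. f (\<gamma> t)) 0 = frechet_derivative (\<lambda>x. f (inv_into U \<phi> x)) (at (\<phi> (\<gamma> 0))) (?D 1)"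
    if f: "smooth_near M (\<gamma> 0) f" for f
  proof -
    let ?g = "\<lambda>x. f (inv_into U \<phi> x)" and ?g' = "frechet_derivative (\<lambda>x. f (inv_into U \<phi> x)) (at (\<phi> (\<gamma> 0)))"
    note g = smooth_near_chart_derivative[OF c f]
    have "((\<lambda>t. ?g (\<phi> (\<gamma> t))) has_derivative (\<lambda>r. ?g' (?D r))) (at 0)"
      by (rule has_derivative_compose[OF d g])
    then have 1: "((\<lambda>t. f (\<gamma> t)) has_derivative (\<lambda>r. ?g' (?D r))) (at 0)"
      by (rule has_derivative_transform_within_open[OF _ T(1,2)])
        (use T(3) chart_inv[OF M' c(1)] in simp)
    have 2: "?g' (?D r) = ?g' (?D 1) * r" for r
      using linear_scale[OF has_derivative_linear[OF d], of r 1]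
        linear_scale[OF has_derivative_linear[OF g], of r "?D 1"] by simp
    have "((\<lambda>t. f (\<gamma> t)) has_real_derivative ?g' (?D 1)) (at 0)"
      unfolding has_field_derivative_def by (rule has_derivative_eq_rhs[OF 1]) (rule ext, rule 2)
    then show ?thesis by (rule DERIV_imp_deriv)
  qed
  then show ?thesis
    unfolding velocity_def chart_tangent_def by (intro exI[of _ "?D 1"]) (simp add: fun_eq_iff)
qed

text \<open>The curve is the straight line from \<open>\<phi> p\<close> in direction a, carried back
  to M for as long as it stays in the image of the chart. With the converse above, tangent vectors
  at p become vectors of the model space, where sums and multiples make sense.\<close>

lemma chart_tangent_in_tangent_space:
  assumes c: "(U, \<phi>) \<in> atlas M" "p \<in> U"
  shows "chart_tangent M U \<phi> p a \<in> tangent_space M p"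
proof -
  note M' = smooth_manifold_charted[OF M]
  note op = chart_open_image[OF M' c(1)]
  define l where "l t = \<phi> p + t *\<^sub>R a" for t :: real
  have l: "(l has_derivative (\<lambda>t. t *\<^sub>R a)) (at t)" for t
    unfolding l_def[abs_def] by (auto intro!: derivative_eq_intros)
  have lc: "continuous_on UNIV l" unfolding l_def[abs_def] by (intro continuous_intros)
  have "smooth_on UNIV (\<lambda>t::real. t *\<^sub>R a)"
    by (rule smooth_on_bounded_linear[OF bounded_linear_scaleR_left])
  then have ls: "smooth_on UNIV l"
    unfolding l_def[abs_def] by (intro smooth_on_add smooth_on_const) auto
  have "open (l -` (\<phi> ` U))" by (rule open_vimage[OF op lc])
  moreover have "0 \<in> l -` (\<phi> ` U)" using c(2) by (simp add: l_def)
  ultimately obtain \<epsilon> where \<epsilon>: "\<epsilon> > 0" "ball 0 \<epsilon> \<subseteq> l -` (\<phi> ` U)" using openE by blast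
  let ?I = "{-\<epsilon><..<\<epsilon>}"
  have I: "l t \<in> \<phi> ` U" if "t \<in> ?I" for t
    using \<epsilon>(2) that by (auto simp: dist_real_def subset_iff)
  define \<gamma> where "\<gamma> t = inv_into U \<phi> (l t)" for t
  have \<gamma>U: "\<gamma> t \<in> U" "\<phi> (\<gamma> t) = l t" if "t \<in> ?I" for t
    using I[OF that] by (simp_all add: \<gamma>_def inv_into_into f_inv_into_f)
  have \<gamma>0: "\<gamma> 0 = p" using chart_inv[OF M' c] by (simp add: \<gamma>_def l_def)
  have "smooth_map (euclidean_manifold ?I) M \<gamma>"
    unfolding smooth_map_def
  proof
    have "openin (top_of_set ?I) {t \<in> ?I. \<gamma> t \<in> W}" if "openin (mtop M) W" for W
    proof -
      have "{t \<in> ?I. \<gamma> t \<in> W} = ?I \<inter> l -` (\<phi> ` (U \<inter> W))"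
      proof (intro equalityI subsetI)
        fix t assume "t \<in> {t \<in> ?I. \<gamma> t \<in> W}"
        then show "t \<in> ?I \<inter> l -` (\<phi> ` (U \<inter> W))" using \<gamma>U[of t] by (auto intro!: image_eqI[of _ _ "\<gamma> t"])
      next
        fix t assume t: "t \<in> ?I \<inter> l -` (\<phi> ` (U \<inter> W))"
        then obtain x where "x \<in> U" "x \<in> W" "l t = \<phi> x" by auto
        then show "t \<in> {t \<in> ?I. \<gamma> t \<in> W}" using t chart_inv[OF M' c(1)] by (simp add: \<gamma>_def)
      qed
      moreover have "open (l -` (\<phi> ` (U \<inter> W)))"
        by (rule open_vimage[OF chart_open_image_Int[OF M' c(1) that] lc])
      ultimately show ?thesis by (simp add: openin_open_Int)
    qed
    then show "continuous_map (mtop (euclidean_manifold ?I)) (mtop M) \<gamma>"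
      using \<gamma>U(1) chart_subset[OF M' c(1)] by (auto simp: continuous_map_def)
    have "smooth_on (?I \<inter> \<gamma> -` V) (\<lambda>t. \<psi> (\<gamma> (inv_into ?I (\<lambda>x. x) t)))" if V: "(V, \<psi>) \<in> atlas M" for V \<psi>
    proof (rule smooth_on_local)
      fix t assume t: "t \<in> ?I \<inter> \<gamma> -` V"
      then have tI: "t \<in> ?I" and tV: "\<gamma> t \<in> V" by auto
      have ls': "smooth_map_at \<E> \<E> t l" unfolding smooth_at_euclidean_iff using ls by blast
      have "smooth_map_at \<E> M t (\<lambda>t. inv_into U \<phi> (l t))"
        by (rule smooth_map_at_compose[OF charted_euclidean[OF open_UNIV] charted_euclidean[OF open_UNIV] _ ls'
            smooth_map_at_inv_chart[OF M c(1) I[OF tI]]]) simp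
      then have at: "smooth_map_at \<E> M t \<gamma>" unfolding \<gamma>_def .
      obtain T where T: "open T" "t \<in> T" "smooth_on T (\<lambda>t. \<psi> (\<gamma> t))"
        using smooth_map_at_from_euclidean[OF at V UNIV_I tV] by blast
      have op: "open (T \<inter> ?I)" using T(1) by (simp add: open_Int)
      have "smooth_on (T \<inter> ?I) (\<lambda>t. \<psi> (\<gamma> (inv_into ?I (\<lambda>x. x) t)))"
        by (rule smooth_on_transform[OF smooth_on_subset[OF T(3)] op]) auto
      then show "\<exists>T. open T \<and> t \<in> T \<and> smooth_on T (\<lambda>t. \<psi> (\<gamma> (inv_into ?I (\<lambda>x. x) t)))"
        using op T(2) tI by blast
    qed
    then show "\<forall>(U, \<phi>)\<in>atlas (euclidean_manifold ?I). \<forall>(V, \<psi>)\<in>atlas M.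
        smooth_on (\<phi> ` (U \<inter> \<gamma> -` V)) (\<lambda>x. \<psi> (\<gamma> (inv_into U \<phi> x)))"
      by auto
  qed
  moreover have "velocity M \<gamma> = chart_tangent M U \<phi> p a"
  proof
    fix f
    have "deriv (\<lambda>t. f (\<gamma> t)) 0 = frechet_derivative (\<lambda>x. f (inv_into U \<phi> x)) (at (\<phi> p)) a"
      if f: "smooth_near M p f"
    proof -
      let ?g = "\<lambda>x. f (inv_into U \<phi> x)" and ?g' = "frechet_derivative (\<lambda>x. f (inv_into U \<phi> x)) (at (\<phi> p))"
      have g: "(?g has_derivative ?g') (at (l 0))"
        using smooth_near_chart_derivative[OF c f] by (simp add: l_def)
      have 1: "((\<lambda>t. ?g (l t)) has_derivative (\<lambda>t. ?g' (t *\<^sub>R a))) (at 0)"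
        by (rule has_derivative_compose[OF l g])
      have 2: "?g' (t *\<^sub>R a) = ?g' a * t" for t
        using linear_scale[OF has_derivative_linear[OF g], of t a] by simp
      have "((\<lambda>t. f (\<gamma> t)) has_real_derivative ?g' a) (at 0)"
        unfolding has_field_derivative_def \<gamma>_def by (rule has_derivative_eq_rhs[OF 1]) (rule ext, rule 2)
      then show ?thesis by (rule DERIV_imp_deriv)
    qed
    then show "velocity M \<gamma> f = chart_tangent M U \<phi> p a f"
      by (simp add: velocity_def chart_tangent_def \<gamma>0)
  qed
  ultimately show ?thesis unfolding tangent_space_def using \<epsilon>(1) \<gamma>0 by (intro CollectI exI[of _ \<gamma>] exI[of _ \<epsilon>]) simp
qed

lemma tangent_space_topspace:
  assumes "u \<in> tangent_space M p"
  shows "p \<in> topspace (mtop M)"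
proof -
  obtain \<gamma> and \<epsilon> :: real where g: "\<epsilon> > 0" "smooth_map (euclidean_manifold {-\<epsilon><..<\<epsilon>}) M \<gamma>" "\<gamma> 0 = p"
    using assms unfolding tangent_space_def by blast
  have "continuous_map (top_of_set {-\<epsilon><..<\<epsilon>}) (mtop M) \<gamma>"
    using g(2) by (simp add: smooth_map_def)
  then have "\<gamma> 0 \<in> topspace (mtop M)" using g(1) by (auto simp: continuous_map_def)
  then show ?thesis using g(3) by simp
qed

lemma tangent_space_chart:
  assumes "u \<in> tangent_space M p" "(U, \<phi>) \<in> atlas M" "p \<in> U"
  obtains a where "u = chart_tangent M U \<phi> p a"
proof -
  obtain \<gamma> and \<epsilon> :: real where g: "u = velocity M \<gamma>" "\<epsilon> > 0" "smooth_map (euclidean_manifold {-\<epsilon><..<\<epsilon>}) M \<gamma>" "\<gamma> 0 = p"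
    using assms(1) unfolding tangent_space_def by blast
  show ?thesis using velocity_eq_chart_tangent[OF g(2,3) assms(2)] assms(3) g(1,4) that by auto
qed

lemma tangent_spaceE:
  assumes "u \<in> tangent_space M p"
  obtains U \<phi> a where "(U, \<phi>) \<in> atlas M" "p \<in> U" "u = chart_tangent M U \<phi> p a"
  using charted_obtain[OF smooth_manifold_charted[OF M] tangent_space_topspace[OF assms]]
    tangent_space_chart[OF assms] by metis

section \<open>Tangent vectors as local derivations\<close>

lemma smooth_near_transform:
  assumes "smooth_near M p f" and W: "openin (mtop M) W" "p \<in> W" "\<And>x. x \<in> W \<Longrightarrow> f x = g x"
  shows "smooth_near M p g"
proof -
  have "smooth_map_at M \<E> p g"
    by (rule smooth_map_at_cong[OF smooth_manifold_charted[OF M] W]) (use assms(1) in \<open>simp_all add: smooth_near_iff[OF M]\<close>)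
  then show ?thesis using assms(1) by (simp add: smooth_near_iff[OF M])
qed

lemma smooth_near_add: "smooth_near M p f \<Longrightarrow> smooth_near M p g \<Longrightarrow> smooth_near M p (\<lambda>x. f x + g x)"
  by (auto simp: smooth_near_iff[OF M] intro!: smooth_at_add[OF smooth_manifold_charted[OF M]])

lemma smooth_near_mult: "smooth_near M p f \<Longrightarrow> smooth_near M p g \<Longrightarrow> smooth_near M p (\<lambda>x. f x * g x)"
  by (auto simp: smooth_near_iff[OF M] intro!: smooth_at_mult[OF smooth_manifold_charted[OF M]])

lemma smooth_near_const: "p \<in> topspace (mtop M) \<Longrightarrow> smooth_near M p (\<lambda>x. c)"
  by (auto simp: smooth_near_iff[OF M] intro!: smooth_at_const[OF smooth_manifold_charted[OF M]])

lemma smooth_near_sum: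
  "p \<in> topspace (mtop M) \<Longrightarrow> (\<And>i. i \<in> I \<Longrightarrow> smooth_near M p (f i)) \<Longrightarrow> smooth_near M p (\<lambda>x. \<Sum>i\<in>I. f i x)"
  by (auto simp: smooth_near_iff[OF M] intro!: smooth_at_sum[OF smooth_manifold_charted[OF M]])

lemma smooth_near_inverse: "smooth_near M p f \<Longrightarrow> f p \<noteq> 0 \<Longrightarrow> smooth_near M p (\<lambda>x. inverse (f x))"
  by (auto simp: smooth_near_iff[OF M] intro!: smooth_at_inverse[OF smooth_manifold_charted[OF M]])

context
  fixes u p assumes u: "u \<in> tangent_space M p"
begin

lemma tangent_not_smooth: "\<not> smooth_near M p f \<Longrightarrow> u f = 0"
  using u by (rule tangent_spaceE) (simp add: chart_tangent_def)

lemma tangent_const: "u (\<lambda>x. c) = 0"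
  using u by (rule tangent_spaceE) (simp add: chart_tangent_def)

text \<open>Smoothness near p is a property of the germ, so either both functions are smooth and
  have the same derivative in a chart, or neither is and both values are the default 0.\<close>

lemma tangent_cong:
  assumes W: "openin (mtop M) W" "p \<in> W" "\<And>x. x \<in> W \<Longrightarrow> f x = g x"
  shows "u f = u g"
proof (cases "smooth_near M p f")
  case True
  then have g: "smooth_near M p g" using smooth_near_transform W by blast
  obtain U \<phi> a where c: "(U, \<phi>) \<in> atlas M" "p \<in> U" "u = chart_tangent M U \<phi> p a"
    using tangent_spaceE[OF u] .
  note M' = smooth_manifold_charted[OF M]
  have "((\<lambda>x. g (inv_into U \<phi> x)) has_derivative
      frechet_derivative (\<lambda>x. f (inv_into U \<phi> x)) (at (\<phi> p))) (at (\<phi> p))"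
    by (rule has_derivative_transform_within_open[OF smooth_near_chart_derivative[OF c(1,2) True]
      chart_open_image_Int[OF M' c(1) W(1)]])
      (use c(2) W chart_inv[OF M' c(1)] in auto)
  then show ?thesis
    using True g c(3) frechet_derivative_apply_eq by (simp add: chart_tangent_def frechet_derivative_apply_eq)
next
  case False
  then have "\<not> smooth_near M p g" using smooth_near_transform[of p g W f] W by metis
  then show ?thesis using False by (simp add: tangent_not_smooth)
qed

lemma tangent_add:
  assumes f: "smooth_near M p f" and g: "smooth_near M p g"
  shows "u (\<lambda>x. f x + g x) = u f + u g"
proof -
  obtain U \<phi> a where c: "(U, \<phi>) \<in> atlas M" "p \<in> U" "u = chart_tangent M U \<phi> p a"
    using tangent_spaceE[OF u] .
  show ?thesis
    using frechet_derivative_apply_eq[OF has_derivative_add[OF smooth_near_chart_derivative[OF c(1,2) f]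
      smooth_near_chart_derivative[OF c(1,2) g]]]
    by (simp add: c(3) chart_tangent_def f g smooth_near_add)
qed

lemma tangent_mult:
  assumes f: "smooth_near M p f" and g: "smooth_near M p g"
  shows "u (\<lambda>x. f x * g x) = u f * g p + f p * u g"
proof -
  obtain U \<phi> a where c: "(U, \<phi>) \<in> atlas M" "p \<in> U" "u = chart_tangent M U \<phi> p a"
    using tangent_spaceE[OF u] .
  have "inv_into U \<phi> (\<phi> p) = p" using chart_inv[OF smooth_manifold_charted[OF M] c(1,2)] .
  then show ?thesis
    using frechet_derivative_apply_eq[OF has_derivative_mult[OF smooth_near_chart_derivative[OF c(1,2) f]
      smooth_near_chart_derivative[OF c(1,2) g]]]
    by (simp add: c(3) chart_tangent_def f g smooth_near_mult)
qed

lemma tangent_cmult: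
  assumes "smooth_near M p f"
  shows "u (\<lambda>x. c * f x) = c * u f"
  using tangent_mult[OF smooth_near_const[OF tangent_space_topspace[OF u]] assms, of c] by (simp add: tangent_const)

lemma tangent_sum:
  assumes "finite I" "\<And>i. i \<in> I \<Longrightarrow> smooth_near M p (f i)"
  shows "u (\<lambda>x. \<Sum>i\<in>I. f i x) = (\<Sum>i\<in>I. u (f i))"
  using assms
proof (induction I rule: finite_induct)
  case empty
  then show ?case by (simp add: tangent_const)
next
  case (insert i I)
  have "smooth_near M p (\<lambda>x. \<Sum>i\<in>I. f i x)"
    by (rule smooth_near_sum[OF tangent_space_topspace[OF u]]) (use insert.prems in auto)
  then show ?case using insert tangent_add[of "f i" "\<lambda>x. \<Sum>i\<in>I. f i x"] by simp
qed

end

section \<open>Linear structure of a tangent space\<close>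

lemma chart_tangent_add:
  assumes c: "(U, \<phi>) \<in> atlas M" "p \<in> U"
  shows "chart_tangent M U \<phi> p (a + b) f = chart_tangent M U \<phi> p a f + chart_tangent M U \<phi> p b f"
  using linear_add[OF has_derivative_linear[OF smooth_near_chart_derivative[OF c]]]
  by (simp add: chart_tangent_def)

lemma chart_tangent_scale:
  assumes c: "(U, \<phi>) \<in> atlas M" "p \<in> U"
  shows "chart_tangent M U \<phi> p (r *\<^sub>R a) f = r * chart_tangent M U \<phi> p a f"
  using linear_scale[OF has_derivative_linear[OF smooth_near_chart_derivative[OF c]]]
  by (simp add: chart_tangent_def)

text \<open>Curves through p cannot be added; in a chart their coordinate vectors can.\<close>

lemma tangent_space_add:
  assumes "u \<in> tangent_space M p" "w \<in> tangent_space M p"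
  shows "(\<lambda>f. u f + w f) \<in> tangent_space M p"
proof -
  obtain U \<phi> a where c: "(U, \<phi>) \<in> atlas M" "p \<in> U" "u = chart_tangent M U \<phi> p a"
    using tangent_spaceE[OF assms(1)] .
  obtain b where "w = chart_tangent M U \<phi> p b" using tangent_space_chart[OF assms(2) c(1,2)] .
  then have "(\<lambda>f. u f + w f) = chart_tangent M U \<phi> p (a + b)"
    using chart_tangent_add[OF c(1,2)] c(3) by (simp add: fun_eq_iff)
  then show ?thesis using chart_tangent_in_tangent_space[OF c(1,2)] by simp
qed

lemma tangent_space_scale:
  assumes "u \<in> tangent_space M p"
  shows "(\<lambda>f. r * u f) \<in> tangent_space M p"
proof -
  obtain U \<phi> a where c: "(U, \<phi>) \<in> atlas M" "p \<in> U" "u = chart_tangent M U \<phi> p a"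
    using tangent_spaceE[OF assms(1)] .
  have "(\<lambda>f. r * u f) = chart_tangent M U \<phi> p (r *\<^sub>R a)"
    using chart_tangent_scale[OF c(1,2)] c(3) by (simp add: fun_eq_iff)
  then show ?thesis using chart_tangent_in_tangent_space[OF c(1,2)] by simp
qed

lemma smooth_near_chart_component:
  assumes c: "(U, \<phi>) \<in> atlas M" "p \<in> U"
  shows "smooth_near M p (\<lambda>x. \<phi> x \<bullet> m)"
  unfolding smooth_near_iff[OF M]
proof
  show "p \<in> topspace (mtop M)" using chart_subset[OF smooth_manifold_charted[OF M] c(1)] c(2) by blast
  show "smooth_map_at M \<E> p (\<lambda>x. \<phi> x \<bullet> m)"
    by (rule smooth_at_bounded_linear[OF smooth_manifold_charted[OF M] smooth_at_chart[OF M c] bounded_linear_inner_left])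
qed

lemma chart_tangent_component:
  assumes c: "(U, \<phi>) \<in> atlas M" "p \<in> U"
  shows "chart_tangent M U \<phi> p a (\<lambda>x. \<phi> x \<bullet> m) = a \<bullet> m"
proof -
  note M' = smooth_manifold_charted[OF M]
  have "((\<lambda>x. x \<bullet> m) has_derivative (\<lambda>x. x \<bullet> m)) (at (\<phi> p))"
    by (rule bounded_linear_imp_has_derivative[OF bounded_linear_inner_left])
  then have "((\<lambda>x. \<phi> (inv_into U \<phi> x) \<bullet> m) has_derivative (\<lambda>x. x \<bullet> m)) (at (\<phi> p))"
    by (rule has_derivative_transform_within_open[OF _ chart_open_image[OF M' c(1)]])
      (use c(2) in \<open>auto simp: f_inv_into_f\<close>)
  then show ?thesis
    by (simp add: chart_tangent_def smooth_near_chart_component[OF c] frechet_derivative_apply_eq)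
qed

text \<open>Evaluated on the components of a chart, a tangent vector returns its coordinates, so one
  chart already separates tangent vectors.\<close>

lemma tangent_eqI:
  assumes u: "u \<in> tangent_space M p" "w \<in> tangent_space M p" and c: "(U, \<phi>) \<in> atlas M" "p \<in> U"
    and eq: "\<And>m. m \<in> Basis \<Longrightarrow> u (\<lambda>x. \<phi> x \<bullet> m) = w (\<lambda>x. \<phi> x \<bullet> m)"
  shows "u = w"
proof -
  obtain a where a: "u = chart_tangent M U \<phi> p a" using tangent_space_chart[OF u(1) c] .
  obtain b where b: "w = chart_tangent M U \<phi> p b" using tangent_space_chart[OF u(2) c] .
  have "a = b" by (rule euclidean_eqI) (use eq chart_tangent_component[OF c] a b in auto)
  then show ?thesis using a b by simp
qed

lemma smooth_near_compose:
  fixes N :: "('n, 'f::euclidean_space) manifold"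
  assumes N: "smooth_manifold N" and p: "p \<in> topspace (mtop M)" and F: "smooth_map_at M N p F"
    and f: "smooth_near N (F p) f"
  shows "smooth_near M p (\<lambda>x. f (F x))"
proof -
  have "smooth_map_at M \<E> p (\<lambda>x. f (F x))"
    by (rule smooth_map_at_compose[OF smooth_manifold_charted[OF M] smooth_manifold_charted[OF N] _ F])
      (use f in \<open>simp_all add: smooth_near_iff[OF N]\<close>)
  then show ?thesis using p by (simp add: smooth_near_iff[OF M])
qed

end

text \<open>The image has coordinate vector \<open>?D a\<close>, where \<open>?D\<close> is the
  derivative of F read in charts at p and F p. Functions not smooth near F p get the default on both
  sides.\<close>

lemma differential_in_tangent_space:
  fixes M :: "('m, 'e::euclidean_space) manifold" and N :: "('n, 'f::euclidean_space) manifold"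
  assumes M: "smooth_manifold M" and N: "smooth_manifold N" and F: "smooth_map_at M N p F" and u: "u \<in> tangent_space M p"
    and Fp: "F p \<in> topspace (mtop N)"
  shows "differential M N F p u \<in> tangent_space N (F p)"
proof -
  note M' = smooth_manifold_charted[OF M] and N' = smooth_manifold_charted[OF N]
  have p: "p \<in> topspace (mtop M)" using tangent_space_topspace[OF M u] .
  obtain U \<phi> a where c: "(U, \<phi>) \<in> atlas M" "p \<in> U" "u = chart_tangent M U \<phi> p a"
    using tangent_spaceE[OF M u] .
  obtain V \<psi> where d: "(V, \<psi>) \<in> atlas N" "F p \<in> V" using charted_obtain[OF N' Fp] .
  obtain T where T: "open T" "\<phi> p \<in> T" "T \<subseteq> \<phi> ` U" "\<And>x. x \<in> T \<Longrightarrow> F (inv_into U \<phi> x) \<in> V"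
    "smooth_on T (\<lambda>x. \<psi> (F (inv_into U \<phi> x)))"
    using smooth_map_atD[OF F c(1) d(1) c(2) d(2)] by blast
  let ?h = "\<lambda>x. \<psi> (F (inv_into U \<phi> x))"
  let ?D = "frechet_derivative ?h (at (\<phi> p))"
  have h: "(?h has_derivative ?D) (at (\<phi> p))" using smooth_on_has_derivative[OF T(5,2)] .
  have hp: "?h (\<phi> p) = \<psi> (F p)" using chart_inv[OF M' c(1,2)] by simp
  have "differential M N F p u = chart_tangent N V \<psi> (F p) (?D a)"
  proof
    fix f
    show "differential M N F p u f = chart_tangent N V \<psi> (F p) (?D a) f"
    proof (cases "smooth_near N (F p) f")
      case True
      let ?g = "\<lambda>x. f (inv_into V \<psi> x)"
      have g: "(?g has_derivative frechet_derivative ?g (at (\<psi> (F p)))) (at (?h (\<phi> p)))"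
      proof -
        have "smooth_map_at N \<E> (F p) f" using True by (simp add: smooth_near_iff[OF N])
        then obtain S where "open S" "\<psi> (F p) \<in> S" "S \<subseteq> \<psi> ` V" "smooth_on S ?g"
          using smooth_atD[OF _ d] by blast
        then show ?thesis unfolding hp using smooth_on_has_derivative by blast
      qed
      have "((\<lambda>x. ?g (?h x)) has_derivative (\<lambda>v. frechet_derivative ?g (at (\<psi> (F p))) (?D v))) (at (\<phi> p))"
        by (rule has_derivative_compose[OF h g])
      then have "((\<lambda>x. f (F (inv_into U \<phi> x))) has_derivative
          (\<lambda>v. frechet_derivative ?g (at (\<psi> (F p))) (?D v))) (at (\<phi> p))"
        by (rule has_derivative_transform_within_open[OF _ T(1,2)])
          (use T(4) chart_inv[OF N' d(1)] in simp)
      then show ?thesis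
        using True smooth_near_compose[OF M N p F True]
        by (simp add: differential_def c(3) chart_tangent_def frechet_derivative_apply_eq)
    next
      case False
      then show ?thesis by (simp add: differential_def chart_tangent_def)
    qed
  qed
  moreover have "chart_tangent N V \<psi> (F p) (?D a) \<in> tangent_space N (F p)"
    by (rule chart_tangent_in_tangent_space[OF N d])
  ultimately show ?thesis by simp
qed

section \<open>Functions of two points\<close>

lemma frechet_derivative_slices:
  assumes "(G has_derivative G') (at (a, b))"
  shows "((\<lambda>x. G (x, b)) has_derivative (\<lambda>v. G' (v, 0))) (at a)"
    "((\<lambda>y. G (a, y)) has_derivative (\<lambda>v. G' (0, v))) (at b)"
proof -
  have "((\<lambda>x. (x, b)) has_derivative (\<lambda>v. (v, 0))) (at a)"
    by (intro has_derivative_Pair has_derivative_ident has_derivative_const)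
  from has_derivative_compose[OF this assms]
  show "((\<lambda>x. G (x, b)) has_derivative (\<lambda>v. G' (v, 0))) (at a)" .
  have "((\<lambda>y. (a, y)) has_derivative (\<lambda>v. (0, v))) (at b)"
    by (intro has_derivative_Pair has_derivative_ident has_derivative_const)
  from has_derivative_compose[OF this assms]
  show "((\<lambda>y. G (a, y)) has_derivative (\<lambda>v. G' (0, v))) (at b)" .
qed

context
  fixes M :: "('m, 'e::euclidean_space) manifold" and N :: "('n, 'f::euclidean_space) manifold"
    and p q and F :: "'m \<times> 'n \<Rightarrow> real"
  assumes M: "smooth_manifold M" and N: "smooth_manifold N"
    and F: "smooth_map_at (prod_manifold M N) \<E> (p, q) F"
begin

lemma smooth_on_product_chart:
  assumes c: "(U, \<phi>) \<in> atlas M" "p \<in> U" and d: "(V, \<psi>) \<in> atlas N" "q \<in> V"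
  obtains T1 T2 where "open T1" "\<phi> p \<in> T1" "T1 \<subseteq> \<phi> ` U" "open T2" "\<psi> q \<in> T2" "T2 \<subseteq> \<psi> ` V"
    "smooth_on (T1 \<times> T2) (\<lambda>z. F (inv_into U \<phi> (fst z), inv_into V \<psi> (snd z)))"
proof -
  note M' = smooth_manifold_charted[OF M] and N' = smooth_manifold_charted[OF N]
  have "(U \<times> V, map_prod \<phi> \<psi>) \<in> atlas (prod_manifold M N)"
    using c(1) d(1) by (auto simp: prod_manifold_def)
  moreover have "(p, q) \<in> U \<times> V" using c d by simp
  ultimately obtain T where T: "open T" "map_prod \<phi> \<psi> (p, q) \<in> T" "T \<subseteq> map_prod \<phi> \<psi> ` (U \<times> V)"
     "smooth_on T (\<lambda>z. F (inv_into (U \<times> V) (map_prod \<phi> \<psi>) z))"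
    using smooth_atD[OF F] by blast
  have "(\<phi> p, \<psi> q) \<in> T" using T(2) by simp
  then obtain T1 T2 where TT: "open T1" "open T2" "(\<phi> p, \<psi> q) \<in> T1 \<times> T2" "T1 \<times> T2 \<subseteq> T"
    using open_prod_elim[OF T(1)] by metis
  have sub: "z \<in> \<phi> ` U \<times> \<psi> ` V" if "z \<in> T1 \<times> T2" for z
    using subsetD[OF T(3) subsetD[OF TT(4) that]] by auto
  have "smooth_on (T1 \<times> T2) (\<lambda>z. F (inv_into U \<phi> (fst z), inv_into V \<psi> (snd z)))"
  proof (rule smooth_on_transform[OF smooth_on_subset[OF T(4) TT(4)] open_Times[OF TT(1,2)]])
    fix z assume "z \<in> T1 \<times> T2"
    then have "fst z \<in> \<phi> ` U" "snd z \<in> \<psi> ` V" using sub by auto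
    then show "F (inv_into (U \<times> V) (map_prod \<phi> \<psi>) z) = F (inv_into U \<phi> (fst z), inv_into V \<psi> (snd z))"
      using inv_into_map_prod[OF chart_inj[OF M' c(1)] chart_inj[OF N' d(1)], of "fst z" "snd z"] by simp
  qed
  moreover have "T1 \<subseteq> \<phi> ` U" "T2 \<subseteq> \<psi> ` V"
    using sub TT(3) by auto
  ultimately show ?thesis using that TT by blast
qed

text \<open>Applying a tangent vector in the second variable is a partial derivative of the joint
  local expression G in direction \<open>(0, b)\<close>. In this form the result can be
  differentiated again with respect to x.\<close>

lemma tangent_of_slice:
  assumes w: "w \<in> tangent_space N q" and c: "(U, \<phi>) \<in> atlas M" "p \<in> U" and d: "(V, \<psi>) \<in> atlas N" "q \<in> V"
    and wb: "w = chart_tangent N V \<psi> q b"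
    and T: "open T1" "T1 \<subseteq> \<phi> ` U" "open T2" "\<psi> q \<in> T2" "T2 \<subseteq> \<psi> ` V"
    and G: "G = (\<lambda>z. F (inv_into U \<phi> (fst z), inv_into V \<psi> (snd z)))" "smooth_on (T1 \<times> T2) G"
    and x: "x \<in> T1"
  shows "w (\<lambda>y. F (inv_into U \<phi> x, y)) = frechet_derivative G (at (x, \<psi> q)) (0, b)"
proof -
  note N' = smooth_manifold_charted[OF N]
  have sl: "smooth_on T2 (\<lambda>y. G (x, y))"
    by (rule smooth_on_compose[OF T(3) open_Times[OF T(1,3)] _ smooth_on_Pair[OF T(3) smooth_on_const smooth_on_ident] G(2)])
      (use x in auto)
  have "smooth_map_at N \<E> q (\<lambda>y. G (x, \<psi> y))"
    by (rule smooth_at_compose_euclidean[OF N' smooth_at_chart[OF N d] T(3,4) sl])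
  then have "smooth_map_at N \<E> q (\<lambda>y. F (inv_into U \<phi> x, y))"
    by (rule smooth_map_at_cong[OF N' chart_openin[OF N' d(1)] d(2), rotated])
      (simp add: G(1) chart_inv[OF N' d(1)])
  then have near: "smooth_near N q (\<lambda>y. F (inv_into U \<phi> x, y))"
    using chart_subset[OF N' d(1)] d(2) by (auto simp: smooth_near_iff[OF N])
  have "(G has_derivative frechet_derivative G (at (x, \<psi> q))) (at (x, \<psi> q))"
    by (rule smooth_on_has_derivative[OF G(2)]) (use x T(4) in simp)
  from frechet_derivative_slices(2)[OF this]
  have "((\<lambda>y. F (inv_into U \<phi> x, inv_into V \<psi> y)) has_derivative
      (\<lambda>v. frechet_derivative G (at (x, \<psi> q)) (0, v))) (at (\<psi> q))"
    by (simp add: G(1))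
  then show ?thesis
    unfolding wb chart_tangent_def using near by (simp add: frechet_derivative_apply_eq)
qed

text \<open>A partial derivative of G, restricted to the slice through \<open>\<psi> q\<close>, is
  smooth in the remaining variable. This is the source of smoothness for invariant derivatives and
  for Ad.\<close>

lemma smooth_near_tangent_of_slice:
  assumes p: "p \<in> topspace (mtop M)" and w: "w \<in> tangent_space N q"
  shows "smooth_near M p (\<lambda>x. w (\<lambda>y. F (x, y)))"
proof -
  obtain V \<psi> b where d: "(V, \<psi>) \<in> atlas N" "q \<in> V" "w = chart_tangent N V \<psi> q b"
    using tangent_spaceE[OF N w] .
  have "smooth_map_at M \<E> p (\<lambda>x. w (\<lambda>y. F (x, y)))"
    unfolding smooth_at_iff
  proof (intro allI impI)
    fix U \<phi> assume c: "(U, \<phi>) \<in> atlas M" "p \<in> U"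
    define G where "G = (\<lambda>z. F (inv_into U \<phi> (fst z), inv_into V \<psi> (snd z)))"
    obtain T1 T2 where T: "open T1" "\<phi> p \<in> T1" "T1 \<subseteq> \<phi> ` U" "open T2" "\<psi> q \<in> T2" "T2 \<subseteq> \<psi> ` V"
      "smooth_on (T1 \<times> T2) G"
      using smooth_on_product_chart[OF c d(1,2)] unfolding G_def by blast
    have sub: "(\<lambda>x. (x, \<psi> q)) ` T1 \<subseteq> T1 \<times> T2" using T(5) by auto
    have "smooth_on T1 (\<lambda>x. frechet_derivative G (at (x, \<psi> q)) (0, b))"
      by (rule smooth_on_compose[OF T(1) open_Times[OF T(1,4)] sub smooth_on_Pair[OF T(1) smooth_on_ident smooth_on_const]
          smooth_on_frechet_derivative[OF T(7)]])
    then have "smooth_on T1 (\<lambda>x. w (\<lambda>y. F (inv_into U \<phi> x, y)))"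
      by (rule smooth_on_transform[OF _ T(1)])
        (rule tangent_of_slice[OF w c d T(1,3,4,5,6) G_def T(7), symmetric])
    then show "\<exists>T. open T \<and> \<phi> p \<in> T \<and> T \<subseteq> \<phi> ` U \<and> smooth_on T (\<lambda>x. w (\<lambda>y. F (inv_into U \<phi> x, y)))"
      using T(1-3) by blast
  qed
  then show ?thesis using p by (simp add: smooth_near_iff[OF M])
qed

end

lemma smooth_map_at_swap:
  assumes M: "smooth_manifold M" and N: "smooth_manifold N"
    and F: "smooth_map_at (prod_manifold M N) L (p, q) F" and p: "p \<in> topspace (mtop M)" "q \<in> topspace (mtop N)"
  shows "smooth_map_at (prod_manifold N M) L (q, p) (\<lambda>z. F (snd z, fst z))"
proof -
  note M' = smooth_manifold_charted[OF M] and N' = smooth_manifold_charted[OF N]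
  note c = charted_prod[OF M' N'] charted_prod[OF N' M']
  have "smooth_map_at (prod_manifold N M) (prod_manifold M N) (q, p) (\<lambda>z. (snd z, fst z))"
    by (rule smooth_map_at_Pair[OF c(2) M' N' smooth_map_at_snd[OF N' M] smooth_map_at_fst[OF N M']])
  from smooth_map_at_compose[OF c(2,1) _ this] F p
  show ?thesis by (simp add: prod_manifold_def)
qed

text \<open>In a product chart both sides are mixed second derivatives of G, in the directions
  \<open>(a, 0)\<close> and \<open>(0, b)\<close>, so their symmetry decides. The swapped function
  \<open>F'\<close> allows the slice formula for the second variable to be used for the
  first.\<close>

lemma tangent_commute:
  fixes M :: "('m, 'e::euclidean_space) manifold" and N :: "('n, 'f::euclidean_space) manifold"
  assumes M: "smooth_manifold M" and N: "smooth_manifold N"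
    and F: "smooth_map_at (prod_manifold M N) \<E> (p, q) F"
    and u: "u \<in> tangent_space M p" and w: "w \<in> tangent_space N q"
  shows "u (\<lambda>x. w (\<lambda>y. F (x, y))) = w (\<lambda>y. u (\<lambda>x. F (x, y)))"
proof -
  note M' = smooth_manifold_charted[OF M] and N' = smooth_manifold_charted[OF N]
  have p: "p \<in> topspace (mtop M)" and q: "q \<in> topspace (mtop N)"
    using tangent_space_topspace[OF M u] tangent_space_topspace[OF N w] .
  define F' where "F' z = F (snd z, fst z)" for z
  have F': "smooth_map_at (prod_manifold N M) \<E> (q, p) F'"
    unfolding F'_def[abs_def] by (rule smooth_map_at_swap[OF M N F p q])
  obtain U \<phi> a where c: "(U, \<phi>) \<in> atlas M" "p \<in> U" "u = chart_tangent M U \<phi> p a"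
    using tangent_spaceE[OF M u] .
  obtain V \<psi> b where d: "(V, \<psi>) \<in> atlas N" "q \<in> V" "w = chart_tangent N V \<psi> q b"
    using tangent_spaceE[OF N w] .
  define G where "G = (\<lambda>z. F (inv_into U \<phi> (fst z), inv_into V \<psi> (snd z)))"
  obtain T1 T2 where T: "open T1" "\<phi> p \<in> T1" "T1 \<subseteq> \<phi> ` U" "open T2" "\<psi> q \<in> T2" "T2 \<subseteq> \<psi> ` V"
    "smooth_on (T1 \<times> T2) G"
    using smooth_on_product_chart[OF M N F c(1,2) d(1,2)] unfolding G_def by blast
  define G' where "G' = (\<lambda>z. F' (inv_into V \<psi> (fst z), inv_into U \<phi> (snd z)))"
  have G'G: "G' z = G (snd z, fst z)" for z by (simp add: G'_def G_def F'_def)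
  have bl: "bounded_linear (\<lambda>z::'f \<times> 'e. (snd z, fst z))"
    by (intro bounded_linear_Pair bounded_linear_snd bounded_linear_fst)
  have G's: "smooth_on (T2 \<times> T1) G'"
    unfolding G'G[abs_def]
    by (rule smooth_on_compose[OF open_Times[OF T(4,1)] open_Times[OF T(1,4)] _ smooth_on_bounded_linear[OF bl] T(7)]) auto
  have op: "open (T1 \<times> T2)" using T(1,4) by (rule open_Times)
  have mem: "(\<phi> p, \<psi> q) \<in> T1 \<times> T2" using T by simp
  have 1: "w (\<lambda>y. F (inv_into U \<phi> x, y)) = frechet_derivative G (at (x, \<psi> q)) (0, b)" if "x \<in> T1" for x
    by (rule tangent_of_slice[OF M N F w c(1,2) d T(1,3,4,5,6) G_def T(7) that])
  have 2: "u (\<lambda>x. F (x, inv_into V \<psi> y)) = frechet_derivative G (at (\<phi> p, y)) (a, 0)" if "y \<in> T2" for y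
  proof -
    have "u (\<lambda>x. F' (inv_into V \<psi> y, x)) = frechet_derivative G' (at (y, \<phi> p)) (0, a)"
      by (rule tangent_of_slice[OF N M F' u d(1,2) c T(4,6,1,2,3) G'_def G's that])
    also have "\<dots> = frechet_derivative G (at (\<phi> p, y)) (a, 0)"
    proof -
      have g: "(G has_derivative frechet_derivative G (at (\<phi> p, y))) (at (snd (y, \<phi> p), fst (y, \<phi> p)))"
        using smooth_on_has_derivative[OF T(7), of "(\<phi> p, y)"] that T(2) by simp
      have "(G' has_derivative (\<lambda>v. frechet_derivative G (at (\<phi> p, y)) (snd v, fst v))) (at (y, \<phi> p))"
        unfolding G'G[abs_def]
        by (rule has_derivative_compose[OF bounded_linear_imp_has_derivative[OF bl] g])
      from frechet_derivative_apply_eq[OF this, of "(0, a)"] show ?thesis by simp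
    qed
    finally show ?thesis by (simp add: F'_def)
  qed
  have near1: "smooth_near M p (\<lambda>x. w (\<lambda>y. F (x, y)))"
    by (rule smooth_near_tangent_of_slice[OF M N F p w])
  have near2: "smooth_near N q (\<lambda>y. u (\<lambda>x. F (x, y)))"
    using smooth_near_tangent_of_slice[OF N M F' q u] by (simp add: F'_def)
  let ?DD = "\<lambda>v w. frechet_derivative (\<lambda>z. frechet_derivative G (at z) v) (at (\<phi> p, \<psi> q)) w"
  have DD: "((\<lambda>z. frechet_derivative G (at z) v) has_derivative ?DD v) (at (\<phi> p, \<psi> q))" for v
    by (rule smooth_on_has_derivative[OF smooth_on_frechet_derivative[OF T(7)] mem])
  have "((\<lambda>x. w (\<lambda>y. F (inv_into U \<phi> x, y))) has_derivative (\<lambda>v. ?DD (0, b) (v, 0))) (at (\<phi> p))"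
    by (rule has_derivative_transform_within_open[OF frechet_derivative_slices(1)[OF DD] T(1,2)]) (simp add: 1)
  then have "u (\<lambda>x. w (\<lambda>y. F (x, y))) = ?DD (0, b) (a, 0)"
    using near1 by (simp add: c(3) chart_tangent_def frechet_derivative_apply_eq)
  also have "\<dots> = ?DD (a, 0) (0, b)"
    by (rule second_derivative_symmetric[OF op T(7) mem])
  also have "\<dots> = w (\<lambda>y. u (\<lambda>x. F (x, y)))"
  proof -
    have "((\<lambda>y. u (\<lambda>x. F (x, inv_into V \<psi> y))) has_derivative (\<lambda>v. ?DD (a, 0) (0, v))) (at (\<psi> q))"
      by (rule has_derivative_transform_within_open[OF frechet_derivative_slices(2)[OF DD] T(4,5)]) (simp add: 2)
    then show ?thesis
      using near2 by (simp add: d(3) chart_tangent_def frechet_derivative_apply_eq)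
  qed
  finally show ?thesis .
qed

section \<open>Simultaneous diagonalisation\<close>

lemma quadratic_nonneg_imp_linear_zero:
  fixes c d :: real
  assumes "\<And>t. 2 * t * c + t\<^sup>2 * d \<ge> 0" "d \<ge> 0"
  shows "c = 0"
proof (rule ccontr)
  assume c: "c \<noteq> 0"
  \<comment> \<open>At t = -s the expression equals -s^2 (d + 2); the denominator d + 1 stays
    positive also for d = 0.\<close>
  define s where "s = c / (d + 1)"
  have s: "c = s * (d + 1)" "s \<noteq> 0" using c assms(2) by (simp_all add: s_def)
  have "2 * (- s) * c + (- s)\<^sup>2 * d = - (s\<^sup>2 * (d + 2))"
    unfolding s(1) by (simp add: algebra_simps power2_eq_square)
  moreover have "s\<^sup>2 * (d + 2) > 0" using s(2) assms(2) by (intro mult_pos_pos) auto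
  ultimately show False using assms(1)[of "- s"] by linarith
qed

context
  fixes B :: "'a::euclidean_space \<Rightarrow> 'a \<Rightarrow> real"
  assumes bil: "bilinear B" and sym: "B x y = B y x" and pos: "x \<noteq> 0 \<Longrightarrow> B x x > 0"
begin

lemma form_definite: "B x x \<le> 0 \<Longrightarrow> x = 0"
  using pos by (metis not_le)

text \<open>A maximum of the Rayleigh quotient is an eigenvector.\<close>

lemma symmetric_operator_eigenvector:
  assumes T: "linear T" and U: "subspace U" "U \<noteq> {0}" and inv: "\<And>x. x \<in> U \<Longrightarrow> T x \<in> U"
    and symT: "\<And>x y. x \<in> U \<Longrightarrow> y \<in> U \<Longrightarrow> B (T x) y = B x (T y)"
  obtains x c where "x \<in> U" "x \<noteq> 0" "T x = c *\<^sub>R x"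
proof -
  note bl = bilinear_ladd[OF bil] bilinear_radd[OF bil] bilinear_lmul[OF bil] bilinear_rmul[OF bil]
    bilinear_lsub[OF bil] bilinear_rsub[OF bil]
  have bb: "bounded_bilinear B" using bil by (simp add: bilinear_conv_bounded_bilinear)
  \<comment> \<open>The Rayleigh quotient is homogeneous of degree 0, so the Euclidean sphere, known
    to be compact, can replace the unit sphere of B.\<close>
  let ?S = "U \<inter> sphere 0 1"
  obtain x1 where x1: "x1 \<in> U" "x1 \<noteq> 0" using U subspace_0 by blast
  have "x1 /\<^sub>R norm x1 \<in> ?S" using x1 U(1) by (simp add: subspace_scale)
  then have ne: "?S \<noteq> {}" by blast
  have comp: "compact ?S"
    using closed_subspace[OF U(1)] by (simp add: closed_Int_compact)
  have contT: "continuous_on ?S T"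
    using T linear_conv_bounded_linear linear_continuous_on by blast
  have "B x x \<noteq> 0" if "x \<in> ?S" for x
  proof -
    have "x \<noteq> 0" using that by auto
    then show ?thesis using pos[of x] by simp
  qed
  then have cont: "continuous_on ?S (\<lambda>x. B (T x) x / B x x)"
    by (intro continuous_on_divide bounded_bilinear.continuous_on[OF bb] contT continuous_on_id) auto
  obtain x0 where x0: "x0 \<in> ?S" "\<forall>y\<in>?S. B (T y) y / B y y \<le> B (T x0) x0 / B x0 x0"
    using continuous_attains_sup[OF comp ne cont] by (elim bexE)
  define l where "l = B (T x0) x0 / B x0 x0"
  define C where "C x y = l * B x y - B (T x) y" for x y
  have x0U: "x0 \<in> U" "x0 \<noteq> 0" using x0(1) by auto
  have C0: "C x0 x0 = 0" using pos[OF x0U(2)] by (simp add: C_def l_def)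
  have Cpos: "C y y \<ge> 0" if y: "y \<in> U" for y
  proof (cases "y = 0")
    case True
    then show ?thesis using bilinear_lzero[OF bil] bilinear_rzero[OF bil] by (simp add: C_def)
  next
    case False
    have "y /\<^sub>R norm y \<in> ?S" using False y U(1) by (simp add: subspace_scale)
    from bspec[OF x0(2) this] have "B (T y) y / B y y \<le> l"
      using False by (simp add: l_def bl linear_scale[OF T])
    then show ?thesis using pos[OF False] by (simp add: C_def pos_divide_le_eq)
  qed
  \<comment> \<open>C is positive semidefinite on U and vanishes at \<open>x0\<close>; expanding it
    along \<open>x0 + t *\<^sub>R y\<close> forces the linear term to vanish. Hence l x0 - T x0, an
    element of U, is B-orthogonal to U.\<close>
  have Cx0: "C x0 y = 0" if y: "y \<in> U" for y
  proof (rule quadratic_nonneg_imp_linear_zero)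
    fix t
    have m: "x0 + t *\<^sub>R y \<in> U" using x0U(1) y U(1) by (simp add: subspace_add subspace_scale)
    have e: "B y x0 = B x0 y" "B (T y) x0 = B (T x0) y"
      using symT[OF y x0U(1)] sym[of y "T x0"] sym[of y x0] by simp_all
    then have "C (x0 + t *\<^sub>R y) (x0 + t *\<^sub>R y) = 2 * t * C x0 y + t\<^sup>2 * C y y"
      using C0 by (simp add: C_def bl linear_add[OF T] linear_scale[OF T] e algebra_simps power2_eq_square)
    then show "0 \<le> 2 * t * C x0 y + t\<^sup>2 * C y y" using Cpos[OF m] by simp
  qed (rule Cpos[OF y])
  have m: "l *\<^sub>R x0 - T x0 \<in> U" using x0U(1) U(1) inv by (simp add: subspace_diff subspace_scale)
  have "B (l *\<^sub>R x0 - T x0) z = C x0 z" for z by (simp add: C_def bl)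
  then have "B (l *\<^sub>R x0 - T x0) (l *\<^sub>R x0 - T x0) = 0"
    using Cx0[OF m] by simp
  then have "T x0 = l *\<^sub>R x0" using form_definite[of "l *\<^sub>R x0 - T x0"] by simp
  then show ?thesis using that x0U by blast
qed

text \<open>Take a nonzero invariant subspace V of least dimension. An eigenspace of one operator
  inside V is invariant under the others, since they commute, hence is all of V. So every operator
  acts on V as a scalar, for index sets of any size.\<close>

lemma commuting_symmetric_operators_eigenvector:
  fixes T :: "'i \<Rightarrow> 'a \<Rightarrow> 'a"
  assumes lin: "\<And>i. i \<in> I \<Longrightarrow> linear (T i)" and symT: "\<And>i x y. i \<in> I \<Longrightarrow> B (T i x) y = B x (T i y)"
    and comm: "\<And>i j x. i \<in> I \<Longrightarrow> j \<in> I \<Longrightarrow> T i (T j x) = T j (T i x)"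
    and U: "subspace U" "U \<noteq> {0}" and inv: "\<And>i x. i \<in> I \<Longrightarrow> x \<in> U \<Longrightarrow> T i x \<in> U"
  shows "\<exists>x\<in>U. x \<noteq> 0 \<and> (\<forall>i\<in>I. \<exists>c. T i x = c *\<^sub>R x)"
proof -
  define Q where "Q V \<longleftrightarrow> subspace V \<and> V \<noteq> {0} \<and> V \<subseteq> U \<and> (\<forall>i\<in>I. \<forall>x\<in>V. T i x \<in> V)" for V
  have "Q U" using U inv by (auto simp: Q_def)
  then obtain V where V: "Q V" and min: "\<And>V'. Q V' \<Longrightarrow> dim V \<le> dim V'"
    using ex_has_least_nat[of Q U dim] by blast
  have Vs: "subspace V" "V \<noteq> {0}" "V \<subseteq> U" "\<And>i x. i \<in> I \<Longrightarrow> x \<in> V \<Longrightarrow> T i x \<in> V"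
    using V by (auto simp: Q_def)
  obtain x where x: "x \<in> V" "x \<noteq> 0" using Vs(1,2) subspace_0 by blast
  have "\<exists>c. T i x = c *\<^sub>R x" if T: "i \<in> I" for i
  proof -
    obtain y c where y: "y \<in> V" "y \<noteq> 0" "T i y = c *\<^sub>R y"
      using symmetric_operator_eigenvector[OF lin[OF T] Vs(1,2) Vs(4)[OF T] symT[OF T]] by blast
    define E where "E = {z \<in> V. T i z = c *\<^sub>R z}"
    have "subspace E"
      unfolding E_def subspace_def using Vs(1) lin[OF T]
      by (auto simp: subspace_0 subspace_add subspace_scale linear_0 linear_add linear_scale scaleR_add_right)
    moreover have "T j z \<in> E" if S: "j \<in> I" and z: "z \<in> E" for j z
      using Vs(4)[OF S, of z] z comm[OF T S, of z] linear_scale[OF lin[OF S], of c z]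
      by (simp add: E_def)
    ultimately have "Q E" using y Vs(3) by (auto simp: Q_def E_def)
    then have "dim V \<le> dim E" by (rule min)
    then have "E = V"
      using subspace_dim_equal[OF \<open>subspace E\<close> Vs(1)] by (auto simp: E_def)
    then show ?thesis using x(1) by (auto simp: E_def)
  qed
  then show ?thesis using x Vs(3) by blast
qed

text \<open>\<open>\<beta>\<close> represents B by the ambient inner product. Definiteness makes it
  injective and so surjective, and a preimage of a Euclidean normal vector of W is B-orthogonal to
  W.\<close>

lemma exists_orthogonal_vector:
  assumes W: "subspace W" "W \<noteq> UNIV"
  obtains x where "x \<noteq> 0" "\<And>w. w \<in> W \<Longrightarrow> B x w = 0"
proof -
  define \<beta> where "\<beta> x = (\<Sum>b\<in>Basis. B x b *\<^sub>R b)" for x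
  have \<beta>: "\<beta> x \<bullet> y = B x y" for x y
  proof -
    have "B x y = (\<Sum>b\<in>Basis. (y \<bullet> b) *\<^sub>R B x b)"
      using bil by (intro linear_Basis_expand) (simp add: bilinear_def)
    moreover have "\<beta> x \<bullet> y = (\<Sum>b\<in>Basis. B x b * (b \<bullet> y))"
      by (simp add: \<beta>_def inner_sum_left)
    ultimately show ?thesis by (simp add: mult.commute inner_commute)
  qed
  have lin: "linear \<beta>"
    by (rule linearI) (simp_all add: \<beta>_def bilinear_ladd[OF bil] bilinear_lmul[OF bil] scaleR_add_left
        sum.distrib scaleR_sum_right)
  have "inj \<beta>"
  proof (rule linear_injective_0[OF lin, THEN iffD2], intro allI impI)
    fix x assume "\<beta> x = 0"
    then have "B x x = 0" using \<beta>[of x x] by simp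
    then show "x = 0" by (simp add: form_definite)
  qed
  then have surj: "surj \<beta>" using linear_injective_imp_surjective[OF lin] by blast
  have "span W \<noteq> UNIV" using W by (simp add: span_eq_iff[THEN iffD2])
  then obtain z where z: "z \<noteq> 0" "\<And>w. w \<in> span W \<Longrightarrow> orthogonal z w"
    using orthogonal_to_subspace_exists_gen[of W UNIV] by (metis UNIV_I psubsetI span_UNIV top_greatest)
  obtain x where x: "\<beta> x = z" using surj by (metis surjD)
  have "x \<noteq> 0" using z(1) x linear_0[OF lin] by auto
  moreover have "B x w = 0" if "w \<in> W" for w
    using z(2)[OF span_base[OF that]] \<beta>[of x w] x by (simp add: orthogonal_def)
  ultimately show ?thesis using that by blast
qed

end


section \<open>The decomposition of \<open>\<gg>\<close> into \<open>\<kk>\<close> and \<open>\<bb>\<^sub>-\<close>\<close>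

lemma trace_commute:
  fixes f g :: "'a::euclidean_space \<Rightarrow> 'a"
  assumes "linear f" "linear g"
  shows "(\<Sum>b\<in>Basis. f (g b) \<bullet> b) = (\<Sum>b\<in>Basis. g (f b) \<bullet> b)"
proof -
  have e: "(\<Sum>b\<in>Basis. f (g b) \<bullet> b) = (\<Sum>b\<in>Basis. \<Sum>c\<in>Basis. (g b \<bullet> c) * (f c \<bullet> b))"
    if "linear f" for f g :: "'a \<Rightarrow> 'a"
    by (subst linear_Basis_expand[OF that]) (simp add: inner_sum_left)
  show ?thesis
    unfolding e[OF assms(1)] e[OF assms(2)] by (subst sum.swap) (simp add: mult.commute)
qed

locale cartan_data =
  fixes br :: "'a::euclidean_space \<Rightarrow> 'a \<Rightarrow> 'a" and \<theta> :: "'a \<Rightarrow> 'a"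
    and A :: "'a set" and P :: "('a \<Rightarrow> real) set"
  assumes lie: "lie_algebra (*\<^sub>R) br" and inv\<theta>: "cartan_involution br \<theta>"
    and maxA: "maximal_commutative_subspace br (cartan_p \<theta>) A" and posP: "positive_roots br A P"
begin

lemmas br_simps = lie_algebra.br_add_left[OF lie] lie_algebra.br_add_right[OF lie]
  lie_algebra.br_scale_left[OF lie] lie_algebra.br_scale_right[OF lie] lie_algebra.br_self[OF lie]

lemma linear_br_right: "linear (br x)"
  by (rule linearI) (simp_all add: br_simps)

lemma linear_br_left: "linear (\<lambda>x. br x y)"
  by (rule linearI) (simp_all add: br_simps)

lemma br_skew: "br x y = - br y x"
proof -
  have "br (x + y) (x + y) = br x y + br y x"
    unfolding lie_algebra.br_add_left[OF lie] lie_algebra.br_add_right[OF lie] by (simp add: br_simps(5))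
  then have "br x y + br y x = 0" by (simp add: br_simps(5))
  then show ?thesis by (simp add: eq_neg_iff_add_eq_0)
qed

lemma br_br_left: "br (br x y) z = br x (br y z) - br y (br x z)"
proof -
  have "br x (br y z) + br y (br z x) + br z (br x y) = 0" by (rule lie_algebra.jacobi[OF lie])
  moreover have "br z (br x y) = - br (br x y) z" "br y (br z x) = - br y (br x z)"
    using br_skew[of z "br x y"] br_skew[of z x] linear_neg[OF linear_br_right] by simp_all
  ultimately show ?thesis by (simp add: algebra_simps)
qed

lemma br_minus: "br (- x) y = - br x y" "br x (- y) = - br x y"
  using linear_neg[OF linear_br_left] linear_neg[OF linear_br_right] by auto

lemma br_diff: "br (x - y) z = br x z - br y z" "br x (y - z) = br x y - br x z"
  using linear_diff[OF linear_br_left] linear_diff[OF linear_br_right] by auto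

lemma linear_\<theta>: "linear \<theta>" and \<theta>_br: "\<theta> (br X Y) = br (\<theta> X) (\<theta> Y)" and \<theta>_\<theta>: "\<theta> (\<theta> X) = X"
  using inv\<theta> unfolding cartan_involution_def by auto

lemmas \<theta>_simps = linear_add[OF linear_\<theta>] linear_diff[OF linear_\<theta>] linear_neg[OF linear_\<theta>]
  linear_scale[OF linear_\<theta>] linear_0[OF linear_\<theta>] \<theta>_\<theta>

section \<open>The Killing form and the inner product attached to \<theta>\<close>

lemma killing_commute: "killing br X Y = killing br Y X"
  unfolding killing_def by (rule trace_commute[OF linear_br_right linear_br_right])

lemma bilinear_killing: "bilinear (killing br)"
  unfolding bilinear_def
  by (auto intro!: linearI simp: killing_def br_simps linear_add[OF linear_br_right]
     linear_scale[OF linear_br_right] inner_add_left sum.distrib sum_distrib_left)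

text \<open>ad [X, Y] is a commutator, and inside the trace the factor ad X can be moved cyclically
  from front to back.\<close>

lemma killing_invariant: "killing br (br X Y) Z = - killing br Y (br X Z)"
proof -
  have l: "linear (\<lambda>b. br Y (br Z b))"
    using linear_compose[OF linear_br_right linear_br_right] by (simp add: o_def)
  have "killing br (br X Y) Z
      = (\<Sum>b\<in>Basis. br X (br Y (br Z b)) \<bullet> b) - (\<Sum>b\<in>Basis. br Y (br X (br Z b)) \<bullet> b)"
    by (simp add: killing_def br_br_left inner_diff_left sum_subtractf)
  also have "(\<Sum>b\<in>Basis. br X (br Y (br Z b)) \<bullet> b) = (\<Sum>b\<in>Basis. br Y (br Z (br X b)) \<bullet> b)"
    by (rule trace_commute[OF linear_br_right l])
  also have "\<dots> - (\<Sum>b\<in>Basis. br Y (br X (br Z b)) \<bullet> b) = - killing br Y (br X Z)"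
    by (simp add: killing_def br_br_left br_diff inner_diff_left sum_subtractf)
  finally show ?thesis .
qed

text \<open>ad (\<theta> X) is ad X conjugated by the involution \<theta>, and conjugation does not
  change a trace.\<close>

lemma killing_\<theta>: "killing br (\<theta> X) (\<theta> Y) = killing br X Y"
proof -
  have l: "linear (\<lambda>b. br X (br Y (\<theta> b)))"
    using linear_compose[OF linear_compose[OF linear_\<theta> linear_br_right] linear_br_right] by (simp add: o_def)
  have "killing br (\<theta> X) (\<theta> Y) = (\<Sum>b\<in>Basis. \<theta> (br X (br Y (\<theta> b))) \<bullet> b)"
    by (simp add: killing_def \<theta>_br \<theta>_\<theta>)
  also have "\<dots> = (\<Sum>b\<in>Basis. br X (br Y (\<theta> (\<theta> b))) \<bullet> b)"
    by (rule trace_commute[OF linear_\<theta> l])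
  finally show ?thesis by (simp add: killing_def \<theta>_\<theta>)
qed

text \<open>The inner product for which ad H is symmetric when H lies in A:
  \<open>killing_invariant\<close> gives a minus sign and \<open>\<theta> H = - H\<close> a second
  one.\<close>

definition form :: "'a \<Rightarrow> 'a \<Rightarrow> real" where
  "form X Y = - killing br X (\<theta> Y)"

lemma form_pos: "X \<noteq> 0 \<Longrightarrow> form X X > 0"
  using inv\<theta> unfolding cartan_involution_def form_def by auto

lemma form_commute: "form X Y = form Y X"
  unfolding form_def using killing_\<theta>[of X "\<theta> Y"] killing_commute[of "\<theta> X" Y] by (simp add: \<theta>_\<theta>)

lemma form_\<theta>: "form (\<theta> X) Y = form X (\<theta> Y)"
  unfolding form_def using killing_\<theta>[of X Y] by (simp add: \<theta>_\<theta>)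

lemma bilinear_form: "bilinear form"
  unfolding bilinear_def form_def
  by (auto intro!: linearI simp: bilinear_ladd[OF bilinear_killing] bilinear_radd[OF bilinear_killing]
     bilinear_lmul[OF bilinear_killing] bilinear_rmul[OF bilinear_killing] \<theta>_simps)

lemmas form_simps = bilinear_ladd[OF bilinear_form] bilinear_radd[OF bilinear_form]
  bilinear_lmul[OF bilinear_form] bilinear_rmul[OF bilinear_form] bilinear_lneg[OF bilinear_form]
  bilinear_rneg[OF bilinear_form] bilinear_rsub[OF bilinear_form] bilinear_lzero[OF bilinear_form] bilinear_rzero[OF bilinear_form]

section \<open>Root spaces of the maximal commutative subspace\<close>

lemma subspace_A: "subspace A" and A_p: "H \<in> A \<Longrightarrow> \<theta> H = - H"
  and A_commute: "H \<in> A \<Longrightarrow> H' \<in> A \<Longrightarrow> br H H' = 0"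
  using maxA unfolding maximal_commutative_subspace_def commutative_subspace_of_def cartan_p_def by auto

lemma form_ad: "H \<in> A \<Longrightarrow> form (br H X) Y = form X (br H Y)"
  unfolding form_def killing_invariant by (simp add: \<theta>_br A_p br_minus bilinear_rneg[OF bilinear_killing])

lemma root_spaceD: "X \<in> root_space br A \<alpha> \<Longrightarrow> H \<in> A \<Longrightarrow> br H X = \<alpha> H *\<^sub>R X"
  unfolding root_space_def by blast

lemma subspace_root_space: "subspace (root_space br A \<alpha>)"
  unfolding subspace_def root_space_def by (auto simp: br_simps linear_0[OF linear_br_right] scaleR_add_right)

lemma root_spaces_orthogonal:
  assumes "X \<in> root_space br A \<alpha>" "Y \<in> root_space br A \<beta>" "H \<in> A" "\<alpha> H \<noteq> \<beta> H"
  shows "form X Y = 0"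
  using form_ad[OF assms(3), of X Y] root_spaceD[OF assms(1,3)] root_spaceD[OF assms(2,3)] assms(4)
  by (simp add: form_simps)

lemma \<theta>_root_space:
  assumes "X \<in> root_space br A \<alpha>"
  shows "\<theta> X \<in> root_space br A (\<lambda>H. - \<alpha> H)"
  unfolding root_space_def
proof (intro CollectI ballI)
  fix H assume H: "H \<in> A"
  have "br H (\<theta> X) = \<theta> (br (\<theta> H) X)" by (simp add: \<theta>_br \<theta>_\<theta>)
  then show "br H (\<theta> X) = - \<alpha> H *\<^sub>R \<theta> X"
    using root_spaceD[OF assms H] H by (simp add: A_p br_minus \<theta>_simps)
qed

lemma br_root_spaces:
  assumes X: "X \<in> root_space br A \<alpha>" and Y: "Y \<in> root_space br A \<beta>"
  shows "br X Y \<in> root_space br A (\<lambda>H. \<alpha> H + \<beta> H)"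
  unfolding root_space_def
proof (intro CollectI ballI)
  fix H assume H: "H \<in> A"
  have "br H (br X Y) = br (br H X) Y + br X (br H Y)" by (simp add: br_br_left)
  then show "br H (br X Y) = (\<alpha> H + \<beta> H) *\<^sub>R br X Y"
    using root_spaceD[OF X H] root_spaceD[OF Y H] by (simp add: br_simps scaleR_add_left)
qed

text \<open>The orthogonal complement U of the span is invariant under ad A. If it were nonzero, a
  joint eigenvector in U would lie in one of the spaces, hence in the span, and would be orthogonal
  to itself. The zero form is in \<open>dual_space A\<close>, so the centralizer of A is among these
  spaces.\<close>

lemma root_spaces_span: "span (\<Union>\<alpha>\<in>dual_space A. root_space br A \<alpha>) = UNIV" (is "?W = UNIV")
proof (rule ccontr)
  assume "?W \<noteq> UNIV"
  then obtain x0 where x0: "x0 \<noteq> 0" "\<And>w. w \<in> ?W \<Longrightarrow> form x0 w = 0"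
    using exists_orthogonal_vector[OF bilinear_form form_commute form_pos subspace_span] by blast
  define U where "U = {x. \<forall>w\<in>?W. form x w = 0}"
  have sU: "subspace U" unfolding U_def subspace_def by (auto simp: form_simps)
  have U0: "U \<noteq> {0}" using x0 unfolding U_def by blast
  have invW: "br H w \<in> ?W" if H: "H \<in> A" and w: "w \<in> ?W" for H w
    using w
  proof (induction rule: span_induct_alt)
    case base
    then show ?case by (simp add: linear_0[OF linear_br_right] span_zero)
  next
    case (step c x y)
    then obtain \<alpha> where a: "\<alpha> \<in> dual_space A" "x \<in> root_space br A \<alpha>" by blast
    have "br H x = \<alpha> H *\<^sub>R x" using root_spaceD[OF a(2) H] .
    moreover have "x \<in> ?W" using a by (intro span_base) blast
    ultimately show ?case using step(2) by (simp add: br_simps span_add span_scale)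
  qed
  have invU: "br H x \<in> U" if "H \<in> A" "x \<in> U" for H x
    using that invW by (auto simp: U_def form_ad)
  have comm: "br H (br H' x) = br H' (br H x)" if H: "H \<in> A" "H' \<in> A" for H H' x
    using br_br_left[of H H' x] A_commute[OF H] linear_0[OF linear_br_left] by simp
  have "\<exists>x\<in>U. x \<noteq> 0 \<and> (\<forall>H\<in>A. \<exists>c. br H x = c *\<^sub>R x)"
    by (rule commuting_symmetric_operators_eigenvector[where T = br and I = A and B = form and U = U,
      OF bilinear_form form_commute form_pos linear_br_right form_ad comm sU U0 invU])
  then obtain x where x: "x \<in> U" "x \<noteq> 0" "\<forall>H\<in>A. \<exists>c. br H x = c *\<^sub>R x" by blast
  then obtain c where c: "\<And>H. H \<in> A \<Longrightarrow> br H x = c H *\<^sub>R x" by metis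
  \<comment> \<open>The eigenvalues are cut off outside A because elements of
    \<open>dual_space A\<close> vanish there; linearity on A holds as x is nonzero.\<close>
  define \<alpha> where "\<alpha> H = (if H \<in> A then c H else 0)" for H
  have "c (H + H') *\<^sub>R x = (c H + c H') *\<^sub>R x" if "H \<in> A" "H' \<in> A" for H H'
    using c[of "H + H'"] c[OF that(1)] c[OF that(2)] that subspace_A
    by (simp add: subspace_add br_simps scaleR_add_left)
  moreover have "c (r *\<^sub>R H) = r * c H" if "H \<in> A" for H r
    using c[of "r *\<^sub>R H"] c[OF that] that subspace_A x(2) by (simp add: subspace_scale br_simps)
  ultimately have "\<alpha> \<in> dual_space A"
    using x(2) subspace_A by (auto simp: dual_space_def \<alpha>_def subspace_add subspace_scale)
  moreover have "x \<in> root_space br A \<alpha>" using c by (auto simp: root_space_def \<alpha>_def)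
  ultimately have "x \<in> ?W" by (intro span_base) blast
  then have "form x x = 0" using x(1) by (simp add: U_def)
  then show False using form_pos[OF x(2)] by simp
qed

section \<open>The complementary subalgebras k and b_-\<close>

abbreviation "\<kk> \<equiv> cartan_k \<theta>"
abbreviation "\<bb> \<equiv> b_minus br A P"

lemma subspace_k: "subspace \<kk>"
  unfolding subspace_def cartan_k_def by (auto simp: \<theta>_simps)

lemma subspace_b: "subspace \<bb>"
  unfolding b_minus_def by (rule subspace_span)

lemma A_in_b: "H \<in> A \<Longrightarrow> H \<in> \<bb>"
  unfolding b_minus_def by (simp add: span_base)

lemma root_space_in_b: "\<alpha> \<in> P \<Longrightarrow> X \<in> root_space br A (\<lambda>H. - \<alpha> H) \<Longrightarrow> X \<in> \<bb>"
  unfolding b_minus_def by (intro span_base) blast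

lemma roots_uminus:
  assumes "\<alpha> \<in> roots br A"
  shows "(\<lambda>H. - \<alpha> H) \<in> roots br A"
proof -
  have a: "\<alpha> \<in> dual_space A" "\<alpha> \<noteq> (\<lambda>H. 0)" "root_space br A \<alpha> \<noteq> {0}" using assms unfolding roots_def by auto
  obtain X where X: "X \<in> root_space br A \<alpha>" "X \<noteq> 0" using a(3) subspace_0[OF subspace_root_space] by blast
  have "\<theta> X \<noteq> 0" using X(2) \<theta>_\<theta>[of X] \<theta>_simps(5) by metis
  then have "root_space br A (\<lambda>H. - \<alpha> H) \<noteq> {0}" using \<theta>_root_space[OF X(1)] by blast
  moreover have "(\<lambda>H. - \<alpha> H) \<in> dual_space A" using a(1) by (auto simp: dual_space_def)
  moreover have "(\<lambda>H. - \<alpha> H) \<noteq> (\<lambda>H. 0)" using a(2) by (auto simp: fun_eq_iff)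
  ultimately show ?thesis by (simp add: roots_def)
qed

lemma P_roots: "\<alpha> \<in> P \<Longrightarrow> \<alpha> \<in> roots br A"
  and P_uminus: "\<alpha> \<in> roots br A \<Longrightarrow> \<alpha> \<in> P \<longleftrightarrow> (\<lambda>H. - \<alpha> H) \<notin> P"
  and P_add: "\<alpha> \<in> P \<Longrightarrow> \<beta> \<in> P \<Longrightarrow> (\<lambda>H. \<alpha> H + \<beta> H) \<in> roots br A \<Longrightarrow> (\<lambda>H. \<alpha> H + \<beta> H) \<in> P"
  using posP unfolding positive_roots_def by auto

lemma roots_nonzero:
  assumes "\<alpha> \<in> dual_space A" "\<alpha> \<noteq> (\<lambda>H. 0)"
  obtains H where "H \<in> A" "\<alpha> H \<noteq> 0"
proof -
  obtain H where H: "\<alpha> H \<noteq> 0" using assms(2) by (auto simp: fun_eq_iff)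
  then have "H \<in> A" using assms(1) unfolding dual_space_def by blast
  then show ?thesis using that H by blast
qed

text \<open>Adjoining X to A keeps the subspace commutative and inside p, so maximality of A puts X
  into A.\<close>

lemma centralizer_p:
  assumes X: "\<theta> X = - X" "\<And>H. H \<in> A \<Longrightarrow> br H X = 0"
  shows "X \<in> A"
proof -
  have e: "\<exists>H r. H \<in> A \<and> y = H + r *\<^sub>R X" if y: "y \<in> span (insert X A)" for y
  proof -
    obtain r where "y - r *\<^sub>R X \<in> span A" using y unfolding span_breakdown_eq by blast
    then show ?thesis using subspace_A by (intro exI[of _ "y - r *\<^sub>R X"] exI[of _ r]) (simp add: span_eq_iff[THEN iffD2])
  qed
  have XH: "br X H = 0" if "H \<in> A" for H using X(2)[OF that] br_skew[of X H] by simp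
  have "commutative_subspace_of br (cartan_p \<theta>) (span (insert X A))"
    unfolding commutative_subspace_of_def
  proof (intro conjI ballI subsetI)
    fix y assume "y \<in> span (insert X A)"
    then obtain H r where "H \<in> A" "y = H + r *\<^sub>R X" using e by blast
    then show "y \<in> cartan_p \<theta>" using A_p X(1) by (simp add: cartan_p_def \<theta>_simps)
  next
    fix y y' assume "y \<in> span (insert X A)" "y' \<in> span (insert X A)"
    then obtain H r H' r' where "H \<in> A" "y = H + r *\<^sub>R X" "H' \<in> A" "y' = H' + r' *\<^sub>R X" using e by metis
    then show "br y y' = 0" using A_commute X(2) XH by (simp add: br_simps)
  qed (rule subspace_span)
  moreover have "A \<subseteq> span (insert X A)" by (meson span_superset subset_insertI order_trans)
  ultimately have "span (insert X A) = A"
    using maxA unfolding maximal_commutative_subspace_def by blast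
  then show ?thesis using span_base[of X "insert X A"] by blast
qed

text \<open>It suffices to split root vectors. For \<alpha> in P write X = (X + \<theta> X) -
  \<theta> X, where \<theta> X lies in the root space of -\<alpha>; for -\<alpha> in P the vector X
  is in b_- itself; for \<alpha> = 0 split X into its \<theta>-components, the anti-invariant one
  lying in A by maximality.\<close>

lemma k_plus_b:
  obtains Y where "Y \<in> \<kk>" "X - Y \<in> \<bb>"
proof -
  let ?S = "{y + z |y z. y \<in> \<kk> \<and> z \<in> \<bb>}"
  have sS: "subspace ?S" by (rule subspace_sums[OF subspace_k subspace_b])
  have dec: "X = (X + \<theta> X) - \<theta> X" "X + \<theta> X \<in> \<kk>" for X by (simp_all add: cartan_k_def \<theta>_simps add.commute)
  have "root_space br A \<alpha> \<subseteq> ?S" if \<alpha>: "\<alpha> \<in> dual_space A" for \<alpha>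
  proof
    fix X assume X: "X \<in> root_space br A \<alpha>"
    consider "\<alpha> = (\<lambda>H. 0)" | "X = 0" | "\<alpha> \<in> roots br A" "\<alpha> \<in> P" | "\<alpha> \<in> roots br A" "(\<lambda>H. - \<alpha> H) \<in> P"
      using \<alpha> X P_uminus unfolding roots_def by blast
    then show "X \<in> ?S"
    proof cases
      case 1
      have "(1/2) *\<^sub>R (X - \<theta> X) \<in> A"
      proof (rule centralizer_p)
        show "\<theta> ((1/2) *\<^sub>R (X - \<theta> X)) = - ((1/2) *\<^sub>R (X - \<theta> X))" by (simp add: \<theta>_simps algebra_simps)
        show "br H ((1/2) *\<^sub>R (X - \<theta> X)) = 0" if "H \<in> A" for H
          using root_spaceD[OF X that] root_spaceD[OF \<theta>_root_space[OF X] that] 1 by (simp add: br_simps br_diff)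
      qed
      then have "(1/2) *\<^sub>R (X - \<theta> X) \<in> \<bb>" by (rule A_in_b)
      moreover have "(1/2) *\<^sub>R (X + \<theta> X) \<in> \<kk>" using dec(2) subspace_k by (simp add: subspace_scale)
      moreover have "X = (1/2) *\<^sub>R (X + \<theta> X) + (1/2) *\<^sub>R (X - \<theta> X)"
        by (simp add: algebra_simps flip: scaleR_add_left)
      ultimately show ?thesis by blast
    next
      case 2
      then show ?thesis using subspace_0[OF sS] by simp
    next
      case 3
      have "- \<theta> X \<in> \<bb>" using root_space_in_b[OF 3(2) \<theta>_root_space[OF X]] subspace_b by (simp add: subspace_neg)
      moreover have "X = (X + \<theta> X) + (- \<theta> X)" by simp
      ultimately show ?thesis using dec(2)[of X] by blast
    next
      case 4
      have "X \<in> \<bb>" using root_space_in_b[OF 4(2)] X by simp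
      moreover have "0 \<in> \<kk>" using subspace_k by (rule subspace_0)
      ultimately show ?thesis by force
    qed
  qed
  then have "span (\<Union>\<alpha>\<in>dual_space A. root_space br A \<alpha>) \<subseteq> ?S" by (intro span_minimal sS) blast
  then have "X \<in> ?S" using root_spaces_span by blast
  then obtain y z where "y \<in> \<kk>" "z \<in> \<bb>" "X = y + z" by blast
  then show ?thesis using that[of y] by simp
qed

lemma b_decompose:
  assumes "X \<in> \<bb>"
  obtains a n where "a \<in> A" "n \<in> span (\<Union>\<alpha>\<in>P. root_space br A (\<lambda>H. - \<alpha> H))" "X = a + n"
proof -
  have "span A = A" using subspace_A by (simp add: span_eq_iff)
  then show ?thesis using assms that unfolding b_minus_def span_Un by blast
qed

text \<open>Write X = a + n. As X = \<theta> X, its squared norm is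
  \<open>form X (\<theta> X)\<close>, in which all terms involving n vanish by orthogonality of root
  spaces for different forms. What remains is \<open>- form a a\<close>, so X = 0 by
  positivity.\<close>

lemma k_Int_b:
  assumes k: "X \<in> \<kk>" and b: "X \<in> \<bb>"
  shows "X = 0"
proof -
  let ?N = "\<Union>\<alpha>\<in>P. root_space br A (\<lambda>H. - \<alpha> H)"
  obtain a n where an: "a \<in> A" "n \<in> span ?N" "X = a + n" using b_decompose[OF b] .
  have Pd: "\<alpha> \<in> dual_space A" "\<alpha> \<noteq> (\<lambda>H. 0)" if "\<alpha> \<in> P" for \<alpha> using P_roots[OF that] by (auto simp: roots_def)
  have a0: "a \<in> root_space br A (\<lambda>H. 0)" using A_commute[OF _ an(1)] by (simp add: root_space_def)
  have 1: "form m a = 0" if "m \<in> span ?N" for m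
    using that
  proof (induction rule: span_induct_alt)
    case base
    then show ?case by (simp add: form_simps)
  next
    case (step c x y)
    then obtain \<alpha> where \<alpha>: "\<alpha> \<in> P" "x \<in> root_space br A (\<lambda>H. - \<alpha> H)" by blast
    obtain H where "H \<in> A" "\<alpha> H \<noteq> 0" using roots_nonzero[OF Pd[OF \<alpha>(1)]] .
    then have "form x a = 0" using root_spaces_orthogonal[OF \<alpha>(2) a0] by simp
    then show ?case using step(2) by (simp add: form_simps)
  qed
  have gen: "form x (\<theta> y) = 0" if x: "x \<in> ?N" and y: "y \<in> ?N" for x y
  proof -
    obtain \<alpha> where \<alpha>: "\<alpha> \<in> P" "x \<in> root_space br A (\<lambda>H. - \<alpha> H)" using x by blast
    obtain \<beta> where \<beta>: "\<beta> \<in> P" "y \<in> root_space br A (\<lambda>H. - \<beta> H)" using y by blast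
    \<comment> \<open>\<theta> y has weight \<beta> while x has weight -\<alpha>; these differ
      because P never contains a root together with its negative.\<close>
    have "\<beta> \<noteq> (\<lambda>H. - \<alpha> H)" using P_uminus[OF P_roots[OF \<alpha>(1)]] \<alpha>(1) \<beta>(1) by auto
    then obtain H where H: "\<beta> H \<noteq> - \<alpha> H" by (auto simp: fun_eq_iff)
    have "\<alpha> H = 0" "\<beta> H = 0" if "H \<notin> A"
      using Pd(1)[OF \<alpha>(1)] Pd(1)[OF \<beta>(1)] that by (simp_all add: dual_space_def)
    then have "H \<in> A" using H by force
    then show ?thesis using root_spaces_orthogonal[OF \<alpha>(2) \<theta>_root_space[OF \<beta>(2)]] H by auto
  qed
  have 2: "form m (\<theta> m') = 0" if m: "m \<in> span ?N" and m': "m' \<in> span ?N" for m m'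
    using m
  proof (induction rule: span_induct_alt)
    case base
    then show ?case by (simp add: form_simps)
  next
    case (step c x y)
    have "form x (\<theta> m') = 0"
      using m' by (induction rule: span_induct_alt) (use step(1) gen in \<open>simp_all add: form_simps \<theta>_simps\<close>)
    then show ?case using step(2) by (simp add: form_simps)
  qed
  have 3: "form a (\<theta> n) = 0"
    using form_\<theta>[of a n] 1[OF an(2)] form_commute[of a n] A_p[OF an(1)] by (simp add: form_simps)
  have "X = \<theta> X" using k by (simp add: cartan_k_def)
  then have "form X X = form X (\<theta> X)" by simp
  also have "\<dots> = - form a a"
    unfolding an(3) using 1[OF an(2)] 2[OF an(2,2)] 3 A_p[OF an(1)] by (simp add: form_simps \<theta>_simps)
  also have "\<dots> \<le> 0" using form_pos[of a] by (cases "a = 0") (simp_all add: form_simps)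
  finally show ?thesis using form_pos[of X] by (metis not_le)
qed

text \<open>On generators the case of two root spaces matters: the bracket has weight -(\<alpha> +
  \<beta>). Either that root space is zero, or \<alpha> + \<beta>, nonzero since P contains no
  opposite pair, is a root and by closedness belongs to P.\<close>

lemma br_b:
  assumes "X \<in> \<bb>" "Y \<in> \<bb>"
  shows "br X Y \<in> \<bb>"
proof -
  let ?G = "A \<union> (\<Union>\<alpha>\<in>P. root_space br A (\<lambda>H. - \<alpha> H))"
  have root: "br H X \<in> \<bb>" if "H \<in> A" "\<alpha> \<in> P" "X \<in> root_space br A (\<lambda>H. - \<alpha> H)" for H X \<alpha>
    using root_spaceD[OF that(3,1)] root_space_in_b[OF that(2,3)] subspace_b by (simp add: subspace_scale subspace_neg)
  have gen: "br x y \<in> \<bb>" if x: "x \<in> ?G" and y: "y \<in> ?G" for x y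
  proof -
    consider "x \<in> A" "y \<in> A" | \<alpha> where "x \<in> A" "\<alpha> \<in> P" "y \<in> root_space br A (\<lambda>H. - \<alpha> H)"
      | \<alpha> where "y \<in> A" "\<alpha> \<in> P" "x \<in> root_space br A (\<lambda>H. - \<alpha> H)"
      | \<alpha> \<beta> where "\<alpha> \<in> P" "x \<in> root_space br A (\<lambda>H. - \<alpha> H)" "\<beta> \<in> P" "y \<in> root_space br A (\<lambda>H. - \<beta> H)"
      using x y by blast
    then show ?thesis
    proof cases
      case 1
      then show ?thesis using A_commute subspace_0[OF subspace_b] by simp
    next
      case 2
      then show ?thesis using root by blast
    next
      case 3
      then show ?thesis using root subspace_neg[OF subspace_b] br_skew[of x y] by metis
    next
      case (4 \<alpha> \<beta>)
      define \<gamma> where "\<gamma> H = \<alpha> H + \<beta> H" for H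
      have mem: "br x y \<in> root_space br A (\<lambda>H. - \<gamma> H)"
        using br_root_spaces[OF 4(2,4)] by (simp add: \<gamma>_def add.commute)
      show ?thesis
      proof (cases "root_space br A (\<lambda>H. - \<gamma> H) = {0}")
        case True
        then show ?thesis using mem subspace_0[OF subspace_b] by simp
      next
        case False
        have "\<gamma> \<noteq> (\<lambda>H. 0)"
        proof
          assume "\<gamma> = (\<lambda>H. 0)"
          then have "\<beta> = (\<lambda>H. - \<alpha> H)" by (simp add: \<gamma>_def fun_eq_iff eq_neg_iff_add_eq_0 add.commute)
          then show False using P_uminus[OF P_roots[OF 4(1)]] 4(1,3) by auto
        qed
        then have "(\<lambda>H. - \<gamma> H) \<noteq> (\<lambda>H. 0)" by (auto simp: fun_eq_iff)
        moreover have "(\<lambda>H. - \<gamma> H) \<in> dual_space A"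
          using P_roots[OF 4(1)] P_roots[OF 4(3)] by (auto simp: roots_def dual_space_def \<gamma>_def algebra_simps)
        ultimately have "(\<lambda>H. - \<gamma> H) \<in> roots br A" using False by (simp add: roots_def)
        then have "\<gamma> \<in> roots br A" using roots_uminus by fastforce
        then have "\<gamma> \<in> P" using P_add[OF 4(1,3)] unfolding \<gamma>_def[abs_def] by blast
        then show ?thesis using root_space_in_b mem by blast
      qed
    qed
  qed
  have step1: "br x Y \<in> \<bb>" if x: "x \<in> ?G" for x
    using assms(2) unfolding b_minus_def[of br A P]
  proof (induction rule: span_induct_alt)
    case base
    then show ?case using span_zero by (simp add: linear_0[OF linear_br_right])
  next
    case (step c y z)
    then show ?case using gen[OF x] unfolding b_minus_def by (simp add: br_simps span_add span_scale)
  qed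
  show ?thesis
    using assms(1) unfolding b_minus_def[of br A P]
  proof (induction rule: span_induct_alt)
    case base
    then show ?case using span_zero by (simp add: linear_0[OF linear_br_left])
  next
    case (step c x z)
    then show ?case using step1 unfolding b_minus_def by (simp add: br_simps span_add span_scale)
  qed
qed

lemma br_k: "X \<in> \<kk> \<Longrightarrow> Y \<in> \<kk> \<Longrightarrow> br X Y \<in> \<kk>"
  by (simp add: cartan_k_def \<theta>_br)

section \<open>The projection onto k\<close>

definition \<pi> :: "'a \<Rightarrow> 'a" where
  "\<pi> X = projection_along \<kk> \<bb> X"

text \<open>The definite description is well determined because k and b_- meet only in 0; further
  facts about \<open>\<pi>\<close> are drawn from this characterization.\<close>

lemma \<pi>_unique:
  assumes "Y \<in> \<kk>" "X - Y \<in> \<bb>"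
  shows "\<pi> X = Y"
  unfolding \<pi>_def projection_along_def
proof (rule the_equality)
  fix Z assume Z: "Z \<in> \<kk> \<and> X - Z \<in> \<bb>"
  have "Z - Y \<in> \<kk>" using Z assms(1) subspace_k by (simp add: subspace_diff)
  moreover have "Z - Y = (X - Y) - (X - Z)" by simp
  then have "Z - Y \<in> \<bb>" using Z assms(2) subspace_b by (metis subspace_diff)
  ultimately show "Z = Y" using k_Int_b by force
qed (use assms in simp)

lemma \<pi>_in_k: "\<pi> X \<in> \<kk>" and \<pi>_diff_in_b: "X - \<pi> X \<in> \<bb>"
proof -
  obtain Y where Y: "Y \<in> \<kk>" "X - Y \<in> \<bb>" using k_plus_b .
  show "\<pi> X \<in> \<kk>" "X - \<pi> X \<in> \<bb>" using \<pi>_unique[OF Y] Y by auto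
qed

lemma linear_\<pi>: "linear \<pi>"
proof (rule linearI)
  fix X Y c
  have "X + Y - (\<pi> X + \<pi> Y) = (X - \<pi> X) + (Y - \<pi> Y)" by simp
  then show "\<pi> (X + Y) = \<pi> X + \<pi> Y"
    using \<pi>_in_k \<pi>_diff_in_b subspace_k subspace_b by (intro \<pi>_unique) (metis subspace_add)+
  have "c *\<^sub>R X - c *\<^sub>R \<pi> X = c *\<^sub>R (X - \<pi> X)" by (simp add: scaleR_diff_right)
  then show "\<pi> (c *\<^sub>R X) = c *\<^sub>R \<pi> X"
    using \<pi>_in_k \<pi>_diff_in_b subspace_k subspace_b by (intro \<pi>_unique) (metis subspace_scale)+
qed

text \<open>The difference of the two sides is \<open>\<pi> [X - \<pi> X, Y - \<pi> Y]\<close>, which vanishes since \<open>\<bb>\<close> is a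
  subalgebra.\<close>

lemma \<pi>_br: "\<pi> (br X Y) = \<pi> (br (\<pi> X) Y) - \<pi> (br (\<pi> Y) X) - br (\<pi> X) (\<pi> Y)"
proof -
  have b: "br (X - \<pi> X) (Y - \<pi> Y) \<in> \<bb>" by (rule br_b[OF \<pi>_diff_in_b \<pi>_diff_in_b])
  then have "\<pi> (br (X - \<pi> X) (Y - \<pi> Y)) = 0"
    using \<pi>_unique[of 0] subspace_0[OF subspace_k] by simp
  moreover have "br (X - \<pi> X) (Y - \<pi> Y) = br X Y - br (\<pi> X) Y + br (\<pi> Y) X + br (\<pi> X) (\<pi> Y)"
    using br_skew[of X "\<pi> Y"] by (simp add: br_diff algebra_simps)
  moreover have "\<pi> (br (\<pi> X) (\<pi> Y)) = br (\<pi> X) (\<pi> Y)"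
    by (rule \<pi>_unique) (simp_all add: br_k \<pi>_in_k subspace_0[OF subspace_b])
  ultimately have "\<pi> (br X Y) - \<pi> (br (\<pi> X) Y) + \<pi> (br (\<pi> Y) X) + br (\<pi> X) (\<pi> Y) = 0"
    by (simp add: linear_add[OF linear_\<pi>] linear_diff[OF linear_\<pi>])
  moreover have "x = a - b - c" if "x - a + b + c = 0" for x a b c :: 'a
  proof -
    have "x = (x - a + b + c) + (a - b - c)" by simp
    then show ?thesis using that by simp
  qed
  ultimately show ?thesis by blast
qed

end

section \<open>Lie groups\<close>

lemma smooth_map_at_const:
  assumes M: "charted M"
  shows "smooth_map_at M N p (\<lambda>x. c)"
  unfolding smooth_map_at_def
proof (intro allI impI)
  fix U \<phi> V \<psi> assume "(U, \<phi>) \<in> atlas M" "p \<in> U" "c \<in> V"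
  then show "\<exists>T. open T \<and> \<phi> p \<in> T \<and> T \<subseteq> \<phi> ` U \<and> (\<forall>x\<in>T. c \<in> V) \<and> smooth_on T (\<lambda>x. \<psi> c)"
    by (intro exI[of _ "\<phi> ` U"]) (simp add: chart_open_image[OF M] smooth_on_const)
qed

lemma smooth_at_pullback:
  assumes M: "charted M" and N: "smooth_manifold N" and F: "smooth_map_at M N p F" and f: "smooth_near N (F p) f"
  shows "smooth_map_at M \<E> p (\<lambda>x. f (F x))"
  by (rule smooth_map_at_compose[OF M smooth_manifold_charted[OF N] _ F])
    (use f in \<open>simp_all add: smooth_near_iff[OF N]\<close>)

text \<open>A linear functional of a vector-valued function is a constant combination of its
  components, so a tangent vector may be applied componentwise.\<close>

lemma tangent_inner_sum:
  assumes M: "smooth_manifold M" and u: "u \<in> tangent_space M p"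
    and F: "\<And>b. b \<in> Basis \<Longrightarrow> smooth_near M p (\<lambda>x. F x \<bullet> b)" and L: "linear L"
  shows "u (\<lambda>x. L (F x)) = L (\<Sum>b\<in>Basis. u (\<lambda>x. F x \<bullet> b) *\<^sub>R b)"
proof -
  have "u (\<lambda>x. L (F x)) = u (\<lambda>x. \<Sum>b\<in>Basis. L b * (F x \<bullet> b))"
    by (subst linear_Basis_expand[OF L]) (simp add: mult.commute)
  also have "\<dots> = (\<Sum>b\<in>Basis. u (\<lambda>x. L b * (F x \<bullet> b)))"
    by (rule tangent_sum[OF M u finite_Basis])
      (rule smooth_near_mult[OF M smooth_near_const[OF M tangent_space_topspace[OF M u]] F])
  also have "\<dots> = (\<Sum>b\<in>Basis. L b * u (\<lambda>x. F x \<bullet> b))"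
    by (rule sum.cong[OF refl]) (rule tangent_cmult[OF M u F])
  also have "\<dots> = L (\<Sum>b\<in>Basis. u (\<lambda>x. F x \<bullet> b) *\<^sub>R b)"
    by (simp add: linear_sum[OF L] linear_scale[OF L] mult.commute)
  finally show ?thesis .
qed

locale lie_grp =
  fixes G :: "('g, 'r) monoid_scheme" (structure) and S :: "('g, 'e::euclidean_space) manifold"
  assumes lg: "lie_group G S"
begin

sublocale group G using lg unfolding lie_group_def by simp

lemma manifold: "smooth_manifold S" and topspace_carrier: "topspace (mtop S) = carrier G"
  using lg unfolding lie_group_def by auto

lemmas ch = smooth_manifold_charted[OF manifold]

lemmas ch2 = charted_prod[OF ch ch]

lemma openin_carrier: "openin (mtop S) (carrier G)"
  using openin_topspace[of "mtop S"] by (simp add: topspace_carrier)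

lemma smooth_map_at_mult:
  assumes M: "charted M" and F: "smooth_map_at M S p F" and H: "smooth_map_at M S p H"
    and c: "F p \<in> carrier G" "H p \<in> carrier G"
  shows "smooth_map_at M S p (\<lambda>x. F x \<otimes> H x)"
proof -
  have m: "smooth_map_at (prod_manifold S S) S (F p, H p) (\<lambda>(g, h). g \<otimes> h)"
    using lg by (intro smooth_map_imp_at[OF ch2 ch]) (simp add: lie_group_def)
  have "(F p, H p) \<in> topspace (mtop (prod_manifold S S))"
    using c by (simp add: prod_manifold_def topspace_carrier)
  from smooth_map_at_compose[OF M ch2 this smooth_map_at_Pair[OF M ch ch F H] m]
  show ?thesis by simp
qed

lemma smooth_map_at_inv:
  assumes M: "charted M" and F: "smooth_map_at M S p F" and c: "F p \<in> carrier G"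
  shows "smooth_map_at M S p (\<lambda>x. inv F x)"
proof -
  have m: "smooth_map_at S S (F p) (\<lambda>g. inv g)"
    using lg by (intro smooth_map_imp_at[OF ch ch]) (simp add: lie_group_def)
  show ?thesis by (rule smooth_map_at_compose[OF M ch _ F m]) (simp add: topspace_carrier c)
qed

lemmas smooth_fst = smooth_map_at_fst[OF manifold ch]
lemmas smooth_snd = smooth_map_at_snd[OF ch manifold]
lemmas smooth_id = smooth_map_at_ident[OF manifold]

lemma smooth_at_mult_pair:
  assumes "g \<in> carrier G" "h \<in> carrier G" "smooth_near S (g \<otimes> h) f"
  shows "smooth_map_at (prod_manifold S S) \<E> (g, h) (\<lambda>z. f (fst z \<otimes> snd z))"
  by (rule smooth_at_pullback[OF ch2 manifold smooth_map_at_mult[OF ch2 smooth_fst smooth_snd]])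
    (use assms in simp_all)

lemma smooth_at_mult_pair_swap:
  assumes "g \<in> carrier G" "h \<in> carrier G" "smooth_near S (h \<otimes> g) f"
  shows "smooth_map_at (prod_manifold S S) \<E> (g, h) (\<lambda>z. f (snd z \<otimes> fst z))"
  by (rule smooth_at_pullback[OF ch2 manifold smooth_map_at_mult[OF ch2 smooth_snd smooth_fst]])
    (use assms in simp_all)

section \<open>Conjugation and invariant derivatives\<close>

definition conjg :: "'g \<Rightarrow> 'g \<Rightarrow> 'g" where
  "conjg g h = g \<otimes> h \<otimes> inv g"

lemma conj_one: "g \<in> carrier G \<Longrightarrow> conjg g \<one> = \<one>"
  by (simp add: conjg_def)

lemma conj_carrier: "g \<in> carrier G \<Longrightarrow> h \<in> carrier G \<Longrightarrow> conjg g h \<in> carrier G"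
  by (simp add: conjg_def)

lemma smooth_at_conj_pair:
  assumes g: "g \<in> carrier G" and f: "smooth_near S \<one> f"
  shows "smooth_map_at (prod_manifold S S) \<E> (g, \<one>) (\<lambda>z. f (conjg (fst z) (snd z)))"
proof -
  have "smooth_map_at (prod_manifold S S) S (g, \<one>) (\<lambda>z. fst z \<otimes> snd z \<otimes> inv (fst z))"
    using g by (intro smooth_map_at_mult[OF ch2] smooth_map_at_inv[OF ch2] smooth_fst smooth_snd) simp_all
  then have "smooth_map_at (prod_manifold S S) S (g, \<one>) (\<lambda>z. conjg (fst z) (snd z))"
    by (simp add: conjg_def)
  then show ?thesis
    by (rule smooth_at_pullback[OF ch2 manifold]) (use g f conj_one in simp)
qed

lemma smooth_map_at_conj:
  assumes g: "g \<in> carrier G" "h \<in> carrier G"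
  shows "smooth_map_at S S h (conjg g)"
proof -
  have "smooth_map_at S S h (\<lambda>z. g \<otimes> z \<otimes> inv g)"
    using g by (intro smooth_map_at_mult[OF ch] smooth_map_at_const[OF ch] smooth_id) simp_all
  then show ?thesis by (simp add: conjg_def[abs_def])
qed

lemma smooth_near_right:
  assumes "g \<in> carrier G" "h \<in> carrier G" "smooth_near S (h \<otimes> g) f"
  shows "smooth_near S h (\<lambda>x. f (x \<otimes> g))"
proof (rule smooth_near_compose[where F = "\<lambda>x. x \<otimes> g", OF manifold manifold _ _ assms(3)])
  show "smooth_map_at S S h (\<lambda>x. x \<otimes> g)"
    using assms by (intro smooth_map_at_mult[OF ch] smooth_map_at_const[OF ch] smooth_id)
qed (use assms in \<open>simp add: topspace_carrier\<close>)

abbreviation "T1 \<equiv> tangent_space S \<one>"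

lemma differential_conj:
  assumes g: "g \<in> carrier G" and u: "u \<in> T1"
  shows "differential S S (conjg g) \<one> u \<in> T1"
    "smooth_near S \<one> f \<Longrightarrow> differential S S (conjg g) \<one> u f = u (\<lambda>h. f (conjg g h))"
  using differential_in_tangent_space[OF manifold manifold smooth_map_at_conj[OF g one_closed] u] conj_one[OF g]
  by (simp_all add: topspace_carrier differential_def)

text \<open>At g the left-invariant field of u coincides with the right-invariant field of Ad_g u,
  because g h = (g h g^-1) g.\<close>

lemma left_derivative_eq_conj:
  assumes g: "g \<in> carrier G" and u: "u \<in> T1" and f: "smooth_near S g f"
  shows "u (\<lambda>h. f (g \<otimes> h)) = differential S S (conjg g) \<one> u (\<lambda>y. f (y \<otimes> g))"
proof -
  have "smooth_near S \<one> (\<lambda>y. f (y \<otimes> g))" using smooth_near_right[OF g one_closed] f g by simp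
  then have "differential S S (conjg g) \<one> u (\<lambda>y. f (y \<otimes> g)) = u (\<lambda>h. f (conjg g h \<otimes> g))"
    by (rule differential_conj(2)[OF g u])
  also have "\<dots> = u (\<lambda>h. f (g \<otimes> h))"
    by (rule tangent_cong[OF manifold u openin_carrier one_closed]) (simp add: conjg_def m_assoc g)
  finally show ?thesis by simp
qed

lemma smooth_near_left_derivative:
  assumes u: "u \<in> T1" and g: "g \<in> carrier G" and f: "smooth_near S g f"
  shows "smooth_near S g (\<lambda>h. u (\<lambda>x. f (h \<otimes> x)))"
  using smooth_near_tangent_of_slice[OF manifold manifold smooth_at_mult_pair[OF g one_closed] _ u] g f
  by (simp add: topspace_carrier)

lemma smooth_near_right_derivative:
  assumes u: "u \<in> T1" and g: "g \<in> carrier G" and f: "smooth_near S g f"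
  shows "smooth_near S g (\<lambda>h. u (\<lambda>x. f (x \<otimes> h)))"
  using smooth_near_tangent_of_slice[OF manifold manifold smooth_at_mult_pair_swap[OF g one_closed] _ u] g f
  by (simp add: topspace_carrier)

text \<open>This says at the identity that a left-invariant and a right-invariant field commute:
  \<open>f (x \<otimes> y)\<close> is a smooth function of two points, and derivatives in different
  variables can be exchanged.\<close>

lemma left_right_derivatives_commute:
  assumes u: "u \<in> T1" and w: "w \<in> T1" and f: "smooth_near S \<one> f"
  shows "u (\<lambda>x. w (\<lambda>y. f (x \<otimes> y))) = w (\<lambda>y. u (\<lambda>x. f (x \<otimes> y)))"
  using tangent_commute[OF manifold manifold smooth_at_mult_pair[OF one_closed one_closed] u w] f by simp

text \<open>Here \<open>j\<close> parametrises tangent vectors at \<open>\<one>\<close> and \<open>ad h\<close> lifts \<open>Ad h\<close> applied to a fixed one. The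
  identity comes from differentiating \<open>f (h x) = f ((h x h\<^sup>-\<^sup>1) h)\<close> first in \<open>x\<close> and then in \<open>h\<close>.\<close>

lemma left_derivatives_commutator:
  fixes j :: "'a::euclidean_space \<Rightarrow> 'g tangent" and ad :: "'g \<Rightarrow> 'a"
  assumes j: "\<And>Y. j Y \<in> T1" "\<And>f. linear (\<lambda>Y. j Y f)" and u: "u \<in> T1"
    and ad: "\<And>h. h \<in> carrier G \<Longrightarrow> j (ad h) = differential S S (conjg h) \<one> w" and w: "w = j (ad \<one>)"
    and ads: "\<And>c. c \<in> Basis \<Longrightarrow> smooth_near S \<one> (\<lambda>h. ad h \<bullet> c)"
    and f: "smooth_near S \<one> f"
  shows "u (\<lambda>h. w (\<lambda>x. f (h \<otimes> x))) - w (\<lambda>h. u (\<lambda>x. f (h \<otimes> x)))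
    = j (\<Sum>c\<in>Basis. u (\<lambda>h. ad h \<bullet> c) *\<^sub>R c) f"
proof -
  have wT: "w \<in> T1" using j(1) w by simp
  obtain W where W: "openin (mtop S) W" "\<one> \<in> W" "\<And>q. q \<in> W \<Longrightarrow> smooth_near S q f"
    using smooth_near_eventually[OF manifold f] by blast
  have Wc: "q \<in> carrier G" if "q \<in> W" for q using openin_subset[OF W(1)] that topspace_carrier by auto
  \<comment> \<open>Since \<open>ad h\<close> moves with h, it is expanded in a basis; the product
    rule can then separate its derivative from that of the right translate.\<close>
  have e: "w (\<lambda>x. f (h \<otimes> x)) = (\<Sum>c\<in>Basis. (ad h \<bullet> c) * j c (\<lambda>y. f (y \<otimes> h)))" if h: "h \<in> W" for h
  proof -
    have "w (\<lambda>x. f (h \<otimes> x)) = j (ad h) (\<lambda>y. f (y \<otimes> h))"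
      unfolding ad[OF Wc[OF h]] by (rule left_derivative_eq_conj[OF Wc[OF h] wT W(3)[OF h]])
    then show ?thesis using linear_Basis_expand[OF j(2)[of "\<lambda>y. f (y \<otimes> h)"], of "ad h"] by simp
  qed
  have r: "smooth_near S \<one> (\<lambda>h. j c (\<lambda>y. f (y \<otimes> h)))" for c
    by (rule smooth_near_right_derivative[OF j(1) one_closed f])
  have "u (\<lambda>h. w (\<lambda>x. f (h \<otimes> x))) = u (\<lambda>h. \<Sum>c\<in>Basis. (ad h \<bullet> c) * j c (\<lambda>y. f (y \<otimes> h)))"
    by (rule tangent_cong[OF manifold u W(1,2) e])
  also have "\<dots> = (\<Sum>c\<in>Basis. u (\<lambda>h. (ad h \<bullet> c) * j c (\<lambda>y. f (y \<otimes> h))))"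
    by (rule tangent_sum[OF manifold u finite_Basis]) (rule smooth_near_mult[OF manifold ads r])
  also have "\<dots> = (\<Sum>c\<in>Basis. u (\<lambda>h. ad h \<bullet> c) * j c (\<lambda>y. f (y \<otimes> \<one>)) + (ad \<one> \<bullet> c) * u (\<lambda>h. j c (\<lambda>y. f (y \<otimes> h))))"
    by (rule sum.cong[OF refl]) (rule tangent_mult[OF manifold u ads r])
  also have "\<dots> = (\<Sum>c\<in>Basis. u (\<lambda>h. ad h \<bullet> c) * j c f) + (\<Sum>c\<in>Basis. (ad \<one> \<bullet> c) * u (\<lambda>h. j c (\<lambda>y. f (y \<otimes> h))))"
  proof -
    have "j c (\<lambda>y. f (y \<otimes> \<one>)) = j c f" for c
      by (rule tangent_cong[OF manifold j(1) openin_carrier one_closed]) simp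
    then show ?thesis by (simp add: sum.distrib)
  qed
  also have "(\<Sum>c\<in>Basis. u (\<lambda>h. ad h \<bullet> c) * j c f) = j (\<Sum>c\<in>Basis. u (\<lambda>h. ad h \<bullet> c) *\<^sub>R c) f"
    by (simp add: linear_sum[OF j(2)[of f]] linear_scale[OF j(2)[of f]])
  \<comment> \<open>At \<one> the coefficients recombine to w; exchanging the left and right
    derivatives yields the iterated derivative in the opposite order.\<close>
  also have "(\<Sum>c\<in>Basis. (ad \<one> \<bullet> c) * u (\<lambda>h. j c (\<lambda>y. f (y \<otimes> h)))) = w (\<lambda>h. u (\<lambda>x. f (h \<otimes> x)))"
  proof -
    have "u (\<lambda>h. j c (\<lambda>y. f (y \<otimes> h))) = j c (\<lambda>y. u (\<lambda>h. f (y \<otimes> h)))" for c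
      by (rule left_right_derivatives_commute[OF j(1) u f, symmetric])
    then show ?thesis
      unfolding w using linear_Basis_expand[OF j(2)[of "\<lambda>h. u (\<lambda>x. f (h \<otimes> x))"], of "ad \<one>"] by simp
  qed
  finally show ?thesis by simp
qed

end

section \<open>The adjoint action and its derivative\<close>

locale lie_group_with_algebra = lie_grp G S
  for G :: "('g, 'r) monoid_scheme" (structure) and S :: "('g, 'e::euclidean_space) manifold" +
  fixes br :: "'a::euclidean_space \<Rightarrow> 'a \<Rightarrow> 'a" and \<iota> :: "'a \<Rightarrow> 'g tangent"
  assumes iso: "lie_algebra_iso br G S \<iota>"
begin

lemma \<iota>_bij: "bij_betw \<iota> UNIV T1"
  using iso unfolding lie_algebra_iso_def by auto

lemma \<iota>_T1: "\<iota> X \<in> T1"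
  using \<iota>_bij by (auto simp: bij_betw_def)

lemma linear_\<iota>: "linear (\<lambda>X. \<iota> X f)"
  using iso unfolding lie_algebra_iso_def by (intro linearI) auto

lemma \<iota>_inj: "\<iota> X = \<iota> Y \<longleftrightarrow> X = Y"
  using \<iota>_bij by (auto simp: bij_betw_def inj_on_def)

lemma \<iota>_eqI:
  assumes "\<And>f. smooth_near S \<one> f \<Longrightarrow> \<iota> X f = \<iota> Y f"
  shows "X = Y"
proof -
  have "\<iota> X = \<iota> Y"
  proof
    fix f show "\<iota> X f = \<iota> Y f"
      using assms tangent_not_smooth[OF manifold \<iota>_T1] by (cases "smooth_near S \<one> f") auto
  qed
  then show ?thesis by (simp add: \<iota>_inj)
qed

abbreviation "AD \<equiv> Ad G S \<iota>"

lemma \<iota>_Ad: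
  assumes "g \<in> carrier G"
  shows "\<iota> (AD g X) = differential S S (conjg g) \<one> (\<iota> X)"
proof -
  have "AD g X = the_inv_into UNIV \<iota> (differential S S (conjg g) \<one> (\<iota> X))"
    by (simp add: Ad_def conjg_def[abs_def])
  moreover have "differential S S (conjg g) \<one> (\<iota> X) \<in> \<iota> ` UNIV" "inj \<iota>"
    using differential_conj(1)[OF assms \<iota>_T1] \<iota>_bij by (auto simp: bij_betw_def)
  ultimately show ?thesis by (simp add: f_the_inv_into_f)
qed

lemma \<iota>_Ad_apply: "g \<in> carrier G \<Longrightarrow> smooth_near S \<one> f \<Longrightarrow> \<iota> (AD g X) f = \<iota> X (\<lambda>h. f (conjg g h))"
  by (simp add: \<iota>_Ad differential_conj(2)[OF _ \<iota>_T1])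

lemma smooth_near_conj:
  assumes "g \<in> carrier G" "smooth_near S \<one> f"
  shows "smooth_near S \<one> (\<lambda>h. f (conjg g h))"
  by (rule smooth_near_compose[OF manifold manifold _ smooth_map_at_conj[OF assms(1) one_closed]])
    (use assms conj_one in \<open>simp_all add: topspace_carrier\<close>)

lemma Ad_one: "AD \<one> X = X"
proof (rule \<iota>_eqI)
  fix f assume "smooth_near S \<one> f"
  then have "\<iota> (AD \<one> X) f = \<iota> X (\<lambda>h. f (conjg \<one> h))" by (simp add: \<iota>_Ad_apply)
  also have "\<dots> = \<iota> X f"
    by (rule tangent_cong[OF manifold \<iota>_T1 openin_carrier one_closed]) (simp add: conjg_def)
  finally show "\<iota> (AD \<one> X) f = \<iota> X f" .
qed

lemma Ad_mult:
  assumes g: "g \<in> carrier G" and h: "h \<in> carrier G"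
  shows "AD (g \<otimes> h) X = AD g (AD h X)"
proof (rule \<iota>_eqI)
  fix f assume f: "smooth_near S \<one> f"
  have "\<iota> (AD (g \<otimes> h) X) f = \<iota> X (\<lambda>x. f (conjg (g \<otimes> h) x))" using g h f by (simp add: \<iota>_Ad_apply)
  also have "\<dots> = \<iota> X (\<lambda>x. f (conjg g (conjg h x)))"
    by (rule tangent_cong[OF manifold \<iota>_T1 openin_carrier one_closed])
      (simp add: conjg_def m_assoc inv_mult_group g h)
  also have "\<dots> = \<iota> (AD g (AD h X)) f"
    using g h f by (simp add: \<iota>_Ad_apply smooth_near_conj)
  finally show "\<iota> (AD (g \<otimes> h) X) f = \<iota> (AD g (AD h X)) f" .
qed

lemma linear_Ad:
  assumes g: "g \<in> carrier G"
  shows "linear (AD g)"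
proof (rule linearI; rule \<iota>_eqI)
  fix X Y f and c :: real assume f: "smooth_near S \<one> f"
  show "\<iota> (AD g (X + Y)) f = \<iota> (AD g X + AD g Y) f"
    using linear_add[OF linear_\<iota>] by (simp add: \<iota>_Ad_apply[OF g f])
  show "\<iota> (AD g (c *\<^sub>R X)) f = \<iota> (c *\<^sub>R AD g X) f"
    using linear_scale[OF linear_\<iota>] by (simp add: \<iota>_Ad_apply[OF g f])
qed

text \<open>\<open>Ad\<close> is defined through the inverse of \<open>\<iota>\<close>, which shows
  nothing about its dependence on q. Evaluation on the components of a chart at \<one> gives an
  injective linear map C, and a left inverse of C writes \<open>AD q X\<close> with constant
  coefficients in the numbers \<open>\<iota> X (\<lambda>h. \<phi> (conjg q h) \<bullet> m)\<close>,
  which are smooth in q as derivatives in the second of two variables.\<close>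

lemma smooth_near_Ad:
  assumes g: "g \<in> carrier G"
  shows "smooth_near S g (\<lambda>q. AD q X \<bullet> c)"
proof -
  obtain U \<phi> where c: "(U, \<phi>) \<in> atlas S" "\<one> \<in> U"
    using charted_obtain[OF ch, of \<one>] by (auto simp: topspace_carrier)
  define C where "C Y = (\<Sum>m\<in>Basis. \<iota> Y (\<lambda>x. \<phi> x \<bullet> m) *\<^sub>R m)" for Y
  have linC: "linear C"
    unfolding C_def using linear_add[OF linear_\<iota>] linear_scale[OF linear_\<iota>]
    by (intro linearI) (simp_all add: scaleR_add_left sum.distrib scaleR_sum_right)
  have Cm: "C Y \<bullet> m = \<iota> Y (\<lambda>x. \<phi> x \<bullet> m)" if "m \<in> Basis" for Y m
    unfolding C_def by (rule inner_sum_left_Basis[OF that])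
  have "inj C"
  proof (rule injI)
    fix X Y assume eq: "C X = C Y"
    have "\<iota> X (\<lambda>x. \<phi> x \<bullet> m) = \<iota> Y (\<lambda>x. \<phi> x \<bullet> m)" if "m \<in> Basis" for m
      using Cm[OF that, of X] Cm[OF that, of Y] eq by simp
    then have "\<iota> X = \<iota> Y" by (rule tangent_eqI[OF manifold \<iota>_T1 \<iota>_T1 c])
    then show "X = Y" by (simp add: \<iota>_inj)
  qed
  then obtain L where L: "linear L" "L \<circ> C = id"
    using linear_injective_left_inverse[OF linC] by blast
  have Ad: "AD q X \<bullet> c = (\<Sum>m\<in>Basis. (L m \<bullet> c) * \<iota> X (\<lambda>h. \<phi> (conjg q h) \<bullet> m))" if q: "q \<in> carrier G" for q
  proof -
    have "AD q X = L (C (AD q X))" using L(2) by (simp add: fun_eq_iff)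
    also have "\<dots> = (\<Sum>m\<in>Basis. \<iota> (AD q X) (\<lambda>x. \<phi> x \<bullet> m) *\<^sub>R L m)"
      by (simp add: C_def linear_sum[OF L(1)] linear_scale[OF L(1)])
    finally show ?thesis
      using \<iota>_Ad_apply[OF q smooth_near_chart_component[OF manifold c]]
      by (simp add: inner_sum_left mult.commute)
  qed
  have gT: "g \<in> topspace (mtop S)" using g by (simp add: topspace_carrier)
  have "smooth_near S g (\<lambda>q. \<iota> X (\<lambda>h. \<phi> (conjg q h) \<bullet> m))" for m
    using smooth_near_tangent_of_slice[OF manifold manifold
        smooth_at_conj_pair[OF g smooth_near_chart_component[OF manifold c]] gT \<iota>_T1] by simp
  then have "smooth_near S g (\<lambda>q. \<Sum>m\<in>Basis. (L m \<bullet> c) * \<iota> X (\<lambda>h. \<phi> (conjg q h) \<bullet> m))"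
    by (intro smooth_near_sum[OF manifold gT] smooth_near_mult[OF manifold smooth_near_const[OF manifold gT]])
  then show ?thesis
    by (rule smooth_near_transform[OF manifold _ openin_carrier g]) (simp add: Ad)
qed

text \<open>The bracket of left-invariant fields with \<open>differential\<close> unfolded. The
  unfolding is valid where f is smooth, which holds on a neighbourhood of \<one>, and locality of
  tangent vectors does the rest.\<close>

lemma \<iota>_br_apply:
  assumes f: "smooth_near S \<one> f"
  shows "\<iota> (br X Y) f = \<iota> X (\<lambda>h. \<iota> Y (\<lambda>x. f (h \<otimes> x))) - \<iota> Y (\<lambda>h. \<iota> X (\<lambda>x. f (h \<otimes> x)))"
proof -
  obtain W where W: "openin (mtop S) W" "\<one> \<in> W" "\<And>q. q \<in> W \<Longrightarrow> smooth_near S q f"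
    using smooth_near_eventually[OF manifold f] by blast
  have Wc: "q \<in> carrier G" if "q \<in> W" for q using openin_subset[OF W(1)] that topspace_carrier by auto
  have e: "left_invariant_field G S (\<iota> Y) h f = \<iota> Y (\<lambda>x. f (h \<otimes> x))" if "h \<in> W" for h Y
    using W(3)[OF that] Wc[OF that] by (simp add: left_invariant_field_def differential_def)
  have s: "smooth_near S \<one> (\<lambda>h. left_invariant_field G S (\<iota> Y) h f)" for Y
    by (rule smooth_near_transform[OF manifold smooth_near_left_derivative[OF \<iota>_T1 one_closed f] W(1,2)])
      (simp add: e)
  have "left_invariant_field G S (\<iota> X) \<one> (\<lambda>h. left_invariant_field G S (\<iota> Y) h f)
      = \<iota> X (\<lambda>h. \<iota> Y (\<lambda>x. f (h \<otimes> x)))" for X Y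
  proof -
    have "left_invariant_field G S (\<iota> X) \<one> (\<lambda>h. left_invariant_field G S (\<iota> Y) h f)
        = \<iota> X (\<lambda>h. left_invariant_field G S (\<iota> Y) (\<one> \<otimes> h) f)"
      using s by (simp add: left_invariant_field_def[of G S "\<iota> X"] differential_def)
    also have "\<dots> = \<iota> X (\<lambda>h. \<iota> Y (\<lambda>x. f (h \<otimes> x)))"
      by (rule tangent_cong[OF manifold \<iota>_T1 W(1,2)]) (simp add: Wc e)
    finally show ?thesis .
  qed
  then show ?thesis
    using iso f unfolding lie_algebra_iso_def by (simp add: vf_bracket_def)
qed

text \<open>The commutator of the left-invariant fields of Y and X is computed twice: by definition
  it is \<open>\<iota> (br Y X)\<close>, and \<open>left_derivatives_commutator\<close> gives
  \<iota> of the derivative of \<open>AD h X\<close> along Y. Injectivity of \<iota> compares the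
  two.\<close>

lemma Ad_derivative:
  assumes c: "c \<in> Basis"
  shows "\<iota> Y (\<lambda>h. AD h X \<bullet> c) = br Y X \<bullet> c"
proof -
  define D where "D = (\<Sum>c\<in>Basis. \<iota> Y (\<lambda>h. AD h X \<bullet> c) *\<^sub>R c)"
  have "D = br Y X"
  proof (rule \<iota>_eqI)
    fix f assume f: "smooth_near S \<one> f"
    have "\<iota> Y (\<lambda>h. \<iota> X (\<lambda>x. f (h \<otimes> x))) - \<iota> X (\<lambda>h. \<iota> Y (\<lambda>x. f (h \<otimes> x))) = \<iota> D f"
      unfolding D_def
      by (rule left_derivatives_commutator[where ad = "\<lambda>h. AD h X" and j = \<iota>, OF \<iota>_T1 linear_\<iota> \<iota>_T1 \<iota>_Ad _ smooth_near_Ad[OF one_closed] f])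
        (simp_all add: Ad_one)
    then show "\<iota> D f = \<iota> (br Y X) f" by (simp add: \<iota>_br_apply[OF f])
  qed
  moreover have "D \<bullet> c = \<iota> Y (\<lambda>h. AD h X \<bullet> c)"
    unfolding D_def by (rule inner_sum_left_Basis[OF c])
  ultimately show ?thesis by simp
qed

lemma Ad_derivative_linear:
  assumes L: "linear L"
  shows "\<iota> Y (\<lambda>h. L (AD h X)) = L (br Y X)"
  using tangent_inner_sum[OF manifold \<iota>_T1 smooth_near_Ad[OF one_closed] L, of Y X] Ad_derivative[of _ Y X]
  by (simp add: euclidean_representation)

text \<open>Differentiate Ad_{g h g^-1} Ad_g Y = Ad_g Ad_h Y in h at \<one> along X.\<close>

lemma Ad_br:
  assumes g: "g \<in> carrier G"
  shows "AD g (br X Y) = br (AD g X) (AD g Y)"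
proof (rule euclidean_eqI)
  fix c :: 'a assume c: "c \<in> Basis"
  have L: "linear (\<lambda>Z. AD g Z \<bullet> c)"
    using linear_compose[OF linear_Ad[OF g] bounded_linear.linear[OF bounded_linear_inner_left]] by (simp add: o_def)
  have "br (AD g X) (AD g Y) \<bullet> c = \<iota> (AD g X) (\<lambda>h. AD h (AD g Y) \<bullet> c)"
    by (simp add: Ad_derivative[OF c])
  also have "\<dots> = \<iota> X (\<lambda>h. AD (conjg g h) (AD g Y) \<bullet> c)"
    by (rule \<iota>_Ad_apply[OF g smooth_near_Ad[OF one_closed]])
  also have "\<dots> = \<iota> X (\<lambda>h. AD g (AD h Y) \<bullet> c)"
  proof (rule tangent_cong[OF manifold \<iota>_T1 openin_carrier one_closed])
    fix h assume h: "h \<in> carrier G"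
    have "conjg g h \<otimes> g = g \<otimes> h" using g h by (simp add: conjg_def m_assoc)
    then have "AD (conjg g h) (AD g Y) = AD g (AD h Y)"
      using Ad_mult[OF conj_carrier[OF g h] g] Ad_mult[OF g h] by metis
    then show "AD (conjg g h) (AD g Y) \<bullet> c = AD g (AD h Y) \<bullet> c" by simp
  qed
  also have "\<dots> = AD g (br X Y) \<bullet> c" by (rule Ad_derivative_linear[OF L])
  finally show "AD g (br X Y) \<bullet> c = br (AD g X) (AD g Y) \<bullet> c" by simp
qed

end

section \<open>Lie subgroups\<close>

locale lie_subgroup_with_algebra = lie_group_with_algebra G S br \<iota>
  for G :: "('g, 'r) monoid_scheme" (structure) and S :: "('g, 'e::euclidean_space) manifold"
    and br :: "'a::euclidean_space \<Rightarrow> 'a \<Rightarrow> 'a" and \<iota> :: "'a \<Rightarrow> 'g tangent" +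
  fixes K :: "'g set" and SK :: "('g, 'f::euclidean_space) manifold"
  assumes sub: "lie_subgroup G S K SK"
begin

lemma subgroup_K: "subgroup K G"
  using sub unfolding lie_subgroup_def by simp

text \<open>K is regarded as a Lie group in its own right, with the topology of \<open>SK\<close>,
  so the facts on invariant derivatives become available a second time.\<close>

sublocale K: lie_grp "G\<lparr>carrier := K\<rparr>" SK
  using sub unfolding lie_subgroup_def by unfold_locales simp

lemma K_topspace: "topspace (mtop SK) = K"
  using K.topspace_carrier by simp

lemma K_openin: "openin (mtop SK) K"
  using K.openin_carrier by simp

lemma K_carrier: "k \<in> K \<Longrightarrow> k \<in> carrier G"
  using subgroup.subset[OF subgroup_K] by blast

lemma K_one: "\<one> \<in> K"
  by (rule subgroup.one_closed[OF subgroup_K])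

lemma K_conjg: "g \<in> K \<Longrightarrow> K.conjg g h = conjg g h"
  by (simp add: K.conjg_def conjg_def m_inv_consistent[OF subgroup_K])

lemma inclusion_smooth: "smooth_map_at SK S p (\<lambda>x. x)"
  using sub by (intro smooth_map_imp_at[OF K.ch ch]) (simp add: lie_subgroup_def)

lemma smooth_near_restrict:
  assumes "k \<in> K" "smooth_near S k f"
  shows "smooth_near SK k f"
  using smooth_near_compose[OF K.manifold manifold _ inclusion_smooth, of k f] assms by (simp add: K_topspace)

abbreviation "TK \<equiv> tangent_space SK \<one>"
abbreviation "push \<equiv> differential SK S (\<lambda>x. x) \<one>"
abbreviation "\<kk>\<ss> \<equiv> subgroup_lie_algebra G S \<iota> SK"
abbreviation "\<tau> \<equiv> subgroup_tangent G S \<iota> SK"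

lemma push_inj: "inj_on push TK"
  using sub K_one unfolding lie_subgroup_def by blast

lemma \<tau>_TK: "X \<in> \<kk>\<ss> \<Longrightarrow> \<tau> X \<in> TK" and push_\<tau>: "X \<in> \<kk>\<ss> \<Longrightarrow> push (\<tau> X) = \<iota> X"
  unfolding subgroup_lie_algebra_def subgroup_tangent_def
  using the_inv_into_into[OF push_inj _ subset_refl] f_the_inv_into_f[OF push_inj] by auto

lemma \<tau>_eqI:
  assumes "u \<in> TK" "push u = \<iota> X"
  shows "X \<in> \<kk>\<ss>" "\<tau> X = u"
proof -
  have "\<iota> X \<in> push ` TK" using assms by (metis imageI)
  then show "X \<in> \<kk>\<ss>" by (simp add: subgroup_lie_algebra_def)
  show "\<tau> X = u"
    unfolding subgroup_tangent_def assms(2)[symmetric] by (rule the_inv_into_f_f[OF push_inj assms(1)])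
qed

text \<open>\<open>\<tau>\<close> inverts the injective map \<open>push\<close>, so additivity is
  checked after pushing forward; off the subalgebra \<open>\<tau>\<close> is unspecified.\<close>

lemma \<tau>_add: "X \<in> \<kk>\<ss> \<Longrightarrow> Y \<in> \<kk>\<ss> \<Longrightarrow> \<tau> (X + Y) f = \<tau> X f + \<tau> Y f"
proof -
  assume k: "X \<in> \<kk>\<ss>" "Y \<in> \<kk>\<ss>"
  have "push (\<lambda>f. \<tau> X f + \<tau> Y f) = (\<lambda>f. push (\<tau> X) f + push (\<tau> Y) f)"
    by (simp add: differential_def fun_eq_iff)
  also have "\<dots> = \<iota> (X + Y)"
    using push_\<tau>[OF k(1)] push_\<tau>[OF k(2)] linear_add[OF linear_\<iota>] by (simp add: fun_eq_iff)
  finally have "\<tau> (X + Y) = (\<lambda>f. \<tau> X f + \<tau> Y f)"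
    by (rule \<tau>_eqI(2)[OF tangent_space_add[OF K.manifold \<tau>_TK[OF k(1)] \<tau>_TK[OF k(2)]]])
  then show ?thesis by simp
qed

lemma \<tau>_scale: "X \<in> \<kk>\<ss> \<Longrightarrow> \<tau> (c *\<^sub>R X) f = c * \<tau> X f"
proof -
  assume k: "X \<in> \<kk>\<ss>"
  have "push (\<lambda>f. c * \<tau> X f) = (\<lambda>f. c * push (\<tau> X) f)"
    by (simp add: differential_def fun_eq_iff)
  also have "\<dots> = \<iota> (c *\<^sub>R X)"
    using push_\<tau>[OF k] linear_scale[OF linear_\<iota>] by (simp add: fun_eq_iff)
  finally have "\<tau> (c *\<^sub>R X) = (\<lambda>f. c * \<tau> X f)"
    by (rule \<tau>_eqI(2)[OF tangent_space_scale[OF K.manifold \<tau>_TK[OF k]]])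
  then show ?thesis by simp
qed

lemma \<tau>_apply:
  assumes "X \<in> \<kk>\<ss>" "smooth_near S \<one> f"
  shows "\<tau> X f = \<iota> X f"
proof -
  have "push (\<tau> X) f = \<tau> X f" using assms(2) by (simp add: differential_def)
  then show ?thesis by (simp add: push_\<tau>[OF assms(1)])
qed

text \<open>Conjugation by h preserves K, so its differential within K supplies a tangent vector of
  K; pushed into G it is \<iota> of \<open>AD h X\<close>.\<close>

lemma Ad_subgroup:
  assumes h: "h \<in> K" and X: "X \<in> \<kk>\<ss>"
  shows "AD h X \<in> \<kk>\<ss>" "\<tau> (AD h X) = differential SK SK (K.conjg h) \<one> (\<tau> X)"
proof -
  let ?u = "differential SK SK (K.conjg h) \<one> (\<tau> X)"
  have hK: "h \<in> carrier (G\<lparr>carrier := K\<rparr>)" using h by simp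
  have \<tau>T: "\<tau> X \<in> tangent_space SK \<one>\<^bsub>G\<lparr>carrier := K\<rparr>\<^esub>" using \<tau>_TK[OF X] by simp
  have uT: "?u \<in> TK" using K.differential_conj(1)[OF hK \<tau>T] by simp
  have "push ?u = \<iota> (AD h X)"
  proof
    fix f
    show "push ?u f = \<iota> (AD h X) f"
    proof (cases "smooth_near S \<one> f")
      case True
      have fK: "smooth_near SK \<one>\<^bsub>G\<lparr>carrier := K\<rparr>\<^esub> f" using smooth_near_restrict[OF K_one True] by simp
      have "push ?u f = ?u f" using True by (simp add: differential_def)
      also have "\<dots> = \<tau> X (\<lambda>x. f (K.conjg h x))"
        using K.differential_conj(2)[OF hK \<tau>T fK] by simp
      also have "\<dots> = \<tau> X (\<lambda>x. f (conjg h x))" by (simp add: K_conjg[OF h])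
      also have "\<dots> = \<iota> X (\<lambda>x. f (conjg h x))"
        by (rule \<tau>_apply[OF X smooth_near_conj[OF K_carrier[OF h] True]])
      also have "\<dots> = \<iota> (AD h X) f" by (rule \<iota>_Ad_apply[OF K_carrier[OF h] True, symmetric])
      finally show ?thesis .
    next
      case False
      then show ?thesis using tangent_not_smooth[OF manifold \<iota>_T1] by (simp add: differential_def)
    qed
  qed
  then show "AD h X \<in> \<kk>\<ss>" "\<tau> (AD h X) = ?u" using \<tau>_eqI[OF uT] by auto
qed

end


section \<open>Generalised Toda fields\<close>

locale toda_data = cartan_data br \<theta> A P + lie_subgroup_with_algebra G S br \<iota> K SK
  for br :: "'a::euclidean_space \<Rightarrow> 'a \<Rightarrow> 'a" and \<theta> :: "'a \<Rightarrow> 'a"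
    and A :: "'a set" and P :: "('a \<Rightarrow> real) set"
    and G :: "('g, 'r) monoid_scheme" (structure) and S :: "('g, 'e::euclidean_space) manifold"
    and \<iota> :: "'a \<Rightarrow> 'g tangent"
    and K :: "'g set" and SK :: "('g, 'f::euclidean_space) manifold" +
  assumes algebra_K: "subgroup_lie_algebra G S \<iota> SK = cartan_k \<theta>"
begin

abbreviation "toda \<equiv> toda_field br \<theta> A P G S \<iota> SK"

text \<open>The tangent vector of K at \<one> given by the k-component of X. Being linear on the
  whole Lie algebra, it allows expansions over \<open>Basis\<close> without choosing a basis of
  k.\<close>

definition \<sigma> :: "'a \<Rightarrow> 'g tangent" where
  "\<sigma> X = \<tau> (\<pi> X)"

lemma \<pi>_in_algebra: "\<pi> X \<in> \<kk>\<ss>"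
  using \<pi>_in_k algebra_K by simp

lemma \<pi>_k: "X \<in> \<kk> \<Longrightarrow> \<pi> X = X"
  by (rule \<pi>_unique) (simp_all add: subspace_0[OF subspace_b])

lemma \<sigma>_TK: "\<sigma> X \<in> TK"
  unfolding \<sigma>_def by (rule \<tau>_TK[OF \<pi>_in_algebra])

lemma linear_\<sigma>: "linear (\<lambda>X. \<sigma> X f)"
  by (rule linearI)
    (simp_all add: \<sigma>_def linear_add[OF linear_\<pi>] linear_scale[OF linear_\<pi>] \<tau>_add \<tau>_scale \<pi>_in_algebra)

lemma \<sigma>_apply: "smooth_near S \<one> f \<Longrightarrow> \<sigma> X f = \<iota> (\<pi> X) f"
  unfolding \<sigma>_def by (rule \<tau>_apply[OF \<pi>_in_algebra])

lemma smooth_map_at_right_mult: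
  assumes "k \<in> K"
  shows "smooth_map_at SK SK \<one> (\<lambda>h. h \<otimes> k)"
  using K.smooth_map_at_mult[OF K.ch K.smooth_id smooth_map_at_const[OF K.ch], of \<one> k] K_one assms by simp

lemma toda_apply:
  assumes k: "k \<in> K" and f: "smooth_near SK k f"
  shows "toda X k f = \<sigma> (AD k X) (\<lambda>h. f (h \<otimes> k))"
  using f K_carrier[OF k] by (simp add: toda_field_def differential_def \<sigma>_def \<pi>_def)

lemma toda_tangent:
  assumes k: "k \<in> K"
  shows "toda X k \<in> tangent_space SK k"
proof -
  have "differential SK SK (\<lambda>h. h \<otimes> k) \<one> (\<sigma> (AD k X)) \<in> tangent_space SK (\<one> \<otimes> k)"
    by (rule differential_in_tangent_space[OF K.manifold K.manifold smooth_map_at_right_mult[OF k] \<sigma>_TK])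
      (use k K_carrier[OF k] in \<open>simp add: K_topspace\<close>)
  then show ?thesis using K_carrier[OF k] by (simp add: toda_field_def \<sigma>_def \<pi>_def)
qed

lemma smooth_near_right_translate:
  assumes "k \<in> K" "smooth_near SK k f"
  shows "smooth_near SK \<one> (\<lambda>h. f (h \<otimes> k))"
  using K.smooth_near_right[of k \<one> f] assms K_one K_carrier by simp

lemma smooth_near_\<sigma>_right:
  assumes k: "k \<in> K" and f: "smooth_near SK k f"
  shows "smooth_near SK k (\<lambda>q. \<sigma> X (\<lambda>h. f (h \<otimes> q)))"
  using K.smooth_near_right_derivative[of "\<sigma> X" k f] assms \<sigma>_TK by simp

lemma smooth_near_Ad_K: "k \<in> K \<Longrightarrow> smooth_near SK k (\<lambda>q. AD q X \<bullet> c)"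
  by (rule smooth_near_restrict[OF _ smooth_near_Ad[OF K_carrier]])

text \<open>The point q enters twice, through Ad_q X and through the right translation by q. The
  expansion separates the two into coefficient functions and right-invariant derivatives. It is
  stated on a neighbourhood so that it can be differentiated.\<close>

lemma toda_near_expansion:
  assumes k: "k \<in> K" and f: "smooth_near SK k f"
  obtains W where "openin (mtop SK) W" "k \<in> W"
    "\<And>q. q \<in> W \<Longrightarrow> toda X q f = (\<Sum>b\<in>Basis. (AD q X \<bullet> b) * \<sigma> b (\<lambda>h. f (h \<otimes> q)))"
proof -
  obtain W where W: "openin (mtop SK) W" "k \<in> W" "\<And>q. q \<in> W \<Longrightarrow> smooth_near SK q f"
    using smooth_near_eventually[OF K.manifold f] by blast
  have "toda X q f = (\<Sum>b\<in>Basis. (AD q X \<bullet> b) * \<sigma> b (\<lambda>h. f (h \<otimes> q)))" if q: "q \<in> W" for q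
  proof -
    have "q \<in> K" using openin_subset[OF W(1)] q K_topspace by auto
    then show ?thesis
      using linear_Basis_expand[OF linear_\<sigma>[of "\<lambda>h. f (h \<otimes> q)"], of "AD q X"] toda_apply W(3)[OF q] by simp
  qed
  then show ?thesis using that W(1,2) by blast
qed

lemma smooth_near_toda:
  assumes k: "k \<in> K" and f: "smooth_near SK k f"
  shows "smooth_near SK k (\<lambda>q. toda X q f)"
proof -
  obtain W where W: "openin (mtop SK) W" "k \<in> W"
    "\<And>q. q \<in> W \<Longrightarrow> toda X q f = (\<Sum>b\<in>Basis. (AD q X \<bullet> b) * \<sigma> b (\<lambda>h. f (h \<otimes> q)))"
    using toda_near_expansion[OF k f] by blast
  have kT: "k \<in> topspace (mtop SK)" using k K_topspace by simp
  have "smooth_near SK k (\<lambda>q. \<Sum>b\<in>Basis. (AD q X \<bullet> b) * \<sigma> b (\<lambda>h. f (h \<otimes> q)))"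
    by (rule smooth_near_sum[OF K.manifold kT])
      (rule smooth_near_mult[OF K.manifold smooth_near_Ad_K[OF k] smooth_near_\<sigma>_right[OF k f]])
  then show ?thesis
    by (rule smooth_near_transform[OF K.manifold _ W(1,2)]) (simp add: W(3))
qed

text \<open>The general commutator formula on K, with \<open>\<sigma>\<close> as parametrization and
  \<open>AD h b\<close> as lift of the adjoint action of K; the derivative of the lift along a is
  known from G to be \<open>br a b\<close>.\<close>

lemma left_derivatives_commutator_K:
  assumes a: "a \<in> \<kk>" and b: "b \<in> \<kk>" and f: "smooth_near SK \<one> f"
  shows "\<sigma> a (\<lambda>h. \<sigma> b (\<lambda>x. f (h \<otimes> x))) - \<sigma> b (\<lambda>h. \<sigma> a (\<lambda>x. f (h \<otimes> x))) = \<sigma> (br a b) f"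
proof -
  have \<sigma>: "\<sigma> c = \<tau> c" if "c \<in> \<kk>" for c by (simp add: \<sigma>_def \<pi>_k[OF that])
  have bs: "b \<in> \<kk>\<ss>" using b algebra_K by simp
  have Ad: "\<sigma> (AD h b) = differential SK SK (K.conjg h) \<one> (\<sigma> b)" if "h \<in> K" for h
    using Ad_subgroup[OF that bs] \<sigma>[OF b] \<sigma>[of "AD h b"] algebra_K by simp
  let ?GK = "G\<lparr>carrier := K\<rparr>"
  have "\<sigma> a (\<lambda>h. \<sigma> b (\<lambda>x. f (h \<otimes>\<^bsub>?GK\<^esub> x))) - \<sigma> b (\<lambda>h. \<sigma> a (\<lambda>x. f (h \<otimes>\<^bsub>?GK\<^esub> x)))
      = \<sigma> (\<Sum>c\<in>Basis. \<sigma> a (\<lambda>h. AD h b \<bullet> c) *\<^sub>R c) f"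
  proof (rule K.left_derivatives_commutator[where j = \<sigma> and u = "\<sigma> a" and w = "\<sigma> b" and ad = "\<lambda>h. AD h b" and f = f])
    show "linear (\<lambda>Y. \<sigma> Y f)" for f by (rule linear_\<sigma>)
    show "\<sigma> (AD h b) = differential SK SK (K.conjg h) \<one>\<^bsub>?GK\<^esub> (\<sigma> b)" if "h \<in> carrier ?GK" for h
      using Ad[of h] that by simp
  qed (use \<sigma>_TK f smooth_near_Ad_K[OF K_one] in \<open>simp_all add: Ad_one\<close>)
  then have "\<sigma> a (\<lambda>h. \<sigma> b (\<lambda>x. f (h \<otimes> x))) - \<sigma> b (\<lambda>h. \<sigma> a (\<lambda>x. f (h \<otimes> x)))
      = \<sigma> (\<Sum>c\<in>Basis. \<sigma> a (\<lambda>h. AD h b \<bullet> c) *\<^sub>R c) f"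
    by simp
  also have "(\<Sum>c\<in>Basis. \<sigma> a (\<lambda>h. AD h b \<bullet> c) *\<^sub>R c) = (\<Sum>c\<in>Basis. (br a b \<bullet> c) *\<^sub>R c)"
    by (rule sum.cong[OF refl]) (simp add: \<sigma>_apply[OF smooth_near_Ad[OF one_closed]] \<pi>_k[OF a] Ad_derivative)
  also have "\<dots> = br a b" by (rule euclidean_representation)
  finally show ?thesis .
qed

text \<open>Ad_{h k} = Ad_h Ad_k, and h moves in K with velocity the k-component of Ad_k X, so the
  derivative is a bracket with that component and not with Ad_k X.\<close>

lemma toda_Ad:
  assumes k: "k \<in> K" and c: "c \<in> Basis"
  shows "toda X k (\<lambda>q. AD q Z \<bullet> c) = br (\<pi> (AD k X)) (AD k Z) \<bullet> c"
proof -
  have "toda X k (\<lambda>q. AD q Z \<bullet> c) = \<sigma> (AD k X) (\<lambda>h. AD (h \<otimes> k) Z \<bullet> c)"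
    by (rule toda_apply[OF k smooth_near_Ad_K[OF k]])
  also have "\<dots> = \<sigma> (AD k X) (\<lambda>h. AD h (AD k Z) \<bullet> c)"
    by (rule tangent_cong[OF K.manifold \<sigma>_TK K_openin K_one]) (simp add: Ad_mult K_carrier k)
  also have "\<dots> = br (\<pi> (AD k X)) (AD k Z) \<bullet> c"
    by (simp add: \<sigma>_apply[OF smooth_near_Ad[OF one_closed]] Ad_derivative[OF c])
  finally show ?thesis .
qed

text \<open>Near k the translate is f(h x k); left and right derivatives on K commute, which moves b
  to the outside. This reversal of order is the source of the opposite sign for right-invariant
  fields.\<close>

lemma toda_\<sigma>:
  assumes k: "k \<in> K" and f: "smooth_near SK k f"
  shows "toda X k (\<lambda>q. \<sigma> b (\<lambda>h. f (h \<otimes> q)))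
    = \<sigma> b (\<lambda>h. \<sigma> (AD k X) (\<lambda>x. f (h \<otimes> x \<otimes> k)))"
proof -
  let ?f = "\<lambda>y. f (y \<otimes> k)"
  have f': "smooth_near SK \<one>\<^bsub>G\<lparr>carrier := K\<rparr>\<^esub> ?f" using smooth_near_right_translate[OF k f] by simp
  have "toda X k (\<lambda>q. \<sigma> b (\<lambda>h. f (h \<otimes> q))) = \<sigma> (AD k X) (\<lambda>x. \<sigma> b (\<lambda>h. f (h \<otimes> (x \<otimes> k))))"
    by (rule toda_apply[OF k smooth_near_\<sigma>_right[OF k f]])
  also have "\<dots> = \<sigma> (AD k X) (\<lambda>x. \<sigma> b (\<lambda>h. ?f (h \<otimes> x)))"
    by (rule tangent_cong[OF K.manifold \<sigma>_TK K_openin K_one], rule tangent_cong[OF K.manifold \<sigma>_TK K_openin K_one])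
      (simp add: m_assoc K_carrier k)
  also have "\<dots> = \<sigma> b (\<lambda>h. \<sigma> (AD k X) (\<lambda>x. ?f (h \<otimes> x)))"
    using K.left_right_derivatives_commute[OF _ _ f', of "\<sigma> b" "\<sigma> (AD k X)"] \<sigma>_TK by simp
  finally show ?thesis .
qed

text \<open>In the product rule for the expansion of T^Z f, the differentiated coefficients give the
  first term and the differentiated right-invariant derivatives the second.\<close>

lemma toda_toda:
  assumes k: "k \<in> K" and f: "smooth_near SK k f"
  shows "toda X k (\<lambda>q. toda Z q f) = \<sigma> (br (\<pi> (AD k X)) (AD k Z)) (\<lambda>h. f (h \<otimes> k))
      + \<sigma> (AD k Z) (\<lambda>h. \<sigma> (AD k X) (\<lambda>x. f (h \<otimes> x \<otimes> k)))"
proof -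
  obtain W where W: "openin (mtop SK) W" "k \<in> W"
    "\<And>q. q \<in> W \<Longrightarrow> toda Z q f = (\<Sum>b\<in>Basis. (AD q Z \<bullet> b) * \<sigma> b (\<lambda>h. f (h \<otimes> q)))"
    using toda_near_expansion[OF k f] by blast
  note D = toda_tangent[OF k, of X]
  note s = smooth_near_Ad_K[OF k] smooth_near_\<sigma>_right[OF k f]
  let ?z = "br (\<pi> (AD k X)) (AD k Z)"
  have "toda X k (\<lambda>q. toda Z q f) = toda X k (\<lambda>q. \<Sum>b\<in>Basis. (AD q Z \<bullet> b) * \<sigma> b (\<lambda>h. f (h \<otimes> q)))"
    by (rule tangent_cong[OF K.manifold D W])
  also have "\<dots> = (\<Sum>b\<in>Basis. toda X k (\<lambda>q. (AD q Z \<bullet> b) * \<sigma> b (\<lambda>h. f (h \<otimes> q))))"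
    by (rule tangent_sum[OF K.manifold D finite_Basis]) (rule smooth_near_mult[OF K.manifold s])
  also have "\<dots> = (\<Sum>b\<in>Basis. (?z \<bullet> b) * \<sigma> b (\<lambda>h. f (h \<otimes> k))
      + (AD k Z \<bullet> b) * \<sigma> b (\<lambda>h. \<sigma> (AD k X) (\<lambda>x. f (h \<otimes> x \<otimes> k))))"
    by (rule sum.cong[OF refl]) (simp add: tangent_mult[OF K.manifold D s] toda_Ad[OF k] toda_\<sigma>[OF k f])
  also have "\<dots> = \<sigma> ?z (\<lambda>h. f (h \<otimes> k)) + \<sigma> (AD k Z) (\<lambda>h. \<sigma> (AD k X) (\<lambda>x. f (h \<otimes> x \<otimes> k)))"
    using linear_Basis_expand[OF linear_\<sigma>[of "\<lambda>h. f (h \<otimes> k)"], of ?z]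
      linear_Basis_expand[OF linear_\<sigma>[of "\<lambda>h. \<sigma> (AD k X) (\<lambda>x. f (h \<otimes> x \<otimes> k))"], of "AD k Z"]
    by (simp add: sum.distrib)
  finally show ?thesis .
qed

text \<open>The second-order terms combine to the commutator [\<pi> z, \<pi> x] in k, with z before
  x. Together with the two first-order terms this is \<pi> [\<pi> x, z] - \<pi> [\<pi> z, x] -
  [\<pi> x, \<pi> z], which is the formula for \<pi> [x, z]; finally Ad_k respects brackets.\<close>

theorem toda_bracket:
  assumes k: "k \<in> K" and f: "smooth_near SK k f"
  shows "toda X k (\<lambda>q. toda Z q f) - toda Z k (\<lambda>q. toda X q f) = toda (br X Z) k f"
proof -
  let ?x = "AD k X" and ?z = "AD k Z" and ?f = "\<lambda>h. f (h \<otimes> k)"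
  have f': "smooth_near SK \<one> ?f" by (rule smooth_near_right_translate[OF k f])
  have \<sigma>\<pi>: "\<sigma> (\<pi> Y) = \<sigma> Y" for Y by (simp add: \<sigma>_def \<pi>_k[OF \<pi>_in_k])
  have c: "\<sigma> ?z (\<lambda>h. \<sigma> ?x (\<lambda>x. ?f (h \<otimes> x))) - \<sigma> ?x (\<lambda>h. \<sigma> ?z (\<lambda>x. ?f (h \<otimes> x))) = \<sigma> (br (\<pi> ?z) (\<pi> ?x)) ?f"
    using left_derivatives_commutator_K[OF \<pi>_in_k \<pi>_in_k f', of ?z ?x] by (simp add: \<sigma>\<pi>)
  have "toda X k (\<lambda>q. toda Z q f) - toda Z k (\<lambda>q. toda X q f)
      = \<sigma> (br (\<pi> ?x) ?z) ?f - \<sigma> (br (\<pi> ?z) ?x) ?f + \<sigma> (br (\<pi> ?z) (\<pi> ?x)) ?f"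
    unfolding toda_toda[OF k f] c[symmetric] by simp
  also have "\<dots> = \<sigma> (br (\<pi> ?x) ?z - br (\<pi> ?z) ?x - br (\<pi> ?x) (\<pi> ?z)) ?f"
    using br_skew[of "\<pi> ?z" "\<pi> ?x"]
    by (simp add: linear_add[OF linear_\<sigma>] linear_diff[OF linear_\<sigma>] linear_neg[OF linear_\<sigma>])
  also have "\<dots> = \<sigma> (br ?x ?z) ?f"
  proof -
    have "\<pi> (br (\<pi> ?x) ?z - br (\<pi> ?z) ?x - br (\<pi> ?x) (\<pi> ?z)) = \<pi> (br ?x ?z)"
      unfolding \<pi>_br[of ?x ?z] by (simp add: linear_diff[OF linear_\<pi>] \<pi>_k[OF br_k[OF \<pi>_in_k \<pi>_in_k]])
    then show ?thesis by (simp add: \<sigma>_def)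
  qed
  also have "\<dots> = toda (br X Z) k f"
    by (simp add: toda_apply[OF k f] Ad_br[OF K_carrier[OF k]])
  finally show ?thesis .
qed

end


section \<open>Matrix coefficients\<close>

locale toda_representation = toda_data br \<theta> A P G S \<iota> K SK
  for br :: "'a::euclidean_space \<Rightarrow> 'a \<Rightarrow> 'a" and \<theta> :: "'a \<Rightarrow> 'a"
    and A :: "'a set" and P :: "('a \<Rightarrow> real) set"
    and G :: "('g, 'r) monoid_scheme" (structure) and S :: "('g, 'e::euclidean_space) manifold"
    and \<iota> :: "'a \<Rightarrow> 'g tangent"
    and K :: "'g set" and SK :: "('g, 'f::euclidean_space) manifold" +
  fixes \<rho> :: "'a \<Rightarrow> 'v::euclidean_space \<Rightarrow> 'v" and R :: "'g \<Rightarrow> 'v \<Rightarrow> 'v" and v0 :: 'v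
  assumes int: "integrates_to G S \<iota> \<rho> R" and inner: "adapted_inner \<theta> K \<rho> R"
    and bottom: "bottom_weight_representation br A P \<rho> v0"
begin

lemma linear_\<rho>: "linear (\<lambda>X. \<rho> X x)"
  using bottom unfolding bottom_weight_representation_def lie_representation_def by blast

lemma R_one: "R \<one> x = x"
  and R_mult: "g \<in> carrier G \<Longrightarrow> h \<in> carrier G \<Longrightarrow> R (g \<otimes> h) x = R g (R h x)"
  and R_smooth: "smooth_map S \<E> (\<lambda>g. R g x)"
  and \<iota>_R: "\<iota> X (\<lambda>g. R g x \<bullet> y) = \<rho> X x \<bullet> y"
  using int unfolding integrates_to_def by blast+

lemma R_orthogonal: "k \<in> K \<Longrightarrow> R k x \<bullet> R k y = x \<bullet> y"
  and \<rho>_symmetric: "L \<in> cartan_p \<theta> \<Longrightarrow> \<rho> L x \<bullet> y = x \<bullet> \<rho> L y"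
  and \<rho>_skew: "X \<in> \<kk> \<Longrightarrow> \<rho> X x \<bullet> y = - (x \<bullet> \<rho> X y)"
  using inner unfolding adapted_inner_def by blast+

lemma R_inv: "g \<in> carrier G \<Longrightarrow> R g (R (inv g) x) = x" "g \<in> carrier G \<Longrightarrow> R (inv g) (R g x) = x"
  by (simp_all add: R_one flip: R_mult)

lemma smooth_near_coeff:
  assumes "g \<in> carrier G"
  shows "smooth_near S g (\<lambda>g. R g x \<bullet> y)"
proof -
  have "smooth_map_at S \<E> g (\<lambda>g. R g x)"
    by (rule smooth_map_imp_at[OF ch charted_euclidean[OF open_UNIV] R_smooth])
  then have "smooth_map_at S \<E> g (\<lambda>g. R g x \<bullet> y)"
    by (rule smooth_at_bounded_linear[OF ch _ bounded_linear_inner_left])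
  then show ?thesis using assms by (simp add: smooth_near_iff[OF manifold] topspace_carrier)
qed

text \<open>The neighbourhood is open for the topology of \<open>SK\<close>; continuity passes
  through the inclusion into G.\<close>

lemma coeff_nonzero_open:
  assumes "k \<in> K" "R k x \<bullet> y \<noteq> 0"
  obtains W where "openin (mtop SK) W" "k \<in> W" "\<And>q. q \<in> W \<Longrightarrow> R q x \<bullet> y \<noteq> 0"
proof -
  have c1: "continuous_map (mtop SK) (mtop S) (\<lambda>x. x)"
    using sub unfolding lie_subgroup_def smooth_map_def by simp
  have c2: "continuous_map (mtop S) euclidean (\<lambda>g. R g x)"
    using R_smooth[of x] unfolding smooth_map_def by simp
  have c3: "continuous_map euclidean euclidean (\<lambda>z. z \<bullet> y)"
    by (simp add: continuous_on_inner)
  have c: "continuous_map (mtop SK) euclidean (\<lambda>g. R g x \<bullet> y)"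
    using continuous_map_compose[OF continuous_map_compose[OF c1 c2] c3] by (simp add: o_def)
  have "openin (mtop SK) {q \<in> topspace (mtop SK). R q x \<bullet> y \<in> - {0}}"
    by (rule openin_continuous_map_preimage[OF c]) (simp add: open_Compl)
  then show ?thesis by (rule that) (use assms K_topspace in auto)
qed

text \<open>Conjugating inside R gives \<rho>(Ad_k X) = R_k \<rho>(X) R_k^-1; orthogonality of R_k
  moves the outer factor to the other side of the inner product.\<close>

lemma \<rho>_Ad:
  assumes k: "k \<in> K"
  shows "\<rho> (AD k X) x \<bullet> y = \<rho> X (R (inv k) x) \<bullet> R (inv k) y"
proof -
  note kG = K_carrier[OF k]
  have "\<rho> (AD k X) x \<bullet> y = \<iota> X (\<lambda>h. R (conjg k h) x \<bullet> y)"
    unfolding \<iota>_R[symmetric] by (rule \<iota>_Ad_apply[OF kG smooth_near_coeff[OF one_closed]])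
  also have "\<dots> = \<iota> X (\<lambda>h. R h (R (inv k) x) \<bullet> R (inv k) y)"
  proof (rule tangent_cong[OF manifold \<iota>_T1 openin_carrier one_closed])
    fix h assume h: "h \<in> carrier G"
    have "R (conjg k h) x \<bullet> y = R k (R h (R (inv k) x)) \<bullet> R k (R (inv k) y)"
      using kG h by (simp add: conjg_def R_mult R_inv)
    then show "R (conjg k h) x \<bullet> y = R h (R (inv k) x) \<bullet> R (inv k) y"
      by (simp add: R_orthogonal[OF k])
  qed
  finally show ?thesis by (simp add: \<iota>_R)
qed

lemma toda_coeff:
  assumes k: "k \<in> K"
  shows "toda X k (\<lambda>q. R q x \<bullet> y) = \<rho> (\<pi> (AD k X)) (R k x) \<bullet> y"
proof -
  have "toda X k (\<lambda>q. R q x \<bullet> y) = \<sigma> (AD k X) (\<lambda>h. R (h \<otimes> k) x \<bullet> y)"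
    by (rule toda_apply[OF k smooth_near_restrict[OF k smooth_near_coeff[OF K_carrier[OF k]]]])
  also have "\<dots> = \<sigma> (AD k X) (\<lambda>h. R h (R k x) \<bullet> y)"
    by (rule tangent_cong[OF K.manifold \<sigma>_TK K_openin K_one]) (simp add: R_mult K_carrier k)
  also have "\<dots> = \<rho> (\<pi> (AD k X)) (R k x) \<bullet> y"
    by (simp add: \<sigma>_apply[OF smooth_near_coeff[OF one_closed]] \<iota>_R)
  finally show ?thesis .
qed

text \<open>Generators in A act on \<open>v0\<close> by the bottom weight and those in the root
  spaces by 0; scalars add along the span.\<close>

lemma b_eigenvector:
  assumes "X \<in> \<bb>"
  obtains c where "\<rho> X v0 = c *\<^sub>R v0"
proof -
  obtain \<omega> where \<omega>: "\<And>H. H \<in> A \<Longrightarrow> \<rho> H v0 = \<omega> H *\<^sub>R v0"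
    using bottom unfolding bottom_weight_representation_def by blast
  have n: "\<rho> X v0 = 0" if "\<alpha> \<in> P" "X \<in> root_space br A (\<lambda>H. - \<alpha> H)" for X \<alpha>
    using bottom that unfolding bottom_weight_representation_def by blast
  have "\<exists>c. \<rho> X v0 = c *\<^sub>R v0"
    using assms unfolding b_minus_def
  proof (induction rule: span_induct_alt)
    case base
    then show ?case using linear_0[OF linear_\<rho>] by (intro exI[of _ 0]) simp
  next
    case (step c x y)
    obtain d where d: "\<rho> y v0 = d *\<^sub>R v0" using step(2) by blast
    obtain e where "\<rho> x v0 = e *\<^sub>R v0"
    proof (cases "x \<in> A")
      case True
      then show ?thesis using \<omega> that by blast
    next
      case False
      then have "\<rho> x v0 = 0 *\<^sub>R v0" using step(1) n by auto
      then show ?thesis using that by blast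
    qed
    then have "\<rho> (c *\<^sub>R x + y) v0 = (c * e + d) *\<^sub>R v0"
      using d by (simp add: linear_add[OF linear_\<rho>] linear_scale[OF linear_\<rho>] scaleR_add_left)
    then show ?case by blast
  qed
  then show ?thesis using that by blast
qed

text \<open>The factor \<open>c\<close>, the value of the character of \<open>\<bb>\<^sub>-\<close> on \<open>v0\<close>, does not depend on the weight vector,
  so that it cancels in quotients of matrix coefficients.\<close>

lemma toda_weight_coeff:
  assumes k: "k \<in> K" and \<Lambda>: "\<Lambda> \<in> A"
  obtains c where "\<And>w \<omega>. \<rho> \<Lambda> w = \<omega> *\<^sub>R w \<Longrightarrow>
      toda \<Lambda> k (\<lambda>q. R q w \<bullet> v0) = (c - \<omega>) * (R k w \<bullet> v0)"
proof -
  let ?x = "AD k \<Lambda>"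
  note kG = K_carrier[OF k]
  obtain c where c: "\<rho> (?x - \<pi> ?x) v0 = c *\<^sub>R v0" using b_eigenvector[OF \<pi>_diff_in_b] .
  have \<Lambda>p: "\<Lambda> \<in> cartan_p \<theta>" using A_p[OF \<Lambda>] by (simp add: cartan_p_def)
  have "toda \<Lambda> k (\<lambda>q. R q w \<bullet> v0) = (c - \<omega>) * (R k w \<bullet> v0)" if w: "\<rho> \<Lambda> w = \<omega> *\<^sub>R w" for w \<omega>
  proof -
    have "R k w \<bullet> \<rho> ?x v0 = \<rho> ?x v0 \<bullet> R k w" by (rule inner_commute)
    \<comment> \<open>Conjugation turns \<open>\<rho> ?x\<close> into
      \<open>\<rho> \<Lambda>\<close>, which is symmetric because \<Lambda> lies in p and so can be
      moved onto its eigenvector w.\<close>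
    also have "\<dots> = \<rho> \<Lambda> (R (inv k) v0) \<bullet> w" by (simp add: \<rho>_Ad[OF k] R_inv[OF kG])
    also have "\<dots> = \<omega> * (R (inv k) v0 \<bullet> w)" by (simp add: \<rho>_symmetric[OF \<Lambda>p] w)
    also have "R (inv k) v0 \<bullet> w = R k w \<bullet> v0"
      using R_orthogonal[OF k, of "R (inv k) v0" w] R_inv[OF kG] by (simp add: inner_commute)
    finally have 1: "R k w \<bullet> \<rho> ?x v0 = \<omega> * (R k w \<bullet> v0)" .
    have 2: "\<rho> (\<pi> ?x) v0 = \<rho> ?x v0 - c *\<^sub>R v0"
      unfolding c[symmetric] linear_diff[OF linear_\<rho>] by simp
    have "R k w \<bullet> \<rho> (\<pi> ?x) v0 = \<omega> * (R k w \<bullet> v0) - c * (R k w \<bullet> v0)"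
      unfolding 2 by (simp add: inner_diff_right 1)
    \<comment> \<open>Skewness of \<open>\<rho> (\<pi> ?x)\<close> turns \<omega> - c into c -
      \<omega>.\<close>
    then show ?thesis
      unfolding toda_coeff[OF k] \<rho>_skew[OF \<pi>_in_k] by (simp add: left_diff_distrib)
  qed
  then show ?thesis using that by blast
qed

text \<open>The product rule is applied to F' = (F'/F) F near k and solved for the derivative of the
  quotient; the common c cancels and the difference of the weights remains.\<close>

lemma toda_weight_quotient:
  assumes k: "k \<in> K" and \<Lambda>: "\<Lambda> \<in> A" and w: "\<rho> \<Lambda> w = \<omega> *\<^sub>R w" "\<rho> \<Lambda> w' = \<omega>' *\<^sub>R w'"
    and nz: "R k w \<bullet> v0 \<noteq> 0"
  shows "toda \<Lambda> k (\<lambda>q. R q w' \<bullet> v0 / (R q w \<bullet> v0)) = (\<omega> - \<omega>') * (R k w' \<bullet> v0 / (R k w \<bullet> v0))"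
    "smooth_near SK k (\<lambda>q. R q w' \<bullet> v0 / (R q w \<bullet> v0))"
proof -
  let ?F = "\<lambda>q. R q w \<bullet> v0" and ?F' = "\<lambda>q. R q w' \<bullet> v0"
  let ?q = "\<lambda>q. ?F' q / ?F q"
  obtain c where c: "\<And>w \<omega>. \<rho> \<Lambda> w = \<omega> *\<^sub>R w \<Longrightarrow> toda \<Lambda> k (\<lambda>q. R q w \<bullet> v0) = (c - \<omega>) * (R k w \<bullet> v0)"
    using toda_weight_coeff[OF k \<Lambda>] by blast
  have s: "smooth_near SK k (\<lambda>q. R q x \<bullet> v0)" for x
    by (rule smooth_near_restrict[OF k smooth_near_coeff[OF K_carrier[OF k]]])
  show sq: "smooth_near SK k ?q"
    unfolding divide_inverse by (intro smooth_near_mult[OF K.manifold] smooth_near_inverse[OF K.manifold] s nz)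
  obtain W where W: "openin (mtop SK) W" "k \<in> W" "\<And>q. q \<in> W \<Longrightarrow> ?F q \<noteq> 0"
    using coeff_nonzero_open[OF k nz] by blast
  \<comment> \<open>The factorization holds on the neighbourhood W where the denominator has no
    zero, which suffices by locality.\<close>
  have "toda \<Lambda> k ?F' = toda \<Lambda> k (\<lambda>q. ?q q * ?F q)"
    by (rule tangent_cong[OF K.manifold toda_tangent[OF k] W(1,2)]) (simp add: W(3))
  also have "\<dots> = toda \<Lambda> k ?q * ?F k + ?q k * toda \<Lambda> k ?F"
    by (rule tangent_mult[OF K.manifold toda_tangent[OF k] sq s])
  finally have "(c - \<omega>') * ?F' k = toda \<Lambda> k ?q * ?F k + ?q k * ((c - \<omega>) * ?F k)"
    by (simp add: c[OF w(1)] c[OF w(2)])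
  moreover have "?q k * ((c - \<omega>) * ?F k) = (c - \<omega>) * ?F' k" using nz by simp
  ultimately have "toda \<Lambda> k ?q * ?F k = (\<omega> - \<omega>') * ?F' k" by (simp add: algebra_simps)
  then show "toda \<Lambda> k ?q = (\<omega> - \<omega>') * ?q k"
    using nz by (simp add: eq_divide_eq)
qed

end

theorem mainTheorem2:
  fixes sC :: "complex \<Rightarrow> 'c::ab_group_add \<Rightarrow> 'c" and brC :: "'c \<Rightarrow> 'c \<Rightarrow> 'c"
    and br :: "'a::euclidean_space \<Rightarrow> 'a \<Rightarrow> 'a" and \<kappa> :: "'a \<Rightarrow> 'c"
    and \<theta> :: "'a \<Rightarrow> 'a" and A :: "'a set" and P :: "('a \<Rightarrow> real) set"
    and G :: "'g monoid" and SG :: "('g, 'e::euclidean_space) manifold"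
    and \<iota> :: "'a \<Rightarrow> 'g tangent"
    and K :: "'g set" and SK :: "('g, 'f::euclidean_space) manifold"
    and \<rho> :: "'a \<Rightarrow> 'v::euclidean_space \<Rightarrow> 'v" and R :: "'g \<Rightarrow> 'v \<Rightarrow> 'v"
    and v :: "nat \<Rightarrow> 'v" and \<omega> :: "nat \<Rightarrow> 'a \<Rightarrow> real"
    and \<alpha> :: "'a \<Rightarrow> real" and e :: 'a and i j :: nat
  assumes "noncompact_real_form sC brC br \<kappa>" and "lie_algebra.semisimple sC brC"
    and "cartan_involution br \<theta>"
    and "maximal_commutative_subspace br (cartan_p \<theta>) A"
    and "positive_roots br A P"
    and "lie_group G SG" and "simply_connected_space (mtop SG)" and "lie_algebra_iso br G SG \<iota>"
    and "lie_subgroup G SG K SK" and "connected_space (mtop SK)"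
    and "subgroup_lie_algebra G SG \<iota> SK = cartan_k \<theta>"
    and "bottom_weight_representation br A P \<rho> (v 1)"
    and "integrates_to G SG \<iota> \<rho> R"
    and "adapted_inner \<theta> K \<rho> R"
    and "adapted_basis A \<rho> v \<omega>"
    and "\<alpha> \<in> roots br A" and "e \<in> root_space br A \<alpha>"
    and "i \<in> {1..DIM('v)}" and "j \<in> {1..DIM('v)}"
    and "\<forall>H\<in>A. \<omega> j H - \<omega> i H = \<alpha> H"
  shows "\<forall>\<Lambda>\<in>A. \<forall>k\<in>{k\<in>K. matrix_coeff R v i k \<noteq> 0}.
    vf_bracket SK
      (toda_field br \<theta> A P G SG \<iota> SK \<Lambda>)
      (\<lambda>q f. matrix_coeff R v j q / matrix_coeff R v i q *
             toda_field br \<theta> A P G SG \<iota> SK e q f) k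
    = (\<lambda>f. 0)"
proof (intro ballI ext)
  fix \<Lambda> k f
  assume \<Lambda>: "\<Lambda> \<in> A" and kF: "k \<in> {k \<in> K. matrix_coeff R v i k \<noteq> 0}"
  have "lie_algebra (*\<^sub>R) br"
    using assms(1) unfolding noncompact_real_form_def real_form_def by blast
  then interpret toda_representation br \<theta> A P G SG \<iota> K SK \<rho> R "v 1"
    by (intro toda_representation.intro toda_data.intro cartan_data.intro lie_subgroup_with_algebra.intro
        lie_group_with_algebra.intro lie_grp.intro toda_representation_axioms.intro toda_data_axioms.intro
        lie_subgroup_with_algebra_axioms.intro lie_group_with_algebra_axioms.intro assms)
  have k: "k \<in> K" and nz: "R k (v i) \<bullet> v 1 \<noteq> 0" using kF by (simp_all add: matrix_coeff_def)
  let ?q = "\<lambda>q. R q (v j) \<bullet> v 1 / (R q (v i) \<bullet> v 1)"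
  have w: "\<rho> \<Lambda> (v i) = \<omega> i \<Lambda> *\<^sub>R v i" "\<rho> \<Lambda> (v j) = \<omega> j \<Lambda> *\<^sub>R v j"
    using assms(15,18,19) \<Lambda> unfolding adapted_basis_def by blast+
  have \<alpha>: "\<omega> i \<Lambda> - \<omega> j \<Lambda> = - \<alpha> \<Lambda>" using assms(20) \<Lambda> by force
  note q = toda_weight_quotient[OF k \<Lambda> w nz]
  show "vf_bracket SK (toda \<Lambda>) (\<lambda>q f. matrix_coeff R v j q / matrix_coeff R v i q * toda e q f) k f = 0"
  proof (cases "smooth_near SK k f")
    case True
    have "toda \<Lambda> k (\<lambda>q. ?q q * toda e q f)
        = toda \<Lambda> k ?q * toda e k f + ?q k * toda \<Lambda> k (\<lambda>q. toda e q f)"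
      by (rule tangent_mult[OF K.manifold toda_tangent[OF k] q(2) smooth_near_toda[OF k True]])
    moreover have "toda \<Lambda> k ?q = - \<alpha> \<Lambda> * ?q k" unfolding q(1) \<alpha> ..
    \<comment> \<open>The root equation [\<Lambda>, e] = \<alpha>(\<Lambda>) e enters here; the
      field depends linearly on its vector.\<close>
    moreover have "toda (br \<Lambda> e) k f = \<alpha> \<Lambda> * toda e k f"
      using root_spaceD[OF assms(17) \<Lambda>]
      by (simp add: toda_apply[OF k True] linear_scale[OF linear_Ad[OF K_carrier[OF k]]] linear_scale[OF linear_\<sigma>])
    \<comment> \<open>Only the derivative along \<Lambda> meets the quotient: in the other half of
      the bracket the factor is evaluated at k, outside the derivation by e.\<close>
    ultimately have "toda \<Lambda> k (\<lambda>q. ?q q * toda e q f) - ?q k * toda e k (\<lambda>q. toda \<Lambda> q f)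
        = - \<alpha> \<Lambda> * ?q k * toda e k f
          + ?q k * (toda \<Lambda> k (\<lambda>q. toda e q f) - toda e k (\<lambda>q. toda \<Lambda> q f))"
      by (simp only: right_diff_distrib)
    also have "\<dots> = 0"
      unfolding toda_bracket[OF k True] using \<open>toda (br \<Lambda> e) k f = _\<close> by simp
    finally show ?thesis using True by (simp add: vf_bracket_def matrix_coeff_def)
  next
    case False
    then show ?thesis by (simp add: vf_bracket_def)
  qed
qed

end
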